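(* For every $n\ge1$ there are constants $c_n\ge1$ and $C_n>0$, depending only on $n$, such that the following holds. Let $p\in(1,\infty)$, $q\in(0,\infty]$, and let $(v,w)\in A_p$ be a pair of weights on $\mathbb R^n$ with $\sigma:=w^{1-p'}\in A_\infty$. Then $$\|\mathrm M\|_{L^{p,q}(w)\to L^{p,q}(v)}\le C_n\, c_n\,p'\,[v,w]_{A_p}^{\frac1p}\,[\sigma]_{A_\infty}^{\frac1p}\qquad\text{if } p\le q\le\infty,$$ and $$\|\mathrm M\|_{L^{p,q}(w)\to L^{p,q}(v)}\le C_n\Big(\frac{4c_n}{q}\Big)^{\frac1q}(p')^{\frac1q}\,[v,w]_{A_p}^{\frac1p}\,[\sigma]_{A_\infty}^{\frac1q}\qquad\text{if } 0<q\le p.$$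
   Context: Cubes are cubes in $\mathbb R^n$. The Hardy–Littlewood maximal operator is $\mathrm Mf(x)=\sup_{Q\ni x}\frac1{|Q|}\int_Q|f(y)|\,dy$, the supremum over all cubes $Q$ containing $x$. A weight is a locally integrable function positive a.e.; $w(E)=\int_E w\,dx$. For $1<p<\infty$, $p'=\frac p{p-1}$. For two weights $v,w$, $(v,w)\in A_p$ means $$[v,w]_{A_p}:=\sup_Q\Big(\frac1{|Q|}\int_Q v\,dx\Big)\Big(\frac1{|Q|}\int_Q w^{1-p'}\,dx\Big)^{p-1}<\infty .$$ $A_\infty=\bigcup_{s>1}A_s$, where $w\in A_s$ means $(w,w)\in A_s$, and the $A_\infty$ constant is the Fujii–Wilson constant $$[w]_{A_\infty}:=\sup_Q\frac1{w(Q)}\int_Q\mathrm M(w\chi_Q)\,dx.$$ Lorentz spaces: for $p,q\in(0,\infty)$, $\|f\|_{L^{p,q}(w)}:=\big(p\int_0^\infty s^q\,w(\{|f|>s\})^{q/p}\frac{ds}s\big)^{1/q}$, and $\|f\|_{L^{p,\infty}(w)}:=\sup_{s>0}s\,w(\{|f|>s\})^{1/p}$. For function spaces $X,Y$, $\|\mathrm M\|_{X\to Y}:=\sup_{0\ne f\in X}\|\mathrm Mf\|_Y/\|f\|_X$. *)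

theory Defs
  imports "HOL-Analysis.Analysis"
begin

text \<open>
  Weights are real-valued functions on \<open>real ^ 'n\<close>; all quantities that may be infinite (averages,
  weight constants, maximal functions, Lorentz quasinorms) take values in \<open>ennreal\<close>, and every
  supremum is a supremum in \<open>ennreal\<close>.
\<close>

text \<open>
  Real powers on \<open>ennreal\<close>, only used for exponents \<open>a > 0\<close>, where \<open>0\<^sup>a = 0\<close> and
  \<open>\<infinity>\<^sup>a = \<infinity>\<close>.
\<close>

definition epowr :: "ennreal \<Rightarrow> real \<Rightarrow> ennreal" (infixr \<open>epowr\<close> 80)
  where "x epowr a = (if x = \<infinity> then \<infinity> else ennreal (enn2real x powr a))"

text \<open>
  Cubes are nondegenerate, closed and have sides parallel to the axes.
\<close>

definition cubes :: "(real ^ 'n) set set"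
  where "cubes = {cbox a (\<chi> i. a $ i + l) | a l. 0 < l}"

definition avg :: "(real ^ 'n) set \<Rightarrow> (real ^ 'n \<Rightarrow> real) \<Rightarrow> ennreal"
  where "avg Q f = (\<integral>\<^sup>+x\<in>Q. ennreal \<bar>f x\<bar> \<partial>lebesgue) / emeasure lebesgue Q"

definition maximal :: "(real ^ 'n \<Rightarrow> real) \<Rightarrow> real ^ 'n \<Rightarrow> ennreal"
  where "maximal f x = (SUP Q\<in>{Q \<in> cubes. x \<in> Q}. avg Q f)"

definition is_weight :: "(real ^ 'n \<Rightarrow> real) \<Rightarrow> bool"
  where "is_weight w \<longleftrightarrow>
    (\<forall>K. compact K \<longrightarrow> w absolutely_integrable_on K) \<and> (AE x in lebesgue. 0 < w x)"

definition weighted :: "(real ^ 'n \<Rightarrow> real) \<Rightarrow> (real ^ 'n) measure"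
  where "weighted w = density lebesgue (\<lambda>x. ennreal (w x))"

definition conj_exp :: "real \<Rightarrow> real"
  where "conj_exp p = p / (p - 1)"

definition dual_weight :: "real \<Rightarrow> (real ^ 'n \<Rightarrow> real) \<Rightarrow> real ^ 'n \<Rightarrow> real"
  where "dual_weight p w = (\<lambda>x. w x powr (1 - conj_exp p))"

definition Ap_const :: "real \<Rightarrow> (real ^ 'n \<Rightarrow> real) \<Rightarrow> (real ^ 'n \<Rightarrow> real) \<Rightarrow> ennreal"
  where "Ap_const p v w = (SUP Q\<in>cubes. avg Q v * avg Q (dual_weight p w) epowr (p - 1))"

definition Ap :: "real \<Rightarrow> ((real ^ 'n \<Rightarrow> real) \<times> (real ^ 'n \<Rightarrow> real)) set"
  where "Ap p = {(v, w). is_weight v \<and> is_weight w \<and> Ap_const p v w < \<infinity>}"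

definition A_infty :: "(real ^ 'n \<Rightarrow> real) set"
  where "A_infty = (\<Union>s\<in>{1<..}. {w. (w, w) \<in> Ap s})"

definition A_infty_const :: "(real ^ 'n \<Rightarrow> real) \<Rightarrow> ennreal"
  where "A_infty_const w =
    (SUP Q\<in>cubes. (\<integral>\<^sup>+x\<in>Q. maximal (\<lambda>y. w y * indicator Q y) x \<partial>lebesgue)
                    / emeasure (weighted w) Q)"

text \<open>
  The quasinorm depends on a function only through its absolute value, so it is defined for
  functions with values in \<open>ennreal\<close>; this also covers maximal functions, which may be infinite.
\<close>

definition lorentz_norm ::
    "real \<Rightarrow> ennreal \<Rightarrow> (real ^ 'n \<Rightarrow> real) \<Rightarrow> (real ^ 'n \<Rightarrow> ennreal) \<Rightarrow> ennreal"
  where "lorentz_norm p q w g =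
    (if q = \<infinity>
     then (SUP s\<in>{0<..}. ennreal s * emeasure (weighted w) {x. ennreal s < g x} epowr (1 / p))
     else (ennreal p *
           (\<integral>\<^sup>+s\<in>{0<..}. ennreal (s powr enn2real q) *
               emeasure (weighted w) {x. ennreal s < g x} epowr (enn2real q / p) / ennreal s
             \<partial>lborel)) epowr (1 / enn2real q))"

definition lorentz_space ::
    "real \<Rightarrow> ennreal \<Rightarrow> (real ^ 'n \<Rightarrow> real) \<Rightarrow> (real ^ 'n \<Rightarrow> real) set"
  where "lorentz_space p q w =
    {f \<in> borel_measurable lebesgue. lorentz_norm p q w (\<lambda>x. ennreal \<bar>f x\<bar>) < \<infinity>}"

text \<open>
  The norm of the maximal operator from \<open>L\<^sup>p\<^sup>,\<^sup>q(w)\<close> to \<open>L\<^sup>p\<^sup>,\<^sup>q(v)\<close>; functions that vanish almost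
  everywhere represent \<open>0\<close> and are excluded.
\<close>

definition maximal_norm ::
    "real \<Rightarrow> ennreal \<Rightarrow> (real ^ 'n \<Rightarrow> real) \<Rightarrow> (real ^ 'n \<Rightarrow> real) \<Rightarrow> ennreal"
  where "maximal_norm p q w v =
    (SUP f\<in>{f \<in> lorentz_space p q w. \<not> (AE x in lebesgue. f x = 0)}.
       lorentz_norm p q v (maximal f) / lorentz_norm p q w (\<lambda>x. ennreal \<bar>f x\<bar>))"

end

theory Submission
  imports Defs
begin

text \<open>
  The proof improves the exponent and then interpolates. Write \<open>\<sigma>\<close> for the dual weight, let
  \<open>S\<close> be its Fujii--Wilson constant, and put \<open>d = 1 / (2\<^bsup>n + 2\<^esup> S)\<close>. The reverse Hoelder inequality
  (\<open>reverse_Hoelder\<close>) says that the average of \<open>\<sigma>\<^bsup>1 + d\<^esup>\<close> over a cube is at most twice the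
  \<open>(1 + d)\<close>-th power of the average of \<open>\<sigma>\<close>. Hence \<open>(v, w) \<in> A\<^sub>p\<close> implies \<open>(v, w) \<in> A\<^sub>P\<close> for
  \<open>P = 1 + (p - 1) / (1 + d) < p\<close>, with \<open>\<sigma>\<^bsup>1 + d\<^esup>\<close> as dual weight and essentially the same
  constant. The gap \<open>p - P\<close> is comparable to \<open>(p - 1) / S\<close>, which is where the factor
  \<open>p / (p - P) \<le> c p' S\<close> of the theorem comes from.

  The class \<open>A\<^sub>P\<close> gives a weak type \<open>(P, P)\<close> estimate (\<open>weak_type_two_weight\<close>), which needs only a
  covering argument and Jensen's inequality. Applied to the part of \<open>f\<close> above height \<open>s\<close>, cut into dyadic
  layers, it bounds \<open>v {Mf > 2 s}\<close> by a constant times \<open>\<Sum>k. 2\<^bsup>k P\<^esup> w {|f| > 2\<^sup>k s}\<close>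
  (\<open>maximal_distribution_le\<close>). In terms of \<open>N(s) = s\<^sup>p v {Mf > s}\<close> and \<open>\<mu>(s) = s\<^sup>p w {|f| > s}\<close> this
  reads \<open>N(2 s) \<le> D \<Sum>k. 2\<^bsup>- k (p - P)\<^esup> \<mu>(2\<^sup>k s)\<close>. The \<open>p\<close>-th power of a Lorentz
  quasinorm is, up to a factor, the quasinorm of \<open>N\<close> or \<open>\<mu>\<close> in \<open>L\<^bsup>q / p\<^esup>(ds / s)\<close>, which dilations preserve, so only the geometric weights have to be summed: convexity of
  the power \<open>q / p\<close> gives the first bound, its subadditivity gives the second.

  The reverse Hoelder inequality is proved with the dyadic maximal function \<open>G\<close> of \<open>\<sigma>\<close> inside a cube. On
  the maximal dyadic cells where the average exceeds \<open>t\<close>, both \<open>\<integral> \<sigma>\<close> and \<open>\<integral> G\<close> are at most a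
  multiple of \<open>t\<close> times the volume: the first because the parent cell has average at most \<open>t\<close>, the second by the
  definition of the Fujii--Wilson constant. Summing these estimates over dyadic levels \<open>t\<close> bounds
  \<open>\<integral> G\<^bsup>1 + d\<^esup>\<close> by itself with a factor proportional to \<open>d S\<close>, so that it can be absorbed. The bound passes from
  dyadic averages to \<open>\<sigma>\<close> by approximation with continuous functions.
\<close>

section \<open>Real powers of extended nonnegative reals\<close>

lemma epowr_ennreal: "0 \<le> x \<Longrightarrow> ennreal x epowr a = ennreal (x powr a)"
  by (simp add: epowr_def)

lemma epowr_top [simp]: "\<infinity> epowr a = \<infinity>" "top epowr a = top"
  by (simp_all add: epowr_def)

lemma epowr_zero [simp]: "0 epowr a = 0"
  by (simp add: epowr_def)

lemma epowr_one [simp]: "x epowr 1 = x"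
  by (cases x) (auto simp: epowr_ennreal)

lemma epowr_eq_0_iff [simp]: "x epowr a = 0 \<longleftrightarrow> x = 0"
  by (cases x) (auto simp: epowr_ennreal)

lemma epowr_eq_top_iff [simp]: "x epowr a = top \<longleftrightarrow> x = top"
  by (cases x) (auto simp: epowr_ennreal)

lemma epowr_mono: "x \<le> y \<Longrightarrow> 0 \<le> a \<Longrightarrow> x epowr a \<le> y epowr a"
  by (cases x; cases y) (auto simp: epowr_ennreal top_unique intro!: ennreal_leI powr_mono2)

lemma epowr_mult: "(x * y) epowr a = x epowr a * y epowr a"
proof (cases "x = top \<or> y = top")
  case True
  then show ?thesis
    by (cases "x = 0"; cases "y = 0") (auto simp: ennreal_top_mult ennreal_mult_top)
next
  case False
  then obtain r s where "x = ennreal r" "0 \<le> r" "y = ennreal s" "0 \<le> s"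
    by (metis ennreal_cases infinity_ennreal_def)
  then show ?thesis
    by (simp add: epowr_ennreal powr_mult flip: ennreal_mult)
qed

lemma epowr_epowr: "(x epowr a) epowr b = x epowr (a * b)"
  by (cases x) (auto simp: epowr_ennreal powr_powr)

lemma epowr_add: "x epowr a * x epowr b = x epowr (a + b)"
  by (cases x) (auto simp: epowr_ennreal powr_add ennreal_top_mult simp flip: ennreal_mult)

lemma epowr_mult_self: "x epowr a * x = x epowr (a + 1)"
  using epowr_add[of x a 1] by simp

lemma borel_measurable_epowr [measurable (raw)]:
  assumes [measurable]: "f \<in> borel_measurable M"
  shows "(\<lambda>x. f x epowr a) \<in> borel_measurable M"
  unfolding epowr_def by measurable

section \<open>Jensen's inequality\<close>

text \<open>
  The graph of \<open>x \<mapsto> x\<^sup>r\<close> lies above its tangent at \<open>y\<close>. The linear form in \<open>x\<close> can be integrated term by term,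
  which gives Jensen's inequality below and linearises powers in later limit arguments.
\<close>

lemma Young_tangent:
  fixes x y r :: real
  assumes "1 < r" "0 \<le> x" "0 < y"
  shows "r * x * y powr (r - 1) \<le> x powr r + (r - 1) * y powr r"
proof -
  have "x * y powr (r - 1) \<le> x powr r / r + (y powr (r - 1)) powr (r / (r - 1)) / (r / (r - 1))"
    using assms by (intro Youngs_inequality) (auto simp: field_simps)
  moreover have "(r - 1) * (r / (r - 1)) = r"
    using assms by simp
  ultimately have "x * y powr (r - 1) \<le> x powr r / r + y powr r * (r - 1) / r"
    using assms by (simp add: powr_powr)
  then show ?thesis
    using assms by (simp add: field_simps)
qed

lemma Young_tangent_ennreal:
  fixes x y :: ennreal
  assumes "1 < r"
  shows "ennreal r * x * y epowr (r - 1) \<le> x epowr r + ennreal (r - 1) * y epowr r"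
proof (cases "x = top \<or> y = top \<or> y = 0")
  case False
  then obtain a b where "x = ennreal a" "0 \<le> a" "y = ennreal b" "0 < b"
    by (metis ennreal_cases infinity_ennreal_def less_eq_real_def ennreal_0)
  then show ?thesis using assms Young_tangent[of r a b]
    by (auto simp: epowr_ennreal simp flip: ennreal_mult ennreal_plus intro!: ennreal_leI)
qed (use assms in \<open>auto simp: ennreal_mult_top\<close>)

text \<open>
  Integrating the tangent inequality at a suitable constant \<open>y\<close> gives the claim. The measure is not
  normalised, so this form contains Hoelder's inequality.
\<close>

lemma nn_integral_epowr_le:
  assumes r: "1 < r" and [measurable]: "g \<in> borel_measurable M"
  shows "(\<integral>\<^sup>+x. g x \<partial>M) epowr r \<le> (\<integral>\<^sup>+x. g x epowr r \<partial>M) * emeasure M (space M) epowr (r - 1)"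
proof -
  let ?I = "\<integral>\<^sup>+x. g x \<partial>M" and ?J = "\<integral>\<^sup>+x. g x epowr r \<partial>M" and ?m = "emeasure M (space M)"
  consider "?J = 0" | "?m = 0" | "?J \<noteq> 0" "?m \<noteq> 0" "?J = top \<or> ?m = top"
    | "?J \<noteq> 0" "?m \<noteq> 0" "?J \<noteq> top" "?m \<noteq> top" by blast
  then show ?thesis
  proof cases
    case 1
    then have "AE x in M. g x = 0" by (subst (asm) nn_integral_0_iff_AE) auto
    then have "?I = 0" by (subst nn_integral_0_iff_AE) auto
    then show ?thesis by simp
  next
    case 2
    then have "AE x in M. g x = 0" by (intro AE_I[of _ _ "space M"]) auto
    then have "?I = 0" by (subst nn_integral_0_iff_AE) auto
    then show ?thesis by simp
  next
    case 3
    then show ?thesis by (auto simp: ennreal_top_mult ennreal_mult_top)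
  next
    case 4
    then obtain J m where J: "?J = ennreal J" "0 < J" and m: "?m = ennreal m" "0 < m"
      by (metis ennreal_cases infinity_ennreal_def less_eq_real_def ennreal_0)
    \<comment> \<open>the tangent point that makes the two terms on the right balance\<close>
    define y where "y = (J / m) powr (1 / r)"
    have y: "0 < y" "y powr r = J / m" using J m r by (auto simp: y_def powr_powr)
    have "ennreal (r * y powr (r - 1)) * ?I = (\<integral>\<^sup>+x. ennreal r * g x * ennreal y epowr (r - 1) \<partial>M)"
      using r y by (subst nn_integral_cmult[symmetric])
        (auto simp: epowr_ennreal ennreal_mult mult_ac intro!: nn_integral_cong)
    also have "\<dots> \<le> (\<integral>\<^sup>+x. g x epowr r + ennreal (r - 1) * ennreal y epowr r \<partial>M)"
      using r by (intro nn_integral_mono Young_tangent_ennreal) auto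
    also have "\<dots> = ?J + ennreal (r - 1) * ennreal (J / m) * ?m"
      using y by (subst nn_integral_add) (auto simp: epowr_ennreal)
    also have "\<dots> = ennreal (r * J)"
      using J m r by (simp add: field_simps flip: ennreal_mult ennreal_plus)
    finally have le: "ennreal (r * y powr (r - 1)) * ?I \<le> ennreal (r * J)" .
    have "?I \<noteq> top"
      using le r y by (auto simp: ennreal_mult_top top_unique)
    then obtain I where I: "?I = ennreal I" "0 \<le> I"
      by (metis ennreal_cases infinity_ennreal_def)
    from le have "r * y powr (r - 1) * I \<le> r * J"
      using r y I J by (auto simp flip: ennreal_mult)
    then have "y powr (r - 1) * I \<le> J" using r by simp
    then have "I \<le> J * y / (y powr (r - 1) * y)" using y by (simp add: field_simps)
    also have "y powr (r - 1) * y = J / m" using y by (simp add: powr_diff)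
    finally have "I \<le> m * y" using J m by (simp add: mult.commute)
    then have "I powr r \<le> (m * y) powr r" using I r by (intro powr_mono2) auto
    also have "\<dots> = J * m powr (r - 1)" using y m by (simp add: powr_mult powr_diff)
    finally show ?thesis using I J m by (simp add: epowr_ennreal flip: ennreal_mult)
  qed
qed


(* This rewrite rule would hide the Lebesgue measure of a cube behind its main part. *)
declare emeasure_completion [simp del]

section \<open>Cubes\<close>

definition cube :: "real ^ 'n \<Rightarrow> real \<Rightarrow> (real ^ 'n) set"
  where "cube a l = cbox a (\<chi> i. a $ i + l)"

lemma mem_cube: "x \<in> cube a l \<longleftrightarrow> (\<forall>i. a $ i \<le> x $ i \<and> x $ i \<le> a $ i + l)"
  by (simp add: cube_def mem_box_cart)

lemma cubes_eq: "cubes = {cube a l | a l. 0 < l}"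
  by (auto simp: cubes_def cube_def)

lemma cube_in_cubes [simp]: "0 < l \<Longrightarrow> cube a l \<in> cubes"
  by (auto simp: cubes_eq)

lemma sets_cube [measurable, simp]: "cube a l \<in> sets lebesgue"
  by (simp add: cube_def)

lemma emeasure_cube:
  assumes "0 \<le> l"
  shows "emeasure lebesgue (cube (a :: real ^ 'n) l) = ennreal (l ^ CARD('n))"
proof -
  have "a \<in> cube a l" using assms by (simp add: mem_cube)
  then have "measure lborel (cube a l) = l ^ CARD('n)"
    by (subst cube_def, subst content_cbox_cart) (auto simp: cube_def)
  then show ?thesis
    using emeasure_lborel_cbox_finite[of a "\<chi> i. a $ i + l"]
    by (simp add: cube_def emeasure_completion emeasure_eq_ennreal_measure)
qed

lemma emeasure_cubes:
  assumes "Q \<in> cubes"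
  shows "emeasure lebesgue Q \<noteq> 0" "emeasure lebesgue Q \<noteq> top" "Q \<in> sets lebesgue"
  using assms by (auto simp: cubes_eq emeasure_cube)

lemma avg_le_maximal: "x \<in> Q \<Longrightarrow> Q \<in> cubes \<Longrightarrow> avg Q f \<le> maximal f x"
  unfolding maximal_def by (intro SUP_upper) auto

section \<open>A covering argument for the maximal operator\<close>

abbreviation triple :: "(real ^ 'n) \<times> real \<Rightarrow> (real ^ 'n) set"
  where "triple Q \<equiv> cube (fst Q - (\<chi> i. snd Q)) (3 * snd Q)"

text \<open>
  Sides are compared in the maximum metric, where a cube that meets a cube of at least the same side lies within
  distance one side of it.
\<close>

lemma cube_subset_triple:
  assumes "cube b m \<inter> cube a l \<noteq> {}" "m \<le> l"
  shows "cube b m \<subseteq> triple (a, l)"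
proof
  fix x assume x: "x \<in> cube b m"
  obtain y where y: "y \<in> cube b m" "y \<in> cube a l" using assms(1) by auto
  show "x \<in> triple (a, l)"
    unfolding mem_cube
  proof
    fix i
    have "b $ i \<le> x $ i" "x $ i \<le> b $ i + m" "b $ i \<le> y $ i" "y $ i \<le> b $ i + m"
      "a $ i \<le> y $ i" "y $ i \<le> a $ i + l"
      using x y by (auto simp: mem_cube)
    then show "(fst (a, l) - (\<chi> i. snd (a, l))) $ i \<le> x $ i
      \<and> x $ i \<le> (fst (a, l) - (\<chi> i. snd (a, l))) $ i + 3 * snd (a, l)"
      using assms(2) by simp
  qed
qed

text \<open>
  Greedy selection: a cube of maximal side is kept, and every cube that it meets lies in its triple.
\<close>

lemma finite_Vitali_cubes:
  fixes F :: "((real ^ 'n) \<times> real) set"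
  assumes "finite F" "\<And>Q. Q \<in> F \<Longrightarrow> 0 < snd Q"
  shows "\<exists>G\<subseteq>F. disjoint_family_on (case_prod cube) G \<and> \<Union> (case_prod cube ` F) \<subseteq> \<Union> (triple ` G)"
  using assms
proof (induction "card F" arbitrary: F rule: less_induct)
  case less
  show ?case
  proof (cases "F = {}")
    case False
    then obtain a l where al: "(a, l) \<in> F" "\<And>Q. Q \<in> F \<Longrightarrow> snd Q \<le> l"
      using obtains_MAX[OF less.prems(1) False, of snd] less.prems(1)
      by (metis Max_ge finite_imageI imageI prod.collapse)
    define F' where "F' = {Q \<in> F. case_prod cube Q \<inter> cube a l = {}}"
    have ne: "a \<in> cube a l" using less.prems(2)[OF al(1)] by (simp add: mem_cube)
    have "F' \<subset> F" using al(1) ne by (auto simp: F'_def)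
    then obtain G where G: "G \<subseteq> F'" "disjoint_family_on (case_prod cube) G"
        "\<Union> (case_prod cube ` F') \<subseteq> \<Union> (triple ` G)"
      using less.hyps[of F'] less.prems by (meson finite_subset psubset_card_mono psubset_imp_subset subsetD)
    have "disjoint_family_on (case_prod cube) (insert (a, l) G)"
      using G(1,2) by (fastforce simp: disjoint_family_on_def F'_def)
    moreover have "case_prod cube Q \<subseteq> \<Union> (triple ` insert (a, l) G)" if "Q \<in> F" for Q
    proof (cases "Q \<in> F'")
      case True then show ?thesis using G(3) by auto
    next
      case False
      then have "cube (fst Q) (snd Q) \<subseteq> triple (a, l)"
        using that al(2) by (intro cube_subset_triple) (auto simp: F'_def case_prod_beta)
      then show ?thesis by (simp only: case_prod_beta image_insert Union_insert) (rule le_supI1)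
    qed
    ultimately show ?thesis
      using G(1) al(1) by (intro exI[of _ "insert (a, l) G"]) (auto simp: F'_def)
  qed (auto simp: disjoint_family_on_def)
qed

text \<open>
  Fattening a cube slightly keeps its average above \<open>t\<close>, so the level set is a union of interiors.
\<close>

lemma maximal_level_set_interiors:
  fixes f :: "real ^ 'n \<Rightarrow> real" and t :: real
  assumes t: "0 \<le> t"
  shows "{x. ennreal t < maximal f x}
    = (\<Union>Q\<in>{Q. 0 < snd Q \<and> ennreal t < avg (case_prod cube Q) f}. interior (case_prod cube Q))"
    (is "?U = (\<Union>Q\<in>?C. _)")
proof (intro equalityI subsetI)
  fix x assume "x \<in> (\<Union>Q\<in>?C. interior (case_prod cube Q))"
  then obtain a l where "0 < l" "ennreal t < avg (cube a l) f" "x \<in> cube a l"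
    using interior_subset by fastforce
  then show "x \<in> ?U"
    using avg_le_maximal[of x "cube a l" f] by auto
next
  fix x assume "x \<in> ?U"
  then obtain a l where al: "0 < l" "ennreal t < avg (cube a l) f" "x \<in> cube a l"
    by (auto simp: maximal_def less_SUP_iff cubes_eq)
  define I where "I = (\<integral>\<^sup>+x\<in>cube a l. ennreal \<bar>f x\<bar> \<partial>lebesgue)"
  have "ennreal (t * l ^ CARD('n)) < I"
  proof (rule ccontr)
    assume "\<not> ?thesis"
    then have "I / ennreal (l ^ CARD('n)) \<le> ennreal (t * l ^ CARD('n)) / ennreal (l ^ CARD('n))"
      by (intro divide_right_mono_ennreal) auto
    also have "\<dots> = ennreal t" using al(1) t by (simp add: divide_ennreal)
    finally show False using al by (simp add: avg_def emeasure_cube I_def)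
  qed
  moreover have "((\<lambda>h. ennreal (t * (l + 2 * h) ^ CARD('n))) \<longlongrightarrow> ennreal (t * (l + 2 * 0) ^ CARD('n)))
      (at_right 0)"
    by (intro tendsto_intros tendsto_ennrealI)
  ultimately have "eventually (\<lambda>h. ennreal (t * (l + 2 * h) ^ CARD('n)) < I) (at_right 0)"
    by (intro order_tendstoD(2)[where y = "ennreal (t * (l + 2 * 0) ^ CARD('n))"]) auto
  moreover have "eventually (\<lambda>h::real. 0 < h) (at_right 0)"
    by (simp add: eventually_at_right_less)
  ultimately obtain h where h: "0 < h" "ennreal (t * (l + 2 * h) ^ CARD('n)) < I"
    by (metis (mono_tags, lifting) eventually_conj eventually_happens trivial_limit_at_right_real)
  define b where "b = a - (\<chi> i. h)"
  have sub: "cube a l \<subseteq> cube b (l + 2 * h)"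
    using h(1) by (auto simp: mem_cube b_def algebra_simps) (smt (verit))+
  have "ennreal t < avg (cube b (l + 2 * h)) f"
  proof (rule ccontr)
    assume "\<not> ?thesis"
    then have "avg (cube b (l + 2 * h)) f * ennreal ((l + 2 * h) ^ CARD('n))
      \<le> ennreal t * ennreal ((l + 2 * h) ^ CARD('n))"
      by (intro mult_right_mono) auto
    moreover have "avg (cube b (l + 2 * h)) f * ennreal ((l + 2 * h) ^ CARD('n))
      = (\<integral>\<^sup>+x\<in>cube b (l + 2 * h). ennreal \<bar>f x\<bar> \<partial>lebesgue)"
      using al h by (simp add: avg_def emeasure_cube ennreal_divide_times ennreal_mult_divide_eq)
    moreover have "I \<le> (\<integral>\<^sup>+x\<in>cube b (l + 2 * h). ennreal \<bar>f x\<bar> \<partial>lebesgue)"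
      unfolding I_def using sub by (intro nn_integral_mono) (auto split: split_indicator)
    ultimately have "I \<le> ennreal t * ennreal ((l + 2 * h) ^ CARD('n))" by simp
    then show False using h al t by (simp flip: ennreal_mult)
  qed
  moreover have "x \<in> interior (cube b (l + 2 * h))"
    using al(3) h(1)
    by (auto simp: cube_def interior_cbox mem_box_cart b_def algebra_simps) (smt (verit))+
  ultimately show "x \<in> (\<Union>Q\<in>?C. interior (case_prod cube Q))"
    using al h by (intro UN_I[of "(b, l + 2 * h)"]) auto
qed

lemma sets_maximal_level: "0 \<le> t \<Longrightarrow> {x. ennreal t < maximal f x} \<in> sets lebesgue"
  by (simp add: maximal_level_set_interiors lebesgue_openin open_UN)

text \<open>
  Countably many of the cubes with average above \<open>t\<close> have interiors covering the level set. Among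
  finitely many of them a disjoint subfamily can be selected whose triples cover; the local estimates then add
  up because \<open>g\<close> is integrated over disjoint cubes.
\<close>

lemma weak_type_covering:
  fixes f :: "real ^ 'n \<Rightarrow> real" and t P :: real
  assumes sets: "sets \<nu> = sets lebesgue" and t: "0 \<le> t" and P: "0 < P"
    and [measurable]: "g \<in> borel_measurable lebesgue"
    and cube: "\<And>Q. 0 < snd Q \<Longrightarrow>
      emeasure \<nu> (triple Q) * (\<integral>\<^sup>+x\<in>case_prod cube Q. ennreal \<bar>f x\<bar> \<partial>lebesgue) epowr P
        \<le> B * emeasure lebesgue (case_prod cube Q) epowr P * (\<integral>\<^sup>+x\<in>case_prod cube Q. g x \<partial>lebesgue)"
  shows "emeasure \<nu> {x. ennreal t < maximal f x} * ennreal t epowr P \<le> B * (\<integral>\<^sup>+x. g x \<partial>lebesgue)"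
proof -
  let ?U = "{x. ennreal t < maximal f x}"
  define C where "C = {Q. 0 < snd Q \<and> ennreal t < avg (case_prod cube Q) f}"
  have U: "?U = \<Union> ((\<lambda>Q. interior (case_prod cube Q)) ` C)"
    using maximal_level_set_interiors[OF t] by (simp add: C_def)
  obtain \<F> where \<F>: "\<F> \<subseteq> (\<lambda>Q. interior (case_prod cube Q)) ` C" "countable \<F>"
      "\<Union>\<F> = \<Union> ((\<lambda>Q. interior (case_prod cube Q)) ` C)"
    using Lindelof[of "(\<lambda>Q. interior (case_prod cube Q)) ` C"] by (metis (no_types, lifting) imageE open_interior)
  obtain C' where C': "C' \<subseteq> C" "countable C'" "\<F> = (\<lambda>Q. interior (case_prod cube Q)) ` C'"
    using \<F> by (metis countable_subset_image)
  \<comment> \<open>finitely many cubes at a time\<close>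
  have fin: "emeasure \<nu> (\<Union> (case_prod cube ` F)) * ennreal t epowr P \<le> B * (\<integral>\<^sup>+x. g x \<partial>lebesgue)"
    if F: "finite F" "F \<subseteq> C" for F
  proof -
    obtain G where G: "G \<subseteq> F" "disjoint_family_on (case_prod cube) G"
        "\<Union> (case_prod cube ` F) \<subseteq> \<Union> (triple ` G)"
      using finite_Vitali_cubes[OF F(1)] F(2) by (auto simp: C_def)
    have [simp]: "finite G" using G F finite_subset by blast
    have one: "emeasure \<nu> (triple Q) * ennreal t epowr P \<le> B * (\<integral>\<^sup>+x\<in>case_prod cube Q. g x \<partial>lebesgue)"
      if Q: "Q \<in> G" for Q
    proof -
      define m where "m = emeasure lebesgue (case_prod cube Q)"
      have Q': "0 < snd Q" "ennreal t < avg (case_prod cube Q) f" using Q G F by (auto simp: C_def)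
      then have "m = ennreal (snd Q ^ CARD('n))" by (simp add: m_def emeasure_cube case_prod_beta)
      then have m: "m \<noteq> 0" "m \<noteq> top" using Q' by auto
      have "ennreal t * m \<le> avg (case_prod cube Q) f * m"
        using Q' by (intro mult_right_mono) auto
      also have "\<dots> = (\<integral>\<^sup>+x\<in>case_prod cube Q. ennreal \<bar>f x\<bar> \<partial>lebesgue)"
        using m by (simp add: avg_def m_def[symmetric] ennreal_divide_times ennreal_divide_self less_top)
      finally have "(ennreal t * m) epowr P
          \<le> (\<integral>\<^sup>+x\<in>case_prod cube Q. ennreal \<bar>f x\<bar> \<partial>lebesgue) epowr P"
        using P by (intro epowr_mono) auto
      then have "emeasure \<nu> (triple Q) * (ennreal t * m) epowr P
          \<le> B * m epowr P * (\<integral>\<^sup>+x\<in>case_prod cube Q. g x \<partial>lebesgue)"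
        using cube[OF Q'(1)] unfolding m_def by (meson mult_left_mono order_trans zero_le)
      then have "m epowr P * (emeasure \<nu> (triple Q) * ennreal t epowr P)
          \<le> m epowr P * (B * (\<integral>\<^sup>+x\<in>case_prod cube Q. g x \<partial>lebesgue))"
        by (simp add: epowr_mult mult_ac)
      then show ?thesis using m by (subst (asm) ennreal_mult_le_mult_iff) auto
    qed
    have "emeasure \<nu> (\<Union> (case_prod cube ` F)) \<le> emeasure \<nu> (\<Union> (triple ` G))"
      using G(3) by (intro emeasure_mono) (auto simp: sets)
    also have "\<dots> \<le> (\<Sum>Q\<in>G. emeasure \<nu> (triple Q))"
      by (intro emeasure_subadditive_finite) (auto simp: sets)
    finally have "emeasure \<nu> (\<Union> (case_prod cube ` F)) * ennreal t epowr P
      \<le> (\<Sum>Q\<in>G. emeasure \<nu> (triple Q) * ennreal t epowr P)"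
      by (simp add: mult_right_mono flip: sum_distrib_right)
    also have "\<dots> \<le> (\<Sum>Q\<in>G. B * (\<integral>\<^sup>+x\<in>case_prod cube Q. g x \<partial>lebesgue))"
      by (intro sum_mono one)
    also have "\<dots> = B * (\<Sum>Q\<in>G. emeasure (density lebesgue g) (case_prod cube Q))"
      by (simp add: emeasure_density case_prod_beta sum_distrib_left)
    also have "\<dots> = B * emeasure (density lebesgue g) (\<Union>Q\<in>G. case_prod cube Q)"
      using G(2) by (subst sum_emeasure) auto
    also have "\<dots> \<le> B * emeasure (density lebesgue g) UNIV"
      by (intro mult_left_mono emeasure_mono) auto
    also have "\<dots> = B * (\<integral>\<^sup>+x. g x \<partial>lebesgue)"
      by (simp add: emeasure_density)
    finally show ?thesis .
  qed
  show ?thesis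
  proof (cases "C' = {}")
    case True
    then have "?U = {}" using U C' \<F> by simp
    then show ?thesis by simp
  next
    case False
    define V where "V m = (\<Union>Q\<in>from_nat_into C' ` {..<m}. interior (case_prod cube Q))" for m :: nat
    have "(\<Union>m. V m) = (\<Union>Q\<in>range (from_nat_into C'). interior (case_prod cube Q))"
      unfolding V_def by (auto intro: lessI)
    then have UV: "?U = (\<Union>m. V m)"
      using U C' \<F> False by (simp add: range_from_nat_into)
    have "emeasure \<nu> ?U = (SUP m. emeasure \<nu> (V m))"
      unfolding UV
      by (rule SUP_emeasure_incseq[symmetric])
        (force simp: V_def sets incseq_def intro!: lebesgue_openin open_UN)+
    moreover have "emeasure \<nu> (V m) * ennreal t epowr P \<le> B * (\<integral>\<^sup>+x. g x \<partial>lebesgue)" for m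
    proof -
      define F where "F = from_nat_into C' ` {..<m}"
      have F: "finite F" "F \<subseteq> C" unfolding F_def using C'(1) from_nat_into[OF False] by auto
      have "emeasure \<nu> (V m) \<le> emeasure \<nu> (\<Union> (case_prod cube ` F))"
        using interior_subset F(1) unfolding V_def F_def[symmetric]
        by (intro emeasure_mono UN_mono sets.finite_UN) (auto simp: sets)
      then show ?thesis using fin[OF F] by (meson mult_right_mono order_trans zero_le)
    qed
    ultimately show ?thesis by (simp add: SUP_mult_right_ennreal SUP_le_iff)
  qed
qed

section \<open>Weak type estimate for a pair of weights\<close>

text \<open>
  Jensen's inequality for \<open>f / \<tau>\<close> and the measure \<open>\<tau> dx\<close>.
\<close>

lemma epowr_nn_integral_le_weighted:
  fixes f \<tau> :: "'a \<Rightarrow> real"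
  assumes P: "1 < P" and [measurable]: "f \<in> borel_measurable M" "\<tau> \<in> borel_measurable M" "Q \<in> sets M"
    and pos: "AE x in M. 0 < \<tau> x"
  shows "(\<integral>\<^sup>+x\<in>Q. ennreal \<bar>f x\<bar> \<partial>M) epowr P
    \<le> (\<integral>\<^sup>+x\<in>Q. ennreal (\<bar>f x\<bar> powr P * \<tau> x powr (1 - P)) \<partial>M) * (\<integral>\<^sup>+x\<in>Q. ennreal (\<tau> x) \<partial>M) epowr (P - 1)"
proof -
  let ?T = "density M (\<lambda>x. ennreal (\<tau> x) * indicator Q x)"
  have "(\<integral>\<^sup>+x\<in>Q. ennreal \<bar>f x\<bar> \<partial>M) = (\<integral>\<^sup>+x. ennreal (\<bar>f x\<bar> / \<tau> x) \<partial>?T)"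
    using pos by (subst nn_integral_density)
      (auto intro!: nn_integral_cong_AE simp: ennreal_mult'[symmetric] split: split_indicator)
  moreover have "(\<integral>\<^sup>+x. ennreal (\<bar>f x\<bar> / \<tau> x) epowr P \<partial>?T)
    = (\<integral>\<^sup>+x\<in>Q. ennreal (\<bar>f x\<bar> powr P * \<tau> x powr (1 - P)) \<partial>M)"
    using pos by (subst nn_integral_density)
      (auto intro!: nn_integral_cong_AE simp: epowr_ennreal powr_divide powr_diff
        ennreal_mult'[symmetric] mult_ac split: split_indicator)
  moreover have "emeasure ?T (space ?T) = (\<integral>\<^sup>+x\<in>Q. ennreal (\<tau> x) \<partial>M)"
    by (auto simp: emeasure_density intro!: nn_integral_cong split: split_indicator)
  ultimately show ?thesis
    using nn_integral_epowr_le[OF P, of "\<lambda>x. ennreal (\<bar>f x\<bar> / \<tau> x)" ?T] by simp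
qed

text \<open>
  The weak type bound for \<open>(v, w) \<in> A\<^sub>P\<close>, with \<open>\<tau>\<close> the dual weight, so that \<open>w = \<tau>\<^bsup>1 - P\<^esup>\<close>. The \<open>A\<^sub>P\<close>
  condition is applied to the tripled cube, whose measure the covering argument has to control.
\<close>

lemma weak_type_two_weight:
  fixes f \<tau> :: "real ^ 'n \<Rightarrow> real"
  assumes sets: "sets \<nu> = sets lebesgue" and t: "0 \<le> t" and P: "1 < P"
    and [measurable]: "f \<in> borel_measurable lebesgue" "\<tau> \<in> borel_measurable lebesgue"
    and pos: "AE x in lebesgue. 0 < \<tau> x"
    and cube: "\<And>Q. Q \<in> cubes \<Longrightarrow>
      emeasure \<nu> Q * (\<integral>\<^sup>+x\<in>Q. ennreal (\<tau> x) \<partial>lebesgue) epowr (P - 1) \<le> A * emeasure lebesgue Q epowr P"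
  shows "emeasure \<nu> {x. ennreal t < maximal f x} * ennreal t epowr P
    \<le> A * ennreal (3 ^ CARD('n)) epowr P * (\<integral>\<^sup>+x. ennreal (\<bar>f x\<bar> powr P * \<tau> x powr (1 - P)) \<partial>lebesgue)"
proof (rule weak_type_covering[OF sets t])
  fix Q :: "(real ^ 'n) \<times> real" assume Q: "0 < snd Q"
  let ?Q = "case_prod cube Q"
  let ?g = "\<integral>\<^sup>+x\<in>?Q. ennreal (\<bar>f x\<bar> powr P * \<tau> x powr (1 - P)) \<partial>lebesgue"
  have sub: "?Q \<subseteq> triple Q"
    using cube_subset_triple[of "fst Q" "snd Q" "fst Q" "snd Q"] Q
    by (auto simp: case_prod_beta mem_cube)
  have "emeasure \<nu> (triple Q) * (\<integral>\<^sup>+x\<in>?Q. ennreal \<bar>f x\<bar> \<partial>lebesgue) epowr P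
    \<le> emeasure \<nu> (triple Q) * (?g * (\<integral>\<^sup>+x\<in>?Q. ennreal (\<tau> x) \<partial>lebesgue) epowr (P - 1))"
    using P pos by (intro mult_left_mono epowr_nn_integral_le_weighted) (auto simp: case_prod_beta)
  also have "\<dots> \<le> emeasure \<nu> (triple Q) * (?g * (\<integral>\<^sup>+x\<in>triple Q. ennreal (\<tau> x) \<partial>lebesgue) epowr (P - 1))"
    using P sub by (intro mult_left_mono epowr_mono nn_integral_mono) (auto split: split_indicator)
  also have "\<dots> = ?g * (emeasure \<nu> (triple Q) * (\<integral>\<^sup>+x\<in>triple Q. ennreal (\<tau> x) \<partial>lebesgue) epowr (P - 1))"
    by (simp add: mult_ac)
  also have "\<dots> \<le> ?g * (A * emeasure lebesgue (triple Q) epowr P)"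
    using Q by (intro mult_left_mono cube) auto
  also have "emeasure lebesgue (triple Q) = ennreal (3 ^ CARD('n)) * emeasure lebesgue ?Q"
    using Q by (simp add: emeasure_cube case_prod_beta power_mult_distrib ennreal_mult)
  finally show "emeasure \<nu> (triple Q) * (\<integral>\<^sup>+x\<in>?Q. ennreal \<bar>f x\<bar> \<partial>lebesgue) epowr P
    \<le> A * ennreal (3 ^ CARD('n)) epowr P * emeasure lebesgue ?Q epowr P * ?g"
    by (simp add: epowr_mult mult_ac)
qed (use P in auto)


section \<open>Dyadic subcells of a cube\<close>

text \<open>
  Only the restriction of \<open>g\<close> to the union is measurable in the applications, where \<open>g\<close> is a function of the
  dyadic cells of one cube.
\<close>

lemma nn_integral_finite_partition:
  assumes "finite D" "disjoint D" "D \<subseteq> sets M"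
    and g: "(\<lambda>x. g x * indicator (\<Union>D) x) \<in> borel_measurable M"
  shows "(\<integral>\<^sup>+x\<in>\<Union>D. g x \<partial>M) = (\<Sum>P\<in>D. \<integral>\<^sup>+x\<in>P. g x \<partial>M)"
proof -
  let ?N = "density M (\<lambda>x. g x * indicator (\<Union>D) x)"
  have sets: "\<Union>D \<in> sets M" using assms(1,3) by auto
  have "(\<Sum>P\<in>D. \<integral>\<^sup>+x\<in>P. g x \<partial>M) = (\<Sum>P\<in>D. emeasure ?N P)"
  proof (rule sum.cong)
    fix P assume P: "P \<in> D"
    then have "emeasure ?N P = (\<integral>\<^sup>+x. g x * indicator (\<Union>D) x * indicator P x \<partial>M)"
      using assms by (intro emeasure_density) auto
    also have "\<dots> = (\<integral>\<^sup>+x\<in>P. g x \<partial>M)"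
      using P by (intro nn_integral_cong) (auto split: split_indicator)
    finally show "(\<integral>\<^sup>+x\<in>P. g x \<partial>M) = emeasure ?N P" by simp
  qed simp
  also have "\<dots> = emeasure ?N (\<Union>P\<in>D. P)"
    using assms(1-3) by (intro sum_emeasure) (auto simp: disjoint_family_on_def disjoint_def)
  also have "\<dots> = (\<integral>\<^sup>+x. g x * indicator (\<Union>D) x * indicator (\<Union>D) x \<partial>M)"
    using sets g by (subst emeasure_density) auto
  also have "\<dots> = (\<integral>\<^sup>+x\<in>\<Union>D. g x \<partial>M)"
    by (intro nn_integral_cong) (auto split: split_indicator)
  finally show ?thesis by simp
qed

text \<open>
  Cells are half-open, so that those of one generation partition the space and each point has a
  unique cell. They are encoded as the classes of points with equal integer coordinates at scale \<open>l / 2\<^sup>k\<close>, which makes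
  nesting a statement about integer division. Only the closed cells are cubes in the sense used for averages; the
  difference is a null set.
\<close>

locale dyadic_cells =
  fixes a :: "real ^ 'n" and l :: real
  assumes side_pos: "0 < l"
begin

definition idx :: "nat \<Rightarrow> real ^ 'n \<Rightarrow> 'n \<Rightarrow> int"
  where "idx k x = (\<lambda>i. \<lfloor>2 ^ k * (x $ i - a $ i) / l\<rfloor>)"

definition cell :: "nat \<Rightarrow> real ^ 'n \<Rightarrow> (real ^ 'n) set"
  where "cell k x = {y. idx k y = idx k x}"

definition closed_cell :: "nat \<Rightarrow> real ^ 'n \<Rightarrow> (real ^ 'n) set"
  where "closed_cell k x = cube (\<chi> i. a $ i + l * idx k x i / 2 ^ k) (l / 2 ^ k)"

abbreviation Q :: "(real ^ 'n) set"
  where "Q \<equiv> cell 0 a"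

lemma cell_refl [simp]: "x \<in> cell k x"
  by (simp add: cell_def)

lemma cell_eq: "y \<in> cell k x \<Longrightarrow> cell k y = cell k x"
  by (simp add: cell_def)

lemma idx_coarsen:
  assumes "j \<le> k"
  shows "idx j x i = idx k x i div 2 ^ (k - j)"
proof -
  have "2 ^ j * (x $ i - a $ i) / l = (2 ^ k * (x $ i - a $ i) / l) / real_of_int (2 ^ (k - j))"
    using power_add[of "2 :: real" j "k - j"] assms by simp
  then show ?thesis
    unfolding idx_def by (simp only: floor_divide_real_eq_div zero_le_numeral zero_le_power)
qed

lemma cell_antimono: "j \<le> k \<Longrightarrow> cell k x \<subseteq> cell j x"
  by (auto simp: cell_def idx_coarsen[of j k] fun_eq_iff)

lemma cell_subset_Q: "x \<in> Q \<Longrightarrow> cell k x \<subseteq> Q"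
  using cell_antimono[of 0 k x] cell_eq[of x 0 a] by simp

lemma mem_cell: "y \<in> cell k x \<longleftrightarrow>
  (\<forall>i. a $ i + l * idx k x i / 2 ^ k \<le> y $ i \<and> y $ i < a $ i + l * idx k x i / 2 ^ k + l / 2 ^ k)"
proof -
  have "idx k y i = idx k x i \<longleftrightarrow>
      a $ i + l * idx k x i / 2 ^ k \<le> y $ i \<and> y $ i < a $ i + l * idx k x i / 2 ^ k + l / 2 ^ k" for i
  proof -
    have "idx k y i = idx k x i \<longleftrightarrow>
        idx k x i \<le> 2 ^ k * (y $ i - a $ i) / l \<and> 2 ^ k * (y $ i - a $ i) / l < idx k x i + 1"
      unfolding idx_def[of k y] by (simp add: floor_eq_iff)
    also have "\<dots> \<longleftrightarrow> l * idx k x i \<le> 2 ^ k * (y $ i - a $ i) \<and> 2 ^ k * (y $ i - a $ i) < l * idx k x i + l"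
      using side_pos by (simp add: field_simps)
    also have "\<dots> \<longleftrightarrow>
        a $ i + l * idx k x i / 2 ^ k \<le> y $ i \<and> y $ i < a $ i + l * idx k x i / 2 ^ k + l / 2 ^ k"
      by (simp add: field_simps)
    finally show ?thesis .
  qed
  then show ?thesis by (auto simp: cell_def fun_eq_iff)
qed

lemma cell_subset_closed_cell: "cell k x \<subseteq> closed_cell k x"
  by (auto simp: mem_cell closed_cell_def mem_cube intro: less_imp_le) (meson less_imp_le)

lemma closed_cell_in_cubes [simp]: "closed_cell k x \<in> cubes"
  using side_pos by (simp add: closed_cell_def)

lemma closed_cell_0: "closed_cell 0 a = cube a l"
  by (simp add: closed_cell_def idx_def)

lemma cell_diam:
  assumes "y \<in> cell k x"
  shows "dist y x \<le> real CARD('n) * (l / 2 ^ k)"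
proof -
  have "\<bar>(y - x) $ i\<bar> \<le> l / 2 ^ k" for i
  proof -
    have "a $ i + l * idx k x i / 2 ^ k \<le> y $ i" "y $ i < a $ i + l * idx k x i / 2 ^ k + l / 2 ^ k"
      "a $ i + l * idx k x i / 2 ^ k \<le> x $ i" "x $ i < a $ i + l * idx k x i / 2 ^ k + l / 2 ^ k"
      using assms cell_refl[of x k] unfolding mem_cell by auto
    then show ?thesis by (simp add: abs_le_iff)
  qed
  then have "(\<Sum>i\<in>UNIV. \<bar>(y - x) $ i\<bar>) \<le> (\<Sum>i\<in>(UNIV :: 'n set). l / 2 ^ k)"
    by (intro sum_mono)
  then show ?thesis using norm_le_l1_cart[of "y - x"] by (simp add: dist_norm)
qed

lemma sets_cell [measurable, simp]: "cell k x \<in> sets lebesgue"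
proof -
  have "cell k x = (\<Inter>i. {y. a $ i + l * idx k x i / 2 ^ k \<le> y $ i})
      \<inter> (\<Inter>i. {y. y $ i < a $ i + l * idx k x i / 2 ^ k + l / 2 ^ k})"
    by (auto simp: mem_cell)
  also have "\<dots> \<in> sets borel"
    by (intro sets.Int borel_closed borel_open closed_INT ballI open_INT
        closed_Collect_le open_Collect_less continuous_intros) auto
  finally show ?thesis by (simp add: sets_completionI_sets)
qed

lemma AE_indicator_cell:
  "AE y in lebesgue. indicator (closed_cell k x) y = (indicator (cell k x) y :: ennreal)"
proof -
  let ?c = "\<chi> i. a $ i + l * idx k x i / 2 ^ k" and ?m = "l / 2 ^ k"
  have "negligible (cbox ?c (\<chi> i. ?c $ i + ?m) - box ?c (\<chi> i. ?c $ i + ?m))"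
    by (rule negligible_frontier_interval)
  then have "AE y in lebesgue. y \<notin> cbox ?c (\<chi> i. ?c $ i + ?m) - box ?c (\<chi> i. ?c $ i + ?m)"
    unfolding negligible_iff_null_sets by (rule AE_not_in)
  then show ?thesis
  proof eventually_elim
    case (elim y)
    have "box ?c (\<chi> i. ?c $ i + ?m) \<subseteq> cell k x"
      by (auto simp: mem_cell mem_box_cart) (meson less_imp_le)
    then have "y \<in> closed_cell k x \<longleftrightarrow> y \<in> cell k x"
      using elim cell_subset_closed_cell[of k x] by (auto simp: closed_cell_def cube_def)
    then show ?case by (simp add: indicator_def)
  qed
qed

lemma nn_integral_closed_cell:
  "(\<integral>\<^sup>+y\<in>closed_cell k x. g y \<partial>lebesgue) = (\<integral>\<^sup>+y\<in>cell k x. g y \<partial>lebesgue)"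
  using AE_indicator_cell[of k x] by (intro nn_integral_cong_AE) auto

lemma emeasure_closed_cell: "emeasure lebesgue (closed_cell k x) = emeasure lebesgue (cell k x)"
  using nn_integral_closed_cell[of "\<lambda>_. 1" k x] emeasure_cubes(3)[OF closed_cell_in_cubes, of k x]
  by simp

lemma emeasure_cell: "emeasure lebesgue (cell k x) = ennreal ((l / 2 ^ k) ^ CARD('n))"
  unfolding emeasure_closed_cell[symmetric] closed_cell_def
  using side_pos by (intro emeasure_cube) auto

lemma emeasure_cell_nontrivial [simp]:
  "emeasure lebesgue (cell k x) \<noteq> 0" "emeasure lebesgue (cell k x) \<noteq> top"
  using side_pos by (auto simp: emeasure_cell)

lemma emeasure_cell_Suc:
  "emeasure lebesgue (cell k x) = ennreal (2 ^ CARD('n)) * emeasure lebesgue (cell (Suc k) x)"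
  using side_pos by (simp add: emeasure_cell power_divide power_mult_distrib flip: ennreal_mult)

lemma finite_cells: "finite (cell k ` Q)"
proof -
  have "idx k ` Q \<subseteq> Pi UNIV (\<lambda>_. {0..<2 ^ k})"
  proof (clarsimp)
    fix x i assume x: "x \<in> Q"
    then have "a $ i \<le> x $ i" "x $ i < a $ i + l" by (auto simp: mem_cell idx_def)
    then show "0 \<le> idx k x i \<and> idx k x i < 2 ^ k"
      using side_pos mult_strict_right_mono[of "x $ i" "a $ i + l" "2 ^ k"]
      by (auto simp: idx_def floor_less_iff field_simps)
  qed
  moreover have "finite (Pi UNIV (\<lambda>_. {0..<2 ^ k}) :: ('n \<Rightarrow> int) set)"
    using finite_PiE[of "UNIV :: 'n set" "\<lambda>_. {0..<2 ^ k} :: int set"] by (simp add: PiE_UNIV_domain)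
  ultimately have "finite (idx k ` Q)" by (rule finite_subset)
  moreover have "cell k ` Q = (\<lambda>m. {y. idx k y = m}) ` idx k ` Q" by (auto simp: cell_def)
  ultimately show ?thesis by simp
qed

lemma Union_cells: "\<Union> (cell k ` Q) = Q"
  using cell_subset_Q cell_refl by blast

lemma disjoint_cells: "disjoint (cell k ` A)"
  by (auto simp: disjoint_def cell_def)

text \<open>
  Measurability with respect to the algebra generated by the cells of generation \<open>k\<close> in \<open>Q\<close>.
\<close>

definition cell_measurable :: "nat \<Rightarrow> (real ^ 'n \<Rightarrow> ennreal) \<Rightarrow> bool"
  where "cell_measurable k \<phi> \<longleftrightarrow> (\<forall>x\<in>Q. \<forall>y\<in>cell k x. \<phi> y = \<phi> x)"

lemma borel_measurable_cell_measurable: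
  assumes "cell_measurable k \<phi>"
  shows "(\<lambda>x. \<phi> x * indicator Q x) \<in> borel_measurable lebesgue"
proof (rule measurableI)
  fix B :: "ennreal set" assume "B \<in> sets borel"
  define C where "C = cell k ` {x \<in> Q. \<phi> x \<in> B}"
  have mem_C: "x \<in> \<Union>C \<longleftrightarrow> x \<in> Q \<and> \<phi> x \<in> B" for x
  proof
    assume "x \<in> \<Union>C"
    then obtain y where y: "y \<in> Q" "\<phi> y \<in> B" "x \<in> cell k y" by (auto simp: C_def)
    then show "x \<in> Q \<and> \<phi> x \<in> B"
      using cell_subset_Q[of y k] assms[unfolded cell_measurable_def, rule_format, of y x] by auto
  next
    assume "x \<in> Q \<and> \<phi> x \<in> B"
    then show "x \<in> \<Union>C" unfolding C_def by (intro UnionI[of "cell k x"] imageI) auto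
  qed
  have "finite C" unfolding C_def by (rule finite_subset[OF _ finite_cells[of k]]) blast
  then have "\<Union>C \<in> sets lebesgue" by (intro sets.finite_Union) (auto simp: C_def)
  moreover have "UNIV - Q \<in> sets lebesgue" using sets.compl_sets[of Q lebesgue] by simp
  moreover have "(\<lambda>x. \<phi> x * indicator Q x) -` B \<inter> space lebesgue
      = \<Union>C \<union> (if 0 \<in> B then UNIV - Q else {})"
  proof (rule set_eqI)
    fix x show "x \<in> (\<lambda>x. \<phi> x * indicator Q x) -` B \<inter> space lebesgue
        \<longleftrightarrow> x \<in> \<Union>C \<union> (if 0 \<in> B then UNIV - Q else {})"
      unfolding Un_iff mem_C by (cases "x \<in> Q") simp_all
  qed
  ultimately show "(\<lambda>x. \<phi> x * indicator Q x) -` B \<inter> space lebesgue \<in> sets lebesgue"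
    by simp
qed simp

lemma cell_measurable_epowr: "cell_measurable k \<phi> \<Longrightarrow> cell_measurable k (\<lambda>x. \<phi> x epowr d)"
  unfolding cell_measurable_def by metis

lemma cell_measurable_mult:
  "cell_measurable k \<phi> \<Longrightarrow> cell_measurable k \<psi> \<Longrightarrow> cell_measurable k (\<lambda>x. \<phi> x * \<psi> x)"
  unfolding cell_measurable_def by metis

lemma cell_measurableD: "cell_measurable k \<phi> \<Longrightarrow> x \<in> Q \<Longrightarrow> y \<in> cell k x \<Longrightarrow> \<phi> y = \<phi> x"
  unfolding cell_measurable_def by blast

text \<open>
  As a function of \<open>x\<close> this is the conditional expectation of \<open>u\<close> given the cells of generation \<open>k\<close>.
\<close>

definition cell_avg :: "(real ^ 'n \<Rightarrow> ennreal) \<Rightarrow> nat \<Rightarrow> real ^ 'n \<Rightarrow> ennreal"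
  where "cell_avg u k x = (\<integral>\<^sup>+y\<in>cell k x. u y \<partial>lebesgue) / emeasure lebesgue (cell k x)"

text \<open>
  The dyadic maximal function is stopped at generation \<open>N\<close>. It then takes finitely many values on \<open>Q\<close>, so that the
  integrals of its powers are finite and can be absorbed.
\<close>

definition cell_max :: "(real ^ 'n \<Rightarrow> ennreal) \<Rightarrow> nat \<Rightarrow> real ^ 'n \<Rightarrow> ennreal"
  where "cell_max u N x = (SUP k\<in>{..N}. cell_avg u k x)"

lemma cell_avg_cong: "y \<in> cell k x \<Longrightarrow> j \<le> k \<Longrightarrow> cell_avg u j y = cell_avg u j x"
  unfolding cell_avg_def using cell_antimono[of j k x] cell_eq[of y j x] by (simp add: subset_iff)

lemma cell_avg_0: "x \<in> Q \<Longrightarrow> cell_avg u 0 x = cell_avg u 0 a"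
  by (rule cell_avg_cong) auto

lemma cell_measurable_avg: "cell_measurable k (cell_avg u k)"
  unfolding cell_measurable_def by (blast intro: cell_avg_cong)

lemma cell_measurable_max: "cell_measurable N (cell_max u N)"
  unfolding cell_measurable_def cell_max_def by (intro ballI SUP_cong refl cell_avg_cong) auto

lemma nn_integral_cell_eq_avg:
  "(\<integral>\<^sup>+y\<in>cell k x. u y \<partial>lebesgue) = cell_avg u k x * emeasure lebesgue (cell k x)"
  using ennreal_divide_self[of "emeasure lebesgue (cell k x)"]
  by (simp add: cell_avg_def ennreal_divide_times less_top[symmetric])

text \<open>
  The defining property of the conditional expectation, cell by cell: \<open>\<phi>\<close> can be taken out of the integral
  over each cell.
\<close>

lemma nn_integral_cell_avg:
  assumes \<phi>: "cell_measurable k \<phi>" and [measurable]: "u \<in> borel_measurable lebesgue"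
  shows "(\<integral>\<^sup>+x\<in>Q. \<phi> x * cell_avg u k x \<partial>lebesgue) = (\<integral>\<^sup>+x\<in>Q. \<phi> x * u x \<partial>lebesgue)"
proof -
  have [measurable]: "(\<lambda>x. \<phi> x * indicator Q x) \<in> borel_measurable lebesgue"
    using \<phi> by (rule borel_measurable_cell_measurable)
  have "(\<lambda>x. \<phi> x * indicator Q x * u x) \<in> borel_measurable lebesgue" by measurable
  then have m: "(\<lambda>x. \<phi> x * u x * indicator Q x) \<in> borel_measurable lebesgue" by (simp add: mult_ac)
  have "(\<integral>\<^sup>+x\<in>\<Union> (cell k ` Q). \<phi> x * cell_avg u k x \<partial>lebesgue)
      = (\<Sum>P\<in>cell k ` Q. \<integral>\<^sup>+x\<in>P. \<phi> x * cell_avg u k x \<partial>lebesgue)"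
    using borel_measurable_cell_measurable[OF cell_measurable_mult[OF \<phi> cell_measurable_avg]]
    by (intro nn_integral_finite_partition finite_cells disjoint_cells) (auto simp: Union_cells)
  also have "\<dots> = (\<Sum>P\<in>cell k ` Q. \<integral>\<^sup>+x\<in>P. \<phi> x * u x \<partial>lebesgue)"
  proof (rule sum.cong)
    fix P assume "P \<in> cell k ` Q"
    then obtain x where x: "x \<in> Q" "P = cell k x" by auto
    have "(\<integral>\<^sup>+y\<in>P. \<phi> y * cell_avg u k y \<partial>lebesgue) = (\<integral>\<^sup>+y\<in>P. \<phi> x * cell_avg u k x \<partial>lebesgue)"
    proof (rule nn_integral_cong)
      fix y
      show "\<phi> y * cell_avg u k y * indicator P y = \<phi> x * cell_avg u k x * indicator P y"
        using cell_measurableD[OF \<phi> x(1), of y] cell_avg_cong[of y k x k u] x(2)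
        by (cases "y \<in> P") simp_all
    qed
    also have "\<dots> = \<phi> x * cell_avg u k x * emeasure lebesgue P"
      using x(2) by (intro nn_integral_cmult_indicator) simp
    also have "\<dots> = \<phi> x * (\<integral>\<^sup>+y\<in>P. u y \<partial>lebesgue)"
      unfolding x(2) nn_integral_cell_eq_avg[where k = k and x = x and u = u] by (rule mult.assoc)
    also have "\<dots> = (\<integral>\<^sup>+y. \<phi> x * (u y * indicator P y) \<partial>lebesgue)"
      using x by (intro nn_integral_cmult[symmetric]) auto
    also have "\<dots> = (\<integral>\<^sup>+y\<in>P. \<phi> y * u y \<partial>lebesgue)"
    proof (rule nn_integral_cong)
      fix y
      show "\<phi> x * (u y * indicator P y) = \<phi> y * u y * indicator P y"
        using cell_measurableD[OF \<phi> x(1), of y] x(2) by (cases "y \<in> P") simp_all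
    qed
    finally show "(\<integral>\<^sup>+y\<in>P. \<phi> y * cell_avg u k y \<partial>lebesgue) = (\<integral>\<^sup>+y\<in>P. \<phi> y * u y \<partial>lebesgue)" .
  qed simp
  also have "\<dots> = (\<integral>\<^sup>+x\<in>\<Union> (cell k ` Q). \<phi> x * u x \<partial>lebesgue)"
    using m by (intro nn_integral_finite_partition[symmetric] finite_cells disjoint_cells)
      (auto simp: Union_cells)
  finally show ?thesis by (simp add: Union_cells)
qed

text \<open>
  The superlevel set of the dyadic maximal function is the disjoint union of the cells that are
  maximal among those whose average exceeds \<open>t\<close>, so an estimate on these cells adds up.
\<close>

lemma nn_integral_superlevel_le:
  assumes g: "(\<lambda>x. g x * indicator Q x) \<in> borel_measurable lebesgue"
    and stop: "\<And>k x. x \<in> Q \<Longrightarrow> k \<le> N \<Longrightarrow> t < cell_avg u k x \<Longrightarrow> (\<forall>j<k. cell_avg u j x \<le> t) \<Longrightarrow>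
      (\<integral>\<^sup>+y\<in>cell k x. g y \<partial>lebesgue) \<le> c * emeasure lebesgue (cell k x)"
  shows "(\<integral>\<^sup>+y\<in>{x \<in> Q. t < cell_max u N x}. g y \<partial>lebesgue)
    \<le> c * emeasure lebesgue {x \<in> Q. t < cell_max u N x}"
proof -
  define S where "S = {x \<in> Q. t < cell_max u N x}"
  \<comment> \<open>the stopping generation, which is constant on the cell where it occurs\<close>
  define \<tau> where "\<tau> x = (LEAST k. t < cell_avg u k x)" for x
  have S_iff: "x \<in> S \<longleftrightarrow> x \<in> Q \<and> (\<exists>k\<le>N. t < cell_avg u k x)" for x
    by (auto simp: S_def cell_max_def less_SUP_iff)
  have \<tau>: "t < cell_avg u (\<tau> x) x" "\<tau> x \<le> N" "\<forall>j<\<tau> x. cell_avg u j x \<le> t" if "x \<in> S" for x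
  proof -
    obtain k where k: "k \<le> N" "t < cell_avg u k x" using \<open>x \<in> S\<close> S_iff[of x] by blast
    show "t < cell_avg u (\<tau> x) x" unfolding \<tau>_def by (rule LeastI[of _ k]) (rule k)
    show "\<tau> x \<le> N" unfolding \<tau>_def using k by (meson Least_le order_trans)
    show "\<forall>j<\<tau> x. cell_avg u j x \<le> t" unfolding \<tau>_def by (meson not_less_Least not_less)
  qed
  define D where "D = (\<lambda>x. cell (\<tau> x) x) ` S"
  have \<tau>_cong: "z \<in> S \<and> \<tau> z = \<tau> x" if "x \<in> S" "z \<in> cell (\<tau> x) x" for x z
  proof -
    have eq: "cell_avg u j z = cell_avg u j x" if "j \<le> \<tau> x" for j
      by (rule cell_avg_cong[OF \<open>z \<in> cell (\<tau> x) x\<close> that])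
    have "z \<in> Q" using that cell_subset_Q[of x "\<tau> x"] by (auto simp: S_iff)
    then have "z \<in> S" using \<tau>(1,2)[OF that(1)] eq[of "\<tau> x"] by (auto simp: S_iff)
    moreover have "\<tau> z = \<tau> x"
      unfolding \<tau>_def[of z]
    proof (rule Least_equality)
      show "t < cell_avg u (\<tau> x) z" using \<tau>(1)[OF that(1)] eq[of "\<tau> x"] by simp
      show "\<tau> x \<le> k" if "t < cell_avg u k z" for k
        using \<tau>(3)[OF \<open>x \<in> S\<close>] eq[of k] that by (metis leD leI less_imp_le)
    qed
    ultimately show ?thesis by simp
  qed
  have UD: "\<Union>D = S"
  proof (intro equalityI subsetI)
    show "z \<in> S" if "z \<in> \<Union>D" for z using that \<tau>_cong unfolding D_def by blast
    show "z \<in> \<Union>D" if "z \<in> S" for z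
      unfolding D_def by (intro UnionI[of "cell (\<tau> z) z"] imageI that) simp
  qed
  have disj: "disjoint D"
  proof (rule disjointI)
    fix A B assume "A \<in> D" "B \<in> D" "A \<noteq> B"
    then obtain x y where xy: "x \<in> S" "y \<in> S" "A = cell (\<tau> x) x" "B = cell (\<tau> y) y"
      by (auto simp: D_def)
    show "A \<inter> B = {}"
    proof (rule ccontr)
      assume "A \<inter> B \<noteq> {}"
      then obtain z where z: "z \<in> cell (\<tau> x) x" "z \<in> cell (\<tau> y) y" using xy by auto
      then have "A = cell (\<tau> z) z" "B = cell (\<tau> z) z"
        using \<tau>_cong[OF xy(1) z(1)] \<tau>_cong[OF xy(2) z(2)] xy(3,4)
          cell_eq[OF z(1)] cell_eq[OF z(2)] by simp_all
      then show False using \<open>A \<noteq> B\<close> by simp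
    qed
  qed
  have "D \<subseteq> (\<Union>k\<in>{..N}. cell k ` Q)"
  proof
    fix P assume "P \<in> D"
    then obtain x where x: "x \<in> S" "P = cell (\<tau> x) x" by (auto simp: D_def)
    then show "P \<in> (\<Union>k\<in>{..N}. cell k ` Q)" using \<tau>(2)[OF x(1)] S_iff[of x] by auto
  qed
  then have fin: "finite D" by (rule finite_subset) (auto simp: finite_cells)
  have sets: "D \<subseteq> sets lebesgue" by (auto simp: D_def)
  then have [measurable]: "S \<in> sets lebesgue" using UD fin by (metis sets.finite_Union)
  have "(\<lambda>x. (g x * indicator Q x) * indicator S x) \<in> borel_measurable lebesgue"
    using g by measurable
  moreover have "(g x * indicator Q x) * indicator S x = g x * indicator (\<Union>D) x" for x
    using S_iff[of x] by (simp add: UD split: split_indicator)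
  ultimately have "(\<integral>\<^sup>+y\<in>\<Union>D. g y \<partial>lebesgue) = (\<Sum>P\<in>D. \<integral>\<^sup>+y\<in>P. g y \<partial>lebesgue)"
    by (intro nn_integral_finite_partition fin disj sets) simp
  also have "\<dots> \<le> (\<Sum>P\<in>D. c * emeasure lebesgue P)"
  proof (rule sum_mono)
    fix P assume "P \<in> D"
    then obtain x where x: "x \<in> S" "P = cell (\<tau> x) x" by (auto simp: D_def)
    then show "(\<integral>\<^sup>+y\<in>P. g y \<partial>lebesgue) \<le> c * emeasure lebesgue P"
      using \<tau>[OF x(1)] S_iff[of x] by (auto intro: stop)
  qed
  also have "\<dots> = c * emeasure lebesgue (\<Union>P\<in>D. P)"
    using sets fin disj
    by (subst sum_emeasure[symmetric]) (auto simp: sum_distrib_left disjoint_family_on_def disjoint_def)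
  finally show ?thesis by (simp add: UD flip: S_def)
qed

lemma superlevel_measurable [measurable]: "{x \<in> Q. t < cell_max u N x} \<in> sets lebesgue"
proof -
  have [measurable]: "(\<lambda>x. cell_max u N x * indicator Q x) \<in> borel_measurable lebesgue"
    by (rule borel_measurable_cell_measurable[OF cell_measurable_max])
  have "{x \<in> Q. t < cell_max u N x} = Q \<inter> {x \<in> space lebesgue. t < cell_max u N x * indicator Q x}"
    by auto
  also have "\<dots> \<in> sets lebesgue" by measurable
  finally show ?thesis .
qed

end


section \<open>Powers of the dyadic maximal function\<close>

lemma ex_dyadic_level:
  fixes s y :: real
  assumes "0 < s" "s < y"
  obtains m where "\<And>j. 2 ^ j * s < y \<longleftrightarrow> j \<le> m" "y \<le> 2 ^ Suc m * s"
proof -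
  obtain n0 where n0: "y / s < 2 ^ n0" using real_arch_pow[of 2 "y / s"] by auto
  define n where "n = (LEAST n. y \<le> 2 ^ n * s)"
  have n: "y \<le> 2 ^ n * s"
    unfolding n_def using n0 assms
    by (intro LeastI[of "\<lambda>n. y \<le> 2 ^ n * s" n0]) (simp add: pos_divide_less_eq)
  then have "n \<noteq> 0" using assms by (intro notI) simp
  then obtain m where m: "n = Suc m" by (cases n) auto
  have "2 ^ j * s < y \<longleftrightarrow> j \<le> m" for j
  proof
    assume "j \<le> m"
    then have "j < n" using m by simp
    then show "2 ^ j * s < y" unfolding n_def by (auto dest: not_less_Least)
  next
    assume *: "2 ^ j * s < y"
    show "j \<le> m"
    proof (rule ccontr)
      assume "\<not> j \<le> m"
      then have "(2::real) ^ n \<le> 2 ^ j" using m by (intro power_increasing) auto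
      then have "2 ^ n * s \<le> 2 ^ j * s" using assms by simp
      then show False using n * by simp
    qed
  qed
  then show ?thesis using that n m by blast
qed

lemma two_powr_le:
  fixes d :: real
  assumes "0 \<le> d" "d \<le> 1"
  shows "2 powr d \<le> 1 + d"
  using Youngs_inequality_0[of d "1 - d" 2 1] assms by simp

lemma dyadic_powr: "0 < s \<Longrightarrow> (2 ^ j * s) powr e = s powr e * 2 powr (real j * e)" for s :: real
  by (simp only: powr_mult powr_powr powr_realpow[symmetric] zero_less_numeral mult.commute)

lemma geometric_level_lower:
  fixes d :: real
  assumes "0 \<le> d" "d \<le> 1"
  shows "2 powr (real (Suc m) * d) \<le> 1 + d * (\<Sum>j\<le>m. 2 powr (real j * d))"
proof (induction m)
  case 0
  then show ?case using two_powr_le[OF assms] by simp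
next
  case (Suc m)
  have "2 powr (real (Suc (Suc m)) * d) = 2 powr (real (Suc m) * d) * 2 powr d"
    by (simp add: algebra_simps flip: powr_add)
  also have "\<dots> \<le> 2 powr (real (Suc m) * d) * (1 + d)"
    using two_powr_le[OF assms] by (intro mult_left_mono) auto
  also have "\<dots> \<le> 1 + d * (\<Sum>j\<le>m. 2 powr (real j * d)) + d * 2 powr (real (Suc m) * d)"
    using Suc by (simp add: algebra_simps)
  finally show ?case by (simp add: algebra_simps)
qed

lemma geometric_level_upper:
  fixes b :: real
  assumes "2 \<le> b"
  shows "(\<Sum>j\<le>m. b ^ j) \<le> 2 * b ^ m"
proof (induction m)
  case (Suc m)
  have "2 * b ^ m \<le> b * b ^ m" using assms by (intro mult_right_mono) auto
  then show ?case using Suc by simp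
qed simp

text \<open>
  A discrete layer cake formula: \<open>y\<^sup>d\<close> is controlled by the dyadic levels below \<open>y\<close>, with the small
  factor \<open>d\<close> in front.
\<close>

lemma epowr_le_level_sum:
  assumes s: "0 < s" and d: "0 \<le> d" "d \<le> 1" and y: "ennreal s \<le> y" "y \<noteq> top"
  shows "y epowr d \<le> ennreal (s powr d) + ennreal (d * s powr d) *
    (\<Sum>j. ennreal (2 powr (real j * d)) * indicator {z. ennreal (2 ^ j * s) < z} y)"
proof -
  obtain y' where y': "y = ennreal y'" "0 \<le> y'" using y(2) by (metis ennreal_cases infinity_ennreal_def)
  show ?thesis
  proof (cases "y' = s")
    case True
    then show ?thesis using y' by (simp add: epowr_ennreal)
  next
    case False
    then have "s < y'" using y y' s by simp
    then obtain m where m: "\<And>j. 2 ^ j * s < y' \<longleftrightarrow> j \<le> m" "y' \<le> 2 ^ Suc m * s"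
      using ex_dyadic_level s by blast
    have "y' powr d \<le> (2 ^ Suc m * s) powr d" using m y' d by (intro powr_mono2) auto
    also have "\<dots> = s powr d * 2 powr (real (Suc m) * d)"
      by (rule dyadic_powr[OF s])
    also have "\<dots> \<le> s powr d * (1 + d * (\<Sum>j\<le>m. 2 powr (real j * d)))"
      using d by (intro mult_left_mono geometric_level_lower) auto
    also have "\<dots> = s powr d + (d * s powr d) * (\<Sum>j\<le>m. 2 powr (real j * d))"
      by (simp add: algebra_simps)
    finally have "ennreal (y' powr d) \<le> ennreal (s powr d) + ennreal (d * s powr d) *
        (\<Sum>j\<le>m. ennreal (2 powr (real j * d)))"
      using d by (simp add: sum_nonneg flip: ennreal_mult ennreal_plus)
    also have "(\<Sum>j\<le>m. ennreal (2 powr (real j * d))) =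
        (\<Sum>j\<le>m. ennreal (2 powr (real j * d)) * indicator {z. ennreal (2 ^ j * s) < z} y)"
      using m s y' by (intro sum.cong) (auto simp: ennreal_less_iff)
    also have "\<dots> \<le> (\<Sum>j. ennreal (2 powr (real j * d)) * indicator {z. ennreal (2 ^ j * s) < z} y)"
      by (intro sum_le_suminf) auto
    finally show ?thesis using y' by (simp add: epowr_ennreal mult_left_mono)
  qed
qed

text \<open>
  The converse of the layer cake bound: the levels below \<open>y\<close> form a geometric progression, dominated by
  its largest term.
\<close>

lemma level_sum_le_epowr:
  assumes s: "0 < s" and d: "0 \<le> d"
  shows "(\<Sum>j. ennreal ((2 ^ j * s) powr (1 + d)) * indicator {z. ennreal (2 ^ j * s) < z} y)
    \<le> 2 * y epowr (1 + d)"
proof (cases "y = top \<or> y \<le> ennreal s")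
  case True
  then show ?thesis
  proof
    assume "y \<le> ennreal s"
    moreover have "ennreal s \<le> ennreal (2 ^ j * s)" for j
      using s by (intro ennreal_leI) simp
    ultimately have "\<not> ennreal (2 ^ j * s) < y" for j by (meson leD order_trans)
    then show ?thesis by simp
  qed (simp add: ennreal_mult_top)
next
  case False
  then obtain y' where y': "y = ennreal y'" "s < y'"
    using s by (cases y) auto
  then obtain m where m: "\<And>j. 2 ^ j * s < y' \<longleftrightarrow> j \<le> m" "y' \<le> 2 ^ Suc m * s"
    using ex_dyadic_level s by blast
  have "(\<Sum>j. ennreal ((2 ^ j * s) powr (1 + d)) * indicator {z. ennreal (2 ^ j * s) < z} y)
      = (\<Sum>j\<le>m. ennreal ((2 ^ j * s) powr (1 + d)) * indicator {z. ennreal (2 ^ j * s) < z} y)"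
    using m s y' by (intro suminf_finite) (auto simp: ennreal_less_iff)
  also have "\<dots> = (\<Sum>j\<le>m. ennreal ((2 ^ j * s) powr (1 + d)))"
    using m s y' by (intro sum.cong) (auto simp: ennreal_less_iff)
  also have "\<dots> = ennreal (\<Sum>j\<le>m. (2 ^ j * s) powr (1 + d))"
    by (simp add: sum_ennreal)
  also have "(\<Sum>j\<le>m. (2 ^ j * s) powr (1 + d)) = s powr (1 + d) * (\<Sum>j\<le>m. (2 powr (1 + d)) ^ j)"
    by (simp add: dyadic_powr[OF s] sum_distrib_left powr_power mult.commute[of "1 + d"])
  also have "\<dots> \<le> s powr (1 + d) * (2 * (2 powr (1 + d)) ^ m)"
    using d by (intro mult_left_mono geometric_level_upper) (auto simp: powr_add ge_one_powr_ge_zero)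
  also have "\<dots> = 2 * (2 ^ m * s) powr (1 + d)"
    by (simp add: dyadic_powr[OF s] powr_power mult.commute[of "1 + d"])
  also have "\<dots> \<le> 2 * y' powr (1 + d)"
    using m(1)[of m] s d by (intro mult_left_mono powr_mono2) auto
  finally show ?thesis using y' s by (simp add: epowr_ennreal ennreal_mult' ennreal_leI)
qed

context dyadic_cells
begin

text \<open>
  A bound of \<open>\<integral> g\<close> on every superlevel set of the maximal function by its level times its volume costs only
  the factor \<open>d\<close> when it is summed over the levels.
\<close>

lemma nn_integral_epowr_max_le:
  assumes s: "0 < s" and d: "0 < d" "d \<le> 1"
    and [measurable]: "u \<in> borel_measurable lebesgue"
    and G: "\<And>x. x \<in> Q \<Longrightarrow> ennreal s \<le> cell_max u N x" "\<And>x. x \<in> Q \<Longrightarrow> cell_max u N x \<noteq> top"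
    and g: "(\<lambda>x. g x * indicator Q x) \<in> borel_measurable lebesgue"
    and level: "\<And>t. s \<le> t \<Longrightarrow> (\<integral>\<^sup>+x\<in>{x \<in> Q. ennreal t < cell_max u N x}. g x \<partial>lebesgue)
      \<le> c * ennreal t * emeasure lebesgue {x \<in> Q. ennreal t < cell_max u N x}"
  shows "(\<integral>\<^sup>+x\<in>Q. cell_max u N x epowr d * g x \<partial>lebesgue)
    \<le> ennreal (s powr d) * (\<integral>\<^sup>+x\<in>Q. g x \<partial>lebesgue)
      + 2 * ennreal d * c * (\<integral>\<^sup>+x\<in>Q. cell_max u N x epowr (1 + d) \<partial>lebesgue)"
proof -
  let ?G = "cell_max u N"
  define S where "S j = {x \<in> Q. ennreal (2 ^ j * s) < ?G x}" for j :: nat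
  define b where "b j = ennreal (d * s powr d) * ennreal (2 powr (real j * d))" for j :: nat
  define h where "h x = g x * indicator Q x" for x
  have [measurable]: "h \<in> borel_measurable lebesgue" using g by (simp add: h_def[abs_def])
  have [measurable]: "S j \<in> sets lebesgue" for j unfolding S_def by measurable
  have ind: "indicator {z. ennreal (2 ^ j * s) < z} (?G x) = (indicator (S j) x :: ennreal)"
    if "x \<in> Q" for x j using that by (simp add: S_def split: split_indicator)
  have "(\<integral>\<^sup>+x\<in>Q. ?G x epowr d * g x \<partial>lebesgue)
      \<le> (\<integral>\<^sup>+x. ennreal (s powr d) * h x + (\<Sum>j. b j * (h x * indicator (S j) x)) \<partial>lebesgue)"
  proof (rule nn_integral_mono)
    fix x
    show "?G x epowr d * g x * indicator Q x
      \<le> ennreal (s powr d) * h x + (\<Sum>j. b j * (h x * indicator (S j) x))"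
    proof (cases "x \<in> Q")
      case True
      have "?G x epowr d * h x \<le> (ennreal (s powr d) + ennreal (d * s powr d) *
          (\<Sum>j. ennreal (2 powr (real j * d)) * indicator (S j) x)) * h x"
        using epowr_le_level_sum[OF s _ d(2) G(1)[OF True] G(2)[OF True]] d(1) ind[OF True]
        by (intro mult_right_mono) auto
      also have "\<dots> = ennreal (s powr d) * h x + (\<Sum>j. b j * (h x * indicator (S j) x))"
      proof -
        have "(\<Sum>j. b j * (h x * indicator (S j) x)) =
            (\<Sum>j. ennreal (d * s powr d) * (ennreal (2 powr (real j * d)) * indicator (S j) x) * h x)"
          by (intro arg_cong[where f = suminf] ext) (simp only: b_def mult_ac)
        also have "\<dots> = ennreal (d * s powr d) *
            (\<Sum>j. ennreal (2 powr (real j * d)) * indicator (S j) x) * h x"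
          by (simp only: ennreal_suminf_multc ennreal_suminf_cmult)
        finally show ?thesis by (simp only: distrib_right)
      qed
      finally show ?thesis using True by (simp add: h_def)
    qed simp
  qed
  also have "\<dots> = ennreal (s powr d) * (\<integral>\<^sup>+x. h x \<partial>lebesgue)
      + (\<Sum>j. b j * (\<integral>\<^sup>+x. h x * indicator (S j) x \<partial>lebesgue))"
    by (simp add: nn_integral_add nn_integral_cmult nn_integral_suminf)
  finally have I: "(\<integral>\<^sup>+x\<in>Q. ?G x epowr d * g x \<partial>lebesgue)
    \<le> ennreal (s powr d) * (\<integral>\<^sup>+x. h x \<partial>lebesgue)
      + (\<Sum>j. b j * (\<integral>\<^sup>+x. h x * indicator (S j) x \<partial>lebesgue))" .
  have "(\<Sum>j. b j * (\<integral>\<^sup>+x. h x * indicator (S j) x \<partial>lebesgue))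
      \<le> (\<Sum>j. ennreal d * c * (ennreal ((2 ^ j * s) powr (1 + d)) * emeasure lebesgue (S j)))"
  proof (intro suminf_le)
    fix j
    have "(\<integral>\<^sup>+x. h x * indicator (S j) x \<partial>lebesgue) = (\<integral>\<^sup>+x\<in>S j. g x \<partial>lebesgue)"
      by (intro nn_integral_cong) (auto simp: h_def S_def split: split_indicator)
    also have "\<dots> \<le> c * ennreal (2 ^ j * s) * emeasure lebesgue (S j)"
      unfolding S_def using s by (intro level) simp
    finally have "b j * (\<integral>\<^sup>+x. h x * indicator (S j) x \<partial>lebesgue)
        \<le> b j * (c * ennreal (2 ^ j * s) * emeasure lebesgue (S j))"
      by (rule mult_left_mono) simp
    also have "\<dots> = c * (b j * ennreal (2 ^ j * s)) * emeasure lebesgue (S j)"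
      by (simp add: mult_ac)
    also have "b j * ennreal (2 ^ j * s) = ennreal d * ennreal ((2 ^ j * s) powr (1 + d))"
    proof -
      have "d * s powr d * 2 powr (real j * d) * (2 ^ j * s) = d * (2 ^ j * s) powr (1 + d)"
        using s by (simp add: dyadic_powr[OF s] powr_add distrib_left powr_realpow)
      then show ?thesis using s d by (simp add: b_def flip: ennreal_mult)
    qed
    finally show "b j * (\<integral>\<^sup>+x. h x * indicator (S j) x \<partial>lebesgue)
      \<le> ennreal d * c * (ennreal ((2 ^ j * s) powr (1 + d)) * emeasure lebesgue (S j))"
      by (simp add: mult_ac)
  qed auto
  also have "\<dots> = ennreal d * c *
      (\<integral>\<^sup>+x. (\<Sum>j. ennreal ((2 ^ j * s) powr (1 + d)) * indicator (S j) x) \<partial>lebesgue)"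
    by (simp add: nn_integral_suminf nn_integral_cmult_indicator ennreal_suminf_cmult)
  also have "\<dots> \<le> ennreal d * c * (\<integral>\<^sup>+x. 2 * (?G x epowr (1 + d) * indicator Q x) \<partial>lebesgue)"
  proof (intro mult_left_mono nn_integral_mono)
    fix x
    show "(\<Sum>j. ennreal ((2 ^ j * s) powr (1 + d)) * indicator (S j) x)
        \<le> 2 * (?G x epowr (1 + d) * indicator Q x)"
      using level_sum_le_epowr[OF s, of d "?G x"] d(1) ind[of x]
      by (cases "x \<in> Q") (simp_all add: S_def)
  qed simp
  also have "(\<integral>\<^sup>+x. 2 * (?G x epowr (1 + d) * indicator Q x) \<partial>lebesgue)
      = 2 * (\<integral>\<^sup>+x\<in>Q. ?G x epowr (1 + d) \<partial>lebesgue)"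
    using borel_measurable_cell_measurable[OF cell_measurable_epowr[OF cell_measurable_max]]
    by (intro nn_integral_cmult) simp
  finally have "(\<Sum>j. b j * (\<integral>\<^sup>+x. h x * indicator (S j) x \<partial>lebesgue))
    \<le> 2 * ennreal d * c * (\<integral>\<^sup>+x\<in>Q. ?G x epowr (1 + d) \<partial>lebesgue)"
    by (simp only: mult_ac)
  then show ?thesis
    using I unfolding h_def by (meson add_left_mono order_trans)
qed

text \<open>
  The level bound is used twice. With \<open>g\<close> the maximal function itself the choice of \<open>d\<close> makes the last
  term of \<open>nn_integral_epowr_max_le\<close> half of the left-hand side, which gives a bound proportional to \<open>T\<close>. With \<open>g = u\<close>
  that factor \<open>T\<close> is cancelled by \<open>d\<close>, so the final constant is absolute.
\<close>

lemma nn_integral_epowr_avg_le: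
  fixes T :: real
  assumes [measurable]: "u \<in> borel_measurable lebesgue" and T: "1 \<le> T"
    and d: "d = 1 / (2 ^ (CARD('n) + 2) * T)"
    and pos: "(\<integral>\<^sup>+x\<in>Q. u x \<partial>lebesgue) \<noteq> 0" and fin: "(\<integral>\<^sup>+x\<in>Q. u x \<partial>lebesgue) \<noteq> top"
    and local_max: "\<And>k x. x \<in> Q \<Longrightarrow> (\<integral>\<^sup>+y\<in>cell k x. (SUP j\<in>{k..N}. cell_avg u j y) \<partial>lebesgue)
      \<le> ennreal T * (\<integral>\<^sup>+y\<in>cell k x. u y \<partial>lebesgue)"
  shows "(\<integral>\<^sup>+x\<in>Q. cell_avg u N x epowr (1 + d) \<partial>lebesgue)
    \<le> 2 * cell_avg u 0 a epowr d * (\<integral>\<^sup>+x\<in>Q. u x \<partial>lebesgue)"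
proof -
  let ?G = "cell_max u N" and ?U = "\<integral>\<^sup>+x\<in>Q. u x \<partial>lebesgue" and ?n = "CARD('n)"
  have d': "0 < d" "d \<le> 1"
  proof -
    have "1 * 1 \<le> (2 ^ (?n + 2)) * T" using T by (intro mult_mono one_le_power) auto
    then show "0 < d" "d \<le> 1" using T by (auto simp: d divide_le_eq)
  qed
  have "cell_avg u 0 a \<noteq> 0" "cell_avg u 0 a \<noteq> top"
    using pos fin by (auto simp: cell_avg_def ennreal_divide_eq_top_iff)
  then obtain s where s: "cell_avg u 0 a = ennreal s" "0 < s"
    by (metis ennreal_cases infinity_ennreal_def less_eq_real_def ennreal_0)
  have G_ge: "ennreal s \<le> ?G x" if "x \<in> Q" for x
    unfolding cell_max_def s(1)[symmetric] cell_avg_0[OF that, symmetric] by (rule SUP_upper) simp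
  have G_le: "?G x \<le> ?U / emeasure lebesgue (cell N a)" if x: "x \<in> Q" for x
    unfolding cell_max_def
  proof (rule SUP_least)
    fix k assume k: "k \<in> {..N}"
    have "(\<integral>\<^sup>+y\<in>cell k x. u y \<partial>lebesgue) \<le> ?U"
      using cell_subset_Q[OF x, of k] by (intro nn_integral_mono) (auto split: split_indicator)
    also have "?U = emeasure lebesgue (cell N a) * (?U / emeasure lebesgue (cell N a))"
      using ennreal_mult_divide_eq[of "emeasure lebesgue (cell N a)" ?U]
      by (simp add: ennreal_times_divide mult.commute)
    also have "\<dots> \<le> emeasure lebesgue (cell k x) * (?U / emeasure lebesgue (cell N a))"
    proof (rule mult_right_mono)
      have "emeasure lebesgue (cell N a) = emeasure lebesgue (cell N x)" by (simp only: emeasure_cell)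
      also have "\<dots> \<le> emeasure lebesgue (cell k x)"
        using k cell_antimono[of k N x] by (intro emeasure_mono) auto
      finally show "emeasure lebesgue (cell N a) \<le> emeasure lebesgue (cell k x)" .
    qed simp
    finally show "cell_avg u k x \<le> ?U / emeasure lebesgue (cell N a)"
      unfolding cell_avg_def by (intro divide_le_posI_ennreal) (auto simp: zero_less_iff_neq_zero)
  qed
  then have G_fin: "?G x \<noteq> top" if "x \<in> Q" for x
    using that fin by (metis emeasure_cell_nontrivial(1) ennreal_divide_eq_top_iff top_unique)
  have G_meas: "(\<lambda>x. ?G x * indicator Q x) \<in> borel_measurable lebesgue"
    by (rule borel_measurable_cell_measurable[OF cell_measurable_max])
  \<comment> \<open>the parent of a stopping cell has average at most \<open>t\<close>, and \<open>2\<^sup>n\<close> times the volume\<close>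
  have stop_u: "(\<integral>\<^sup>+y\<in>cell k x. u y \<partial>lebesgue) \<le> ennreal (2 ^ ?n) * ennreal t * emeasure lebesgue (cell k x)"
    if "s \<le> t" "x \<in> Q" "ennreal t < cell_avg u k x" "\<forall>j<k. cell_avg u j x \<le> ennreal t" for k x t
  proof (cases k)
    case 0
    then show ?thesis using that s cell_avg_0[of x u] by (auto simp: ennreal_less_iff)
  next
    case (Suc k')
    have "(\<integral>\<^sup>+y\<in>cell k x. u y \<partial>lebesgue) \<le> (\<integral>\<^sup>+y\<in>cell k' x. u y \<partial>lebesgue)"
      using cell_antimono[of k' k x] Suc by (intro nn_integral_mono) (auto split: split_indicator)
    also have "\<dots> = cell_avg u k' x * emeasure lebesgue (cell k' x)"
      by (rule nn_integral_cell_eq_avg)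
    also have "\<dots> \<le> ennreal t * emeasure lebesgue (cell k' x)"
      using that Suc by (intro mult_right_mono) auto
    finally show ?thesis using Suc by (simp add: emeasure_cell_Suc[of k'] mult_ac)
  qed
  have level_u: "(\<integral>\<^sup>+x\<in>{x \<in> Q. ennreal t < ?G x}. u x \<partial>lebesgue)
      \<le> ennreal (2 ^ ?n) * ennreal t * emeasure lebesgue {x \<in> Q. ennreal t < ?G x}" if "s \<le> t" for t
  proof (rule nn_integral_superlevel_le)
    show "(\<lambda>x. u x * indicator Q x) \<in> borel_measurable lebesgue" by measurable
  qed (use stop_u[OF that] in blast)
  have level_G: "(\<integral>\<^sup>+x\<in>{x \<in> Q. ennreal t < ?G x}. ?G x \<partial>lebesgue)
      \<le> ennreal (T * 2 ^ ?n) * ennreal t * emeasure lebesgue {x \<in> Q. ennreal t < ?G x}" if "s \<le> t" for t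
  proof (rule nn_integral_superlevel_le[OF G_meas])
    fix k x
    assume x: "x \<in> Q" "k \<le> N" "ennreal t < cell_avg u k x" "\<forall>j<k. cell_avg u j x \<le> ennreal t"
    have "(\<integral>\<^sup>+y\<in>cell k x. ?G y \<partial>lebesgue) \<le> (\<integral>\<^sup>+y\<in>cell k x. (SUP j\<in>{k..N}. cell_avg u j y) \<partial>lebesgue)"
    proof (rule nn_integral_mono)
      fix y
      show "?G y * indicator (cell k x) y \<le> (SUP j\<in>{k..N}. cell_avg u j y) * indicator (cell k x) y"
      proof (cases "y \<in> cell k x")
        case True
        have "cell_avg u j y \<le> (SUP j\<in>{k..N}. cell_avg u j y)" if "j \<le> N" for j
        proof (cases "j < k")
          case True
          \<comment> \<open>before the stopping generation the averages do not exceed the one at stopping\<close>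
          have "cell_avg u j y = cell_avg u j x" "cell_avg u k y = cell_avg u k x"
            using True cell_avg_cong[OF \<open>y \<in> cell k x\<close>] by auto
          then have "cell_avg u j y \<le> cell_avg u k y"
            using x(3,4) True by (metis order.trans less_imp_le)
          also have "\<dots> \<le> (SUP j\<in>{k..N}. cell_avg u j y)" using x by (intro SUP_upper) auto
          finally show ?thesis .
        qed (use that in \<open>auto intro!: SUP_upper\<close>)
        then have "?G y \<le> (SUP j\<in>{k..N}. cell_avg u j y)"
          unfolding cell_max_def by (intro SUP_least) auto
        then show ?thesis by (rule mult_right_mono) simp
      qed simp
    qed
    also have "\<dots> \<le> ennreal T * (\<integral>\<^sup>+y\<in>cell k x. u y \<partial>lebesgue)" using x by (intro local_max)
    also have "\<dots> \<le> ennreal T * (ennreal (2 ^ ?n) * ennreal t * emeasure lebesgue (cell k x))"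
      using stop_u[OF that x(1,3,4)] by (intro mult_left_mono) auto
    finally show "(\<integral>\<^sup>+y\<in>cell k x. ?G y \<partial>lebesgue)
        \<le> ennreal (T * 2 ^ ?n) * ennreal t * emeasure lebesgue (cell k x)"
      using T by (simp add: ennreal_mult mult_ac)
  qed
  define I where "I = (\<integral>\<^sup>+x\<in>Q. ?G x epowr (1 + d) \<partial>lebesgue)"
  have "I \<le> (\<integral>\<^sup>+x\<in>Q. (?U / emeasure lebesgue (cell N a)) epowr (1 + d) \<partial>lebesgue)"
    unfolding I_def using G_le d'
    by (intro nn_integral_mono) (auto intro!: epowr_mono split: split_indicator)
  also have "\<dots> < top"
    using fin by (simp add: nn_integral_cmult_indicator less_top[symmetric] ennreal_mult_eq_top_iff
        ennreal_divide_eq_top_iff)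
  finally have I_fin: "I \<noteq> top" by simp
  have "I = (\<integral>\<^sup>+x\<in>Q. ?G x epowr d * ?G x \<partial>lebesgue)"
    by (simp add: I_def epowr_mult_self add.commute)
  also have "\<dots> \<le> ennreal (s powr d) * (\<integral>\<^sup>+x\<in>Q. ?G x \<partial>lebesgue) + 2 * ennreal d * ennreal (T * 2 ^ ?n) * I"
    unfolding I_def by (rule nn_integral_epowr_max_le[OF s(2) d' assms(1) G_ge G_fin G_meas level_G])
  also have "\<dots> \<le> ennreal (s powr d) * (ennreal T * ?U) + 2 * ennreal d * ennreal (T * 2 ^ ?n) * I"
    using local_max[of a 0]
    by (intro add_right_mono mult_left_mono) (simp_all add: cell_max_def atLeast0AtMost)
  \<comment> \<open>absorption, possible because \<open>I\<close> is finite\<close>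
  also have "2 * ennreal d * ennreal (T * 2 ^ ?n) = ennreal (1 / 2)"
  proof -
    have "2 * ennreal d * ennreal (T * 2 ^ ?n) = ennreal (2 * d * (T * 2 ^ ?n))"
      using T d' by (simp add: ennreal_mult')
    also have "2 * d * (T * 2 ^ ?n) = 1 / 2" using T by (simp add: d power_add)
    finally show ?thesis .
  qed
  finally have I1: "I \<le> ennreal (s powr d) * (ennreal T * ?U) + ennreal (1 / 2) * I" .
  obtain i r where ir: "I = ennreal i" "0 \<le> i" "?U = ennreal r" "0 \<le> r"
    using I_fin fin by (metis ennreal_cases infinity_ennreal_def)
  have "ennreal i \<le> ennreal (s powr d * (T * r) + 1 / 2 * i)"
    using I1 T ir by (simp only: ennreal_mult ennreal_plus mult_nonneg_nonneg powr_ge_zero)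
  then have i: "i \<le> 2 * (s powr d * (T * r))"
    using T ir by (subst (asm) ennreal_le_iff) auto
  have "(\<integral>\<^sup>+x\<in>Q. cell_avg u N x epowr (1 + d) \<partial>lebesgue)
      = (\<integral>\<^sup>+x\<in>Q. cell_avg u N x epowr d * cell_avg u N x \<partial>lebesgue)"
    by (simp add: epowr_mult_self add.commute)
  also have "\<dots> = (\<integral>\<^sup>+x\<in>Q. cell_avg u N x epowr d * u x \<partial>lebesgue)"
    by (intro nn_integral_cell_avg cell_measurable_epowr cell_measurable_avg) simp
  also have "\<dots> \<le> (\<integral>\<^sup>+x\<in>Q. ?G x epowr d * u x \<partial>lebesgue)"
    using d' by (intro nn_integral_mono mult_right_mono epowr_mono) (auto simp: cell_max_def intro: SUP_upper)
  also have "\<dots> \<le> ennreal (s powr d) * ?U + 2 * ennreal d * ennreal (2 ^ ?n) * I"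
    unfolding I_def by (rule nn_integral_epowr_max_le[OF s(2) d' assms(1) G_ge G_fin _ level_u]) auto
  also have "\<dots> = ennreal (s powr d * r + 2 * d * 2 ^ ?n * i)"
    using ir d' by (simp add: ennreal_mult')
  also have "\<dots> \<le> ennreal (2 * s powr d * r)"
  proof (rule ennreal_leI)
    have "2 * d * 2 ^ ?n * i \<le> 2 * d * 2 ^ ?n * (2 * (s powr d * (T * r)))"
      using i d' by (intro mult_left_mono) auto
    also have "\<dots> = s powr d * r" using T by (simp add: d power_add)
    finally show "s powr d * r + 2 * d * 2 ^ ?n * i \<le> 2 * s powr d * r" by (simp add: mult.commute)
  qed
  finally show ?thesis using s ir by (simp add: epowr_ennreal ennreal_mult')
qed

end


section \<open>From dyadic averages to the function\<close>

lemma tendsto_epowr: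
  assumes a: "0 < a" and f: "(f \<longlongrightarrow> x) F"
  shows "((\<lambda>t. f t epowr a) \<longlongrightarrow> x epowr a) F"
proof -
  have "surj (\<lambda>x. x epowr a)"
    by (rule surjI[where f = "\<lambda>x. x epowr (1 / a)"]) (use a in \<open>simp add: epowr_epowr\<close>)
  then have "continuous_on UNIV (\<lambda>x. x epowr a)"
    using a by (intro continuous_onI_mono) (auto intro: epowr_mono)
  then show ?thesis
    by (rule continuous_on_tendsto_compose[OF _ f]) auto
qed

context dyadic_cells
begin

lemma cell_subset_open:
  assumes "open U" "x \<in> U"
  shows "eventually (\<lambda>N. cell N x \<subseteq> U) sequentially"
proof -
  obtain r where r: "0 < r" "ball x r \<subseteq> U" using assms open_contains_ball by blast
  have "(\<lambda>N. real CARD('n) * (l / 2 ^ N)) \<longlonglongrightarrow> 0"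
    by real_asymp
  then have "eventually (\<lambda>N. real CARD('n) * (l / 2 ^ N) < r) sequentially"
    using r(1) by (rule order_tendstoD)
  then show ?thesis
  proof eventually_elim
    case (elim N)
    then have "cell N x \<subseteq> ball x r"
      using cell_diam[of _ N x] by (force simp: dist_commute)
    then show ?case using r by blast
  qed
qed

text \<open>
  Young's inequality linearises the power, so that only the pairing of \<open>u\<close> with a continuous function
  has to be passed to the limit along the dyadic cells.
\<close>

lemma nn_integral_continuous_mult_le:
  assumes d: "0 < d" and [measurable]: "u \<in> borel_measurable lebesgue" and u: "\<And>x. u x < top"
    and K: "\<And>N. (\<integral>\<^sup>+x\<in>Q. cell_avg u N x epowr (1 + d) \<partial>lebesgue) \<le> K"
    and g: "continuous_on UNIV g" "\<And>x. 0 \<le> g x"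
  shows "(\<integral>\<^sup>+x\<in>Q. ennreal (1 + d) * u x * ennreal (g x) epowr d \<partial>lebesgue)
    \<le> K + ennreal d * (\<integral>\<^sup>+x\<in>Q. ennreal (g x) epowr (1 + d) \<partial>lebesgue)"
proof -
  \<comment> \<open>a minorant of \<open>g\<close> that is constant on cells and increases to \<open>g\<close> by continuity\<close>
  define \<phi> where "\<phi> N x = (INF y\<in>cell N x. ennreal (g y))" for N x
  have \<phi>_le: "\<phi> N x \<le> ennreal (g x)" for N x
    unfolding \<phi>_def by (rule INF_lower) simp
  have \<phi>_meas: "cell_measurable N (\<phi> N)" for N
    unfolding cell_measurable_def \<phi>_def using cell_eq by metis
  have cont: "continuous_on UNIV (\<lambda>y. ennreal (g y))"
    using g(1) by (intro continuous_on_ennreal)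
  have lim: "(\<lambda>N. \<phi> N x) \<longlonglongrightarrow> ennreal (g x)" for x
  proof (rule order_tendstoI)
    fix c assume "c < ennreal (g x)"
    then obtain c' where c': "c < c'" "c' < ennreal (g x)" using dense by blast
    have "open {y. c' < ennreal (g y)}" by (intro open_Collect_less cont continuous_on_const)
    then have "eventually (\<lambda>N. cell N x \<subseteq> {y. c' < ennreal (g y)}) sequentially"
      using c' by (intro cell_subset_open) auto
    then show "eventually (\<lambda>N. c < \<phi> N x) sequentially"
    proof eventually_elim
      case (elim N)
      then have "c' \<le> \<phi> N x" unfolding \<phi>_def by (intro INF_greatest) (auto intro: less_imp_le)
      then show ?case using c' by simp
    qed
  next
    fix c assume "ennreal (g x) < c"
    then show "eventually (\<lambda>N. \<phi> N x < c) sequentially"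
      using \<phi>_le by (intro always_eventually allI) (meson order_le_less_trans)
  qed
  have m1: "(\<lambda>x. \<phi> N x epowr e * indicator Q x) \<in> borel_measurable lebesgue" for N e
    by (rule borel_measurable_cell_measurable[OF cell_measurable_epowr[OF \<phi>_meas]])
  have "(\<lambda>x. ennreal (1 + d) * u x * (\<phi> N x epowr d * indicator Q x)) \<in> borel_measurable lebesgue" for N
    using m1[of N d] by measurable
  then have m2: "(\<lambda>x. ennreal (1 + d) * u x * \<phi> N x epowr d * indicator Q x) \<in> borel_measurable lebesgue" for N
    by (simp add: mult.assoc)
  have bound: "(\<integral>\<^sup>+x\<in>Q. ennreal (1 + d) * u x * \<phi> N x epowr d \<partial>lebesgue)
      \<le> K + ennreal d * (\<integral>\<^sup>+x\<in>Q. ennreal (g x) epowr (1 + d) \<partial>lebesgue)" for N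
  proof -
    have "(\<integral>\<^sup>+x\<in>Q. ennreal (1 + d) * u x * \<phi> N x epowr d \<partial>lebesgue)
        = (\<integral>\<^sup>+x\<in>Q. (ennreal (1 + d) * \<phi> N x epowr d) * u x \<partial>lebesgue)"
      by (simp only: mult_ac)
    also have "\<dots> = (\<integral>\<^sup>+x\<in>Q. (ennreal (1 + d) * \<phi> N x epowr d) * cell_avg u N x \<partial>lebesgue)"
    proof (rule nn_integral_cell_avg[symmetric])
      show "cell_measurable N (\<lambda>x. ennreal (1 + d) * \<phi> N x epowr d)"
        by (rule cell_measurable_mult[OF _ cell_measurable_epowr[OF \<phi>_meas]])
          (simp add: cell_measurable_def)
    qed simp
    also have "\<dots> \<le> (\<integral>\<^sup>+x. cell_avg u N x epowr (1 + d) * indicator Q x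
        + ennreal d * (\<phi> N x epowr (1 + d) * indicator Q x) \<partial>lebesgue)"
    proof (rule nn_integral_mono)
      fix x
      show "ennreal (1 + d) * \<phi> N x epowr d * cell_avg u N x * indicator Q x
        \<le> cell_avg u N x epowr (1 + d) * indicator Q x
          + ennreal d * (\<phi> N x epowr (1 + d) * indicator Q x)"
        using Young_tangent_ennreal[of "1 + d" "cell_avg u N x" "\<phi> N x"] d
        by (cases "x \<in> Q") (simp_all add: mult_ac)
    qed
    also have "\<dots> = (\<integral>\<^sup>+x\<in>Q. cell_avg u N x epowr (1 + d) \<partial>lebesgue)
        + ennreal d * (\<integral>\<^sup>+x\<in>Q. \<phi> N x epowr (1 + d) \<partial>lebesgue)"
      using m1[of N "1 + d"] borel_measurable_cell_measurable[OF cell_measurable_epowr[OF cell_measurable_avg]]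
      by (simp add: nn_integral_add nn_integral_cmult)
    also have "\<dots> \<le> K + ennreal d * (\<integral>\<^sup>+x\<in>Q. ennreal (g x) epowr (1 + d) \<partial>lebesgue)"
      using d by (intro add_mono K mult_left_mono nn_integral_mono mult_right_mono epowr_mono \<phi>_le) auto
    finally show ?thesis .
  qed
  have "(\<integral>\<^sup>+x\<in>Q. ennreal (1 + d) * u x * ennreal (g x) epowr d \<partial>lebesgue)
      = (\<integral>\<^sup>+x. liminf (\<lambda>N. ennreal (1 + d) * u x * \<phi> N x epowr d * indicator Q x) \<partial>lebesgue)"
  proof (rule nn_integral_cong)
    fix x
    have "(\<lambda>N. (ennreal (1 + d) * u x * indicator Q x) * \<phi> N x epowr d)
        \<longlonglongrightarrow> (ennreal (1 + d) * u x * indicator Q x) * ennreal (g x) epowr d"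
      using u[of x]
      by (intro ennreal_tendsto_cmult tendsto_epowr d lim) (auto simp: ennreal_mult_less_top split: split_indicator)
    then show "ennreal (1 + d) * u x * ennreal (g x) epowr d * indicator Q x
        = liminf (\<lambda>N. ennreal (1 + d) * u x * \<phi> N x epowr d * indicator Q x)"
      by (simp add: lim_imp_Liminf mult_ac)
  qed
  also have "\<dots> \<le> liminf (\<lambda>N. \<integral>\<^sup>+x\<in>Q. ennreal (1 + d) * u x * \<phi> N x epowr d \<partial>lebesgue)"
    by (intro nn_integral_liminf m2)
  also have "\<dots> \<le> liminf (\<lambda>N::nat. K + ennreal d * (\<integral>\<^sup>+x\<in>Q. ennreal (g x) epowr (1 + d) \<partial>lebesgue))"
    by (intro Liminf_mono always_eventually allI bound)
  also have "\<dots> = K + ennreal d * (\<integral>\<^sup>+x\<in>Q. ennreal (g x) epowr (1 + d) \<partial>lebesgue)"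
    by (simp add: Liminf_const)
  finally show ?thesis .
qed

text \<open>
  A bound for the powers of all dyadic averages passes to the function itself. The function is
  truncated first, so that continuous approximations converge boundedly and the term on the right of
  Young's inequality can be absorbed.
\<close>

lemma nn_integral_epowr_le_of_cell_avg:
  fixes \<sigma> :: "real ^ 'n \<Rightarrow> real"
  assumes d: "0 < d" and [measurable]: "\<sigma> \<in> borel_measurable lebesgue" and \<sigma>: "\<And>x. 0 \<le> \<sigma> x"
    and K: "\<And>N. (\<integral>\<^sup>+x\<in>Q. cell_avg (\<lambda>x. ennreal (\<sigma> x)) N x epowr (1 + d) \<partial>lebesgue) \<le> K"
  shows "(\<integral>\<^sup>+x\<in>Q. ennreal (\<sigma> x) epowr (1 + d) \<partial>lebesgue) \<le> K"
proof -
  have truncated: "(\<integral>\<^sup>+x\<in>Q. ennreal (min (\<sigma> x) B) epowr (1 + d) \<partial>lebesgue) \<le> K" if B: "0 \<le> B" for B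
  proof -
    define h where "h x = min (\<sigma> x) B" for x
    have [measurable]: "h \<in> borel_measurable lebesgue" unfolding h_def by measurable
    have h: "0 \<le> h x" "h x \<le> B" "h x \<le> \<sigma> x" for x using \<sigma> B by (auto simp: h_def)
    have "h measurable_on UNIV"
      by (rule lebesgue_measurable_imp_measurable_on_nnreal_UNIV) (use h in auto)
    then obtain N g where Ng: "negligible N" "\<And>n. continuous_on UNIV (g n)"
        "\<And>x. x \<notin> N \<Longrightarrow> (\<lambda>n. g n x) \<longlonglongrightarrow> h x"
      unfolding measurable_on_def by auto
    define g' where "g' n x = max 0 (min B (g n x))" for n :: nat and x
    have cont: "continuous_on UNIV (g' n)" for n
      unfolding g'_def by (intro continuous_intros Ng)
    have [measurable]: "g' n \<in> borel_measurable lebesgue" for n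
      using borel_measurable_continuous_onI[OF cont[of n]] by (simp add: measurable_completion)
    have g': "0 \<le> g' n x" "g' n x \<le> B" for n x using B by (auto simp: g'_def)
    have "AE x in lebesgue. x \<notin> N" using Ng(1) unfolding negligible_iff_null_sets by (rule AE_not_in)
    then have lim: "AE x in lebesgue. (\<lambda>n. ennreal (g' n x)) \<longlonglongrightarrow> ennreal (h x)"
    proof eventually_elim
      case (elim x)
      then have "(\<lambda>n. g' n x) \<longlonglongrightarrow> max 0 (min B (h x))"
        unfolding g'_def by (intro tendsto_intros Ng)
      then show ?case using h[of x] by (intro tendsto_ennrealI) (simp add: min_absorb2 max_absorb2)
    qed
    let ?X = "\<integral>\<^sup>+x\<in>Q. ennreal (h x) epowr (1 + d) \<partial>lebesgue"
    have "(\<integral>\<^sup>+x\<in>Q. ennreal (B powr (1 + d)) \<partial>lebesgue) < \<infinity>"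
      by (simp add: nn_integral_cmult_indicator ennreal_mult_eq_top_iff less_top[symmetric])
    then have limX: "(\<lambda>n. \<integral>\<^sup>+x\<in>Q. ennreal (g' n x) epowr (1 + d) \<partial>lebesgue) \<longlonglongrightarrow> ?X"
    proof (intro nn_integral_dominated_convergence
        [where w = "\<lambda>x. ennreal (B powr (1 + d)) * indicator Q x"])
      show "AE x in lebesgue. (\<lambda>n. ennreal (g' n x) epowr (1 + d) * indicator Q x)
          \<longlonglongrightarrow> ennreal (h x) epowr (1 + d) * indicator Q x"
        using lim
      proof eventually_elim
        case (elim x)
        then have "(\<lambda>n. ennreal (g' n x) epowr (1 + d)) \<longlonglongrightarrow> ennreal (h x) epowr (1 + d)"
          using d by (intro tendsto_epowr) auto
        then show ?case by (cases "x \<in> Q") auto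
      qed
      show "AE x in lebesgue. ennreal (g' n x) epowr (1 + d) * indicator Q x
          \<le> ennreal (B powr (1 + d)) * indicator Q x" for n
        using g'[of n] d by (intro always_eventually allI mult_right_mono)
          (auto simp: epowr_ennreal intro!: ennreal_leI powr_mono2)
    qed measurable
    have "(\<integral>\<^sup>+x\<in>Q. ennreal (B powr (1 + d)) \<partial>lebesgue) \<noteq> top"
      by (simp add: nn_integral_cmult_indicator ennreal_mult_eq_top_iff)
    moreover have "?X \<le> (\<integral>\<^sup>+x\<in>Q. ennreal (B powr (1 + d)) \<partial>lebesgue)"
      using h d by (intro nn_integral_mono mult_right_mono)
        (auto simp: epowr_ennreal intro!: ennreal_leI powr_mono2)
    ultimately have X_fin: "?X \<noteq> top" by (auto simp: top_unique)
    have "ennreal (1 + d) * ?X = (\<integral>\<^sup>+x\<in>Q. ennreal (1 + d) * ennreal (h x) * ennreal (h x) epowr d \<partial>lebesgue)"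
    proof -
      have "ennreal (1 + d) * ?X = (\<integral>\<^sup>+x. ennreal (1 + d) * (ennreal (h x) epowr (1 + d) * indicator Q x) \<partial>lebesgue)"
        by (rule nn_integral_cmult[symmetric]) measurable
      also have "\<dots> = (\<integral>\<^sup>+x\<in>Q. ennreal (1 + d) * ennreal (h x) * ennreal (h x) epowr d \<partial>lebesgue)"
      proof (rule nn_integral_cong)
        fix x
        have "ennreal (h x) epowr (1 + d) = ennreal (h x) * ennreal (h x) epowr d"
          using epowr_add[of "ennreal (h x)" 1 d] by simp
        then show "ennreal (1 + d) * (ennreal (h x) epowr (1 + d) * indicator Q x)
            = ennreal (1 + d) * ennreal (h x) * ennreal (h x) epowr d * indicator Q x"
          by (simp only: mult.assoc)
      qed
      finally show ?thesis .
    qed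
    also have "\<dots> \<le> (\<integral>\<^sup>+x\<in>Q. ennreal (1 + d) * ennreal (\<sigma> x) * ennreal (h x) epowr d \<partial>lebesgue)"
      using h by (intro nn_integral_mono mult_right_mono mult_left_mono ennreal_leI) auto
    also have "\<dots> = (\<integral>\<^sup>+x. liminf (\<lambda>n. ennreal (1 + d) * ennreal (\<sigma> x) * ennreal (g' n x) epowr d
        * indicator Q x) \<partial>lebesgue)"
    proof (rule nn_integral_cong_AE)
      show "AE x in lebesgue. ennreal (1 + d) * ennreal (\<sigma> x) * ennreal (h x) epowr d * indicator Q x
        = liminf (\<lambda>n. ennreal (1 + d) * ennreal (\<sigma> x) * ennreal (g' n x) epowr d * indicator Q x)"
        using lim
      proof eventually_elim
        case (elim x)
        have "(\<lambda>n. (ennreal (1 + d) * ennreal (\<sigma> x) * indicator Q x) * ennreal (g' n x) epowr d)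
            \<longlonglongrightarrow> (ennreal (1 + d) * ennreal (\<sigma> x) * indicator Q x) * ennreal (h x) epowr d"
          by (intro ennreal_tendsto_cmult tendsto_epowr d elim)
            (auto simp: ennreal_mult_less_top split: split_indicator)
        then show ?case by (simp add: lim_imp_Liminf mult_ac)
      qed
    qed
    also have "\<dots> \<le> liminf (\<lambda>n. \<integral>\<^sup>+x\<in>Q. ennreal (1 + d) * ennreal (\<sigma> x) * ennreal (g' n x) epowr d \<partial>lebesgue)"
      by (intro nn_integral_liminf) measurable
    also have "\<dots> \<le> liminf (\<lambda>n. K + ennreal d * (\<integral>\<^sup>+x\<in>Q. ennreal (g' n x) epowr (1 + d) \<partial>lebesgue))"
      by (intro Liminf_mono always_eventually allI nn_integral_continuous_mult_le d K cont g') auto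
    also have "\<dots> = K + ennreal d * ?X"
      by (intro lim_imp_Liminf tendsto_add tendsto_const ennreal_tendsto_cmult limX) auto
    finally have le: "ennreal (1 + d) * ?X \<le> K + ennreal d * ?X" .
    have "?X \<le> K"
    proof (cases "K = top")
      case False
      then obtain k where k: "K = ennreal k" "0 \<le> k" by (cases K) auto
      obtain x where x: "?X = ennreal x" "0 \<le> x" using X_fin by (cases ?X) auto
      note kx = k x
      have "ennreal (1 + d) * ennreal x \<le> ennreal k + ennreal d * ennreal x"
        using le unfolding kx .
      then have "ennreal ((1 + d) * x) \<le> ennreal (k + d * x)"
        using kx(2,4) d by (simp only: ennreal_mult ennreal_plus mult_nonneg_nonneg add_nonneg_nonneg less_imp_le zero_le_one)
      then have "(1 + d) * x \<le> k + d * x"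
        using kx d by (subst (asm) ennreal_le_iff) auto
      then show ?thesis unfolding kx by (intro ennreal_leI) (simp add: algebra_simps)
    qed simp
    then show ?thesis by (simp add: h_def)
  qed
  have "(\<integral>\<^sup>+x\<in>Q. ennreal (\<sigma> x) epowr (1 + d) \<partial>lebesgue)
      = (\<integral>\<^sup>+x. liminf (\<lambda>m. ennreal (min (\<sigma> x) (real m)) epowr (1 + d) * indicator Q x) \<partial>lebesgue)"
  proof (rule nn_integral_cong)
    fix x
    obtain m0 :: nat where m0: "\<sigma> x \<le> real m0" using real_arch_simple by blast
    have "(\<lambda>m. ennreal (min (\<sigma> x) (real m)) epowr (1 + d) * indicator Q x)
        \<longlonglongrightarrow> ennreal (\<sigma> x) epowr (1 + d) * indicator Q x"
      by (rule tendsto_eventually, rule eventually_sequentiallyI[of m0]) (use m0 in \<open>simp add: min_def\<close>)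
    then show "ennreal (\<sigma> x) epowr (1 + d) * indicator Q x
        = liminf (\<lambda>m. ennreal (min (\<sigma> x) (real m)) epowr (1 + d) * indicator Q x)"
      by (simp add: lim_imp_Liminf)
  qed
  also have "\<dots> \<le> liminf (\<lambda>m. \<integral>\<^sup>+x\<in>Q. ennreal (min (\<sigma> x) (real m)) epowr (1 + d) \<partial>lebesgue)"
    by (intro nn_integral_liminf) measurable
  also have "\<dots> \<le> liminf (\<lambda>m::nat. K)"
    by (intro Liminf_mono always_eventually allI truncated) simp
  also have "\<dots> = K" by (simp add: Liminf_const)
  finally show ?thesis .
qed

end

section \<open>The reverse Hoelder inequality\<close>

lemma emeasure_weighted:
  assumes [measurable]: "w \<in> borel_measurable lebesgue" "S \<in> sets lebesgue"
    and pos: "AE x in lebesgue. 0 < w x"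
  shows "emeasure (weighted w) S = (\<integral>\<^sup>+x\<in>S. ennreal \<bar>w x\<bar> \<partial>lebesgue)"
  unfolding weighted_def using pos
  by (subst emeasure_density) (auto intro!: nn_integral_cong_AE)

lemma nn_integral_cube_neq_0:
  assumes [measurable]: "w \<in> borel_measurable lebesgue" and pos: "AE x in lebesgue. 0 < w x"
    and Q: "Q \<in> cubes"
  shows "(\<integral>\<^sup>+x\<in>Q. ennreal \<bar>w x\<bar> \<partial>lebesgue) \<noteq> 0"
proof
  note [measurable] = emeasure_cubes(3)[OF Q]
  assume "(\<integral>\<^sup>+x\<in>Q. ennreal \<bar>w x\<bar> \<partial>lebesgue) = 0"
  then have "AE x in lebesgue. ennreal \<bar>w x\<bar> * indicator Q x = 0"
    by (subst (asm) nn_integral_0_iff_AE) auto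
  then have "AE x in lebesgue. x \<notin> Q"
    using pos by eventually_elim (auto split: split_indicator)
  then have "emeasure lebesgue Q = 0"
    using emeasure_cubes(3)[OF Q] by (simp add: AE_iff_null_sets null_setsD1)
  then show False using emeasure_cubes(1)[OF Q] by simp
qed

lemma A_infty_const_bound:
  fixes \<sigma> :: "real ^ 'n \<Rightarrow> real"
  assumes \<sigma>: "\<sigma> \<in> borel_measurable lebesgue" and pos: "AE x in lebesgue. 0 < \<sigma> x"
    and fin: "\<And>Q. Q \<in> cubes \<Longrightarrow> (\<integral>\<^sup>+x\<in>Q. ennreal \<bar>\<sigma> x\<bar> \<partial>lebesgue) \<noteq> top"
    and Q: "Q \<in> cubes"
  shows "(\<integral>\<^sup>+x\<in>Q. maximal (\<lambda>y. \<sigma> y * indicator Q y) x \<partial>lebesgue)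
    \<le> A_infty_const \<sigma> * (\<integral>\<^sup>+x\<in>Q. ennreal \<bar>\<sigma> x\<bar> \<partial>lebesgue)"
proof -
  let ?I = "\<integral>\<^sup>+x\<in>Q. maximal (\<lambda>y. \<sigma> y * indicator Q y) x \<partial>lebesgue"
    and ?S = "\<integral>\<^sup>+x\<in>Q. ennreal \<bar>\<sigma> x\<bar> \<partial>lebesgue"
  have S: "?S \<noteq> 0" "?S \<noteq> top" using nn_integral_cube_neq_0[OF \<sigma> pos Q] fin[OF Q] by auto
  have "?I / ?S \<le> A_infty_const \<sigma>"
    unfolding A_infty_const_def emeasure_weighted[OF \<sigma> emeasure_cubes(3)[OF Q] pos, symmetric]
    using Q by (rule SUP_upper)
  then have "?I / ?S * ?S \<le> A_infty_const \<sigma> * ?S" by (rule mult_right_mono) simp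
  then show ?thesis using S
    by (simp add: ennreal_divide_times ennreal_divide_self less_top)
qed

lemma A_infty_const_ge_1:
  fixes \<sigma> :: "real ^ 'n \<Rightarrow> real"
  assumes \<sigma>: "\<sigma> \<in> borel_measurable lebesgue" and pos: "AE x in lebesgue. 0 < \<sigma> x"
    and fin: "\<And>Q. Q \<in> cubes \<Longrightarrow> (\<integral>\<^sup>+x\<in>Q. ennreal \<bar>\<sigma> x\<bar> \<partial>lebesgue) \<noteq> top"
  shows "1 \<le> A_infty_const \<sigma>"
proof -
  define Q where "Q = cube (0 :: real ^ 'n) 1"
  have Q: "Q \<in> cubes" "emeasure lebesgue Q = 1" by (auto simp: Q_def emeasure_cube)
  let ?S = "\<integral>\<^sup>+x\<in>Q. ennreal \<bar>\<sigma> x\<bar> \<partial>lebesgue"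
  have S: "?S \<noteq> 0" "?S \<noteq> top" using nn_integral_cube_neq_0[OF \<sigma> pos Q(1)] fin[OF Q(1)] by auto
  have avg: "avg Q (\<lambda>y. \<sigma> y * indicator Q y) = ?S"
  proof -
    have "(\<integral>\<^sup>+x\<in>Q. ennreal \<bar>\<sigma> x * indicator Q x\<bar> \<partial>lebesgue) = ?S"
      by (intro nn_integral_cong) (auto split: split_indicator)
    then show ?thesis using ennreal_mult_divide_eq[of 1 ?S] by (simp add: avg_def Q(2))
  qed
  have "?S = (\<integral>\<^sup>+x\<in>Q. avg Q (\<lambda>y. \<sigma> y * indicator Q y) \<partial>lebesgue)"
    using Q emeasure_cubes(3)[OF Q(1)] by (simp add: avg nn_integral_cmult_indicator)
  also have "\<dots> \<le> (\<integral>\<^sup>+x\<in>Q. maximal (\<lambda>y. \<sigma> y * indicator Q y) x \<partial>lebesgue)"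
    using avg_le_maximal[OF _ Q(1)] by (intro nn_integral_mono) (auto split: split_indicator)
  also have "\<dots> \<le> A_infty_const \<sigma> * ?S"
    by (rule A_infty_const_bound[OF \<sigma> pos fin Q(1)])
  finally have "?S * 1 \<le> ?S * A_infty_const \<sigma>" by (simp add: mult.commute)
  then show ?thesis using S by (subst (asm) ennreal_mult_le_mult_iff) auto
qed

text \<open>
  Applied to each dyadic subcell, the definition of the Fujii--Wilson constant controls the local dyadic maximal
  function, which is the hypothesis of \<open>nn_integral_epowr_avg_le\<close>. The gain \<open>d\<close> in the exponent is inversely
  proportional to that constant, and the factor \<open>2\<close> does not depend on \<open>\<sigma>\<close>.
\<close>

theorem reverse_Hoelder:
  fixes \<sigma> :: "real ^ 'n \<Rightarrow> real"
  assumes [measurable]: "\<sigma> \<in> borel_measurable lebesgue" and pos: "AE x in lebesgue. 0 < \<sigma> x"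
    and fin: "\<And>Q. Q \<in> cubes \<Longrightarrow> (\<integral>\<^sup>+x\<in>Q. ennreal \<bar>\<sigma> x\<bar> \<partial>lebesgue) \<noteq> top"
    and T: "A_infty_const \<sigma> = ennreal T" "1 \<le> T"
    and d: "d = 1 / (2 ^ (CARD('n) + 2) * T)"
    and Q: "Q \<in> cubes"
  shows "(\<integral>\<^sup>+x\<in>Q. ennreal \<bar>\<sigma> x\<bar> epowr (1 + d) \<partial>lebesgue) \<le> 2 * emeasure lebesgue Q * avg Q \<sigma> epowr (1 + d)"
proof -
  obtain a l where al: "Q = cube a l" "0 < l" using Q by (auto simp: cubes_eq)
  interpret dyadic_cells a l by standard (rule al)
  define u where "u x = ennreal \<bar>\<sigma> x\<bar>" for x
  have [measurable]: "u \<in> borel_measurable lebesgue" unfolding u_def by measurable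
  have d0: "0 < d" using T by (simp add: d)
  have Qc: "Q = closed_cell 0 a" by (simp add: al closed_cell_0)
  have cell_Q: "(\<integral>\<^sup>+x\<in>cell 0 a. h x \<partial>lebesgue) = (\<integral>\<^sup>+x\<in>Q. h x \<partial>lebesgue)" for h
    unfolding Qc by (rule nn_integral_closed_cell[symmetric])
  have avg: "cell_avg u 0 a = avg Q \<sigma>"
    unfolding cell_avg_def avg_def cell_Q Qc emeasure_closed_cell by (simp add: u_def)
  \<comment> \<open>inside a cell, averages over smaller cells only see the part of \<open>\<sigma>\<close> on that cell\<close>
  have local_max: "(\<integral>\<^sup>+y\<in>cell k x. (SUP j\<in>{k..N}. cell_avg u j y) \<partial>lebesgue)
      \<le> ennreal T * (\<integral>\<^sup>+y\<in>cell k x. u y \<partial>lebesgue)" for k N x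
  proof -
    define C where "C = closed_cell k x"
    have C: "C \<in> cubes" by (simp add: C_def)
    have "cell_avg u j y \<le> maximal (\<lambda>z. \<sigma> z * indicator C z) y" if y: "y \<in> cell k x" and j: "k \<le> j" for j y
    proof -
      have sub: "cell j y \<subseteq> C"
        using cell_antimono[OF j, of y] cell_eq[OF y] cell_subset_closed_cell[of k x] by (auto simp: C_def)
      have "cell_avg u j y = (\<integral>\<^sup>+z\<in>cell j y. ennreal \<bar>\<sigma> z * indicator C z\<bar> \<partial>lebesgue) / emeasure lebesgue (cell j y)"
        unfolding cell_avg_def u_def using sub
        by (intro arg_cong2[where f = "(/)"] nn_integral_cong refl) (auto split: split_indicator)
      also have "\<dots> = avg (closed_cell j y) (\<lambda>z. \<sigma> z * indicator C z)"
        by (simp only: avg_def nn_integral_closed_cell emeasure_closed_cell)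
      also have "\<dots> \<le> maximal (\<lambda>z. \<sigma> z * indicator C z) y"
        using cell_subset_closed_cell[of j y] by (intro avg_le_maximal) auto
      finally show ?thesis .
    qed
    then have "(\<integral>\<^sup>+y\<in>cell k x. (SUP j\<in>{k..N}. cell_avg u j y) \<partial>lebesgue)
        \<le> (\<integral>\<^sup>+y\<in>cell k x. maximal (\<lambda>z. \<sigma> z * indicator C z) y \<partial>lebesgue)"
      by (intro nn_integral_mono) (auto intro!: SUP_least split: split_indicator)
    also have "\<dots> = (\<integral>\<^sup>+y\<in>C. maximal (\<lambda>z. \<sigma> z * indicator C z) y \<partial>lebesgue)"
      unfolding C_def by (rule nn_integral_closed_cell[symmetric])
    also have "\<dots> \<le> ennreal T * (\<integral>\<^sup>+y\<in>C. u y \<partial>lebesgue)"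
      using A_infty_const_bound[OF assms(1) pos fin C] by (simp add: T u_def)
    also have "(\<integral>\<^sup>+y\<in>C. u y \<partial>lebesgue) = (\<integral>\<^sup>+y\<in>cell k x. u y \<partial>lebesgue)"
      unfolding C_def by (rule nn_integral_closed_cell)
    finally show ?thesis .
  qed
  have U: "(\<integral>\<^sup>+x\<in>cell 0 a. u x \<partial>lebesgue) \<noteq> 0" "(\<integral>\<^sup>+x\<in>cell 0 a. u x \<partial>lebesgue) \<noteq> top"
    unfolding cell_Q using nn_integral_cube_neq_0[OF assms(1) pos Q] fin[OF Q] by (auto simp: u_def)
  have "(\<integral>\<^sup>+x\<in>cell 0 a. ennreal \<bar>\<sigma> x\<bar> epowr (1 + d) \<partial>lebesgue)
      \<le> 2 * cell_avg u 0 a epowr d * (\<integral>\<^sup>+x\<in>cell 0 a. u x \<partial>lebesgue)"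
  proof (rule nn_integral_epowr_le_of_cell_avg[OF d0])
    show "(\<integral>\<^sup>+x\<in>cell 0 a. cell_avg (\<lambda>x. ennreal \<bar>\<sigma> x\<bar>) N x epowr (1 + d) \<partial>lebesgue)
      \<le> 2 * cell_avg u 0 a epowr d * (\<integral>\<^sup>+x\<in>cell 0 a. u x \<partial>lebesgue)" for N
      using nn_integral_epowr_avg_le[OF _ T(2) d U local_max] by (simp add: u_def[abs_def])
  qed auto
  also have "(\<integral>\<^sup>+x\<in>cell 0 a. u x \<partial>lebesgue) = cell_avg u 0 a * emeasure lebesgue (cell 0 a)"
    by (rule nn_integral_cell_eq_avg)
  also have "2 * cell_avg u 0 a epowr d * (cell_avg u 0 a * emeasure lebesgue (cell 0 a))
      = 2 * emeasure lebesgue (cell 0 a) * cell_avg u 0 a epowr (1 + d)"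
    using epowr_add[of "cell_avg u 0 a" 1 d, symmetric] by (simp only: epowr_one mult_ac)
  finally show ?thesis
    unfolding cell_Q avg by (simp add: Qc emeasure_closed_cell)
qed


section \<open>The distribution function of the maximal function\<close>

lemma avg_add_le:
  assumes [measurable]: "f \<in> borel_measurable lebesgue" "g \<in> borel_measurable lebesgue"
    and le: "\<And>x. \<bar>f x\<bar> \<le> \<bar>g x\<bar> + s" and s: "0 \<le> s" and Q: "Q \<in> cubes"
  shows "avg Q f \<le> avg Q g + ennreal s"
proof -
  note [measurable] = emeasure_cubes(3)[OF Q]
  have "(\<integral>\<^sup>+x\<in>Q. ennreal \<bar>f x\<bar> \<partial>lebesgue)
      \<le> (\<integral>\<^sup>+x. ennreal \<bar>g x\<bar> * indicator Q x + ennreal s * indicator Q x \<partial>lebesgue)"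
    using le s by (intro nn_integral_mono) (auto split: split_indicator simp flip: ennreal_plus intro!: ennreal_leI)
  also have "\<dots> = (\<integral>\<^sup>+x\<in>Q. ennreal \<bar>g x\<bar> \<partial>lebesgue) + ennreal s * emeasure lebesgue Q"
    by (simp add: nn_integral_add nn_integral_cmult_indicator)
  finally have "avg Q f \<le> ((\<integral>\<^sup>+x\<in>Q. ennreal \<bar>g x\<bar> \<partial>lebesgue) + ennreal s * emeasure lebesgue Q) / emeasure lebesgue Q"
    unfolding avg_def by (rule divide_right_mono_ennreal)
  also have "\<dots> = avg Q g + ennreal s"
    using emeasure_cubes[OF Q] by (simp add: avg_def add_divide_distrib_ennreal ennreal_mult_divide_eq)
  finally show ?thesis .
qed

lemma powr_le_dyadic_sum:
  fixes s y P :: real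
  assumes s: "0 < s" "s < y" and P: "0 \<le> P"
  shows "ennreal (y powr P) \<le> (\<Sum>k. ennreal ((2 * (2 ^ k * s)) powr P) * indicator {..<y} (2 ^ k * s))"
proof -
  obtain m where m: "\<And>j. 2 ^ j * s < y \<longleftrightarrow> j \<le> m" "y \<le> 2 ^ Suc m * s"
    using ex_dyadic_level s by blast
  let ?a = "\<lambda>k. ennreal ((2 * (2 ^ k * s)) powr P) * indicator {..<y} (2 ^ k * s)"
  have "ennreal (y powr P) \<le> ?a m"
    using m(1)[of m] m(2) s P by (auto intro!: ennreal_leI powr_mono2 simp: mult.assoc)
  also have "?a m = (\<Sum>k\<in>{m}. ?a k)"
    by (simp only: sum.insert finite.emptyI empty_iff not_False_eq_True sum.empty add_0_right)
  also have "\<dots> \<le> (\<Sum>k. ?a k)" by (intro sum_le_suminf) auto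
  finally show ?thesis .
qed

text \<open>
  Truncating \<open>f\<close> at height \<open>s\<close> changes its averages by at most \<open>s\<close>. The weak type bound then applies to the
  part of \<open>f\<close> above \<open>s\<close>, which is split into dyadic layers.
\<close>

lemma maximal_distribution_le:
  fixes f \<tau> w :: "real ^ 'n \<Rightarrow> real"
  assumes sets: "sets \<nu> = sets lebesgue" and s: "0 < s" and P: "1 < P"
    and [measurable]: "f \<in> borel_measurable lebesgue" "\<tau> \<in> borel_measurable lebesgue"
      "w \<in> borel_measurable lebesgue"
    and pos: "AE x in lebesgue. 0 < \<tau> x" and w: "AE x in lebesgue. w x = \<tau> x powr (1 - P)"
    and cube: "\<And>Q. Q \<in> cubes \<Longrightarrow>
      emeasure \<nu> Q * (\<integral>\<^sup>+x\<in>Q. ennreal (\<tau> x) \<partial>lebesgue) epowr (P - 1) \<le> A * emeasure lebesgue Q epowr P"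
  shows "emeasure \<nu> {x. ennreal (2 * s) < maximal f x} \<le> A * ennreal (2 * 3 ^ CARD('n)) epowr P *
    (\<Sum>k. ennreal ((2 ^ k) powr P) * emeasure (weighted w) {x. ennreal (2 ^ k * s) < ennreal \<bar>f x\<bar>})"
proof -
  define g where "g x = f x * indicator {x. s < \<bar>f x\<bar>} x" for x
  define E where "E k = {x. ennreal (2 ^ k * s) < ennreal \<bar>f x\<bar>}" for k :: nat
  have [measurable]: "g \<in> borel_measurable lebesgue" unfolding g_def by measurable
  have E[measurable]: "E k \<in> sets lebesgue" for k
  proof -
    have "{x \<in> space lebesgue. ennreal (2 ^ k * s) < ennreal \<bar>f x\<bar>} \<in> sets lebesgue" by measurable
    then show ?thesis by (simp add: E_def)
  qed
  have "{x. ennreal (2 * s) < maximal f x} \<subseteq> {x. ennreal s < maximal g x}"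
  proof
    fix x assume "x \<in> {x. ennreal (2 * s) < maximal f x}"
    then obtain Q where Q: "Q \<in> cubes" "x \<in> Q" "ennreal (2 * s) < avg Q f"
      by (auto simp: maximal_def less_SUP_iff)
    have "avg Q f \<le> avg Q g + ennreal s"
      using s Q by (intro avg_add_le) (auto simp: g_def split: split_indicator)
    also have "\<dots> \<le> maximal g x + ennreal s"
      using Q by (intro add_right_mono avg_le_maximal)
    finally have "ennreal s + ennreal s < maximal g x + ennreal s"
      using Q(3) s by (simp flip: ennreal_plus)
    then show "x \<in> {x. ennreal s < maximal g x}"
      by (metis (mono_tags) add_right_mono leD leI mem_Collect_eq)
  qed
  then have "emeasure \<nu> {x. ennreal (2 * s) < maximal f x} \<le> emeasure \<nu> {x. ennreal s < maximal g x}"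
    using s by (intro emeasure_mono) (auto simp: sets sets_maximal_level)
  then have "emeasure \<nu> {x. ennreal (2 * s) < maximal f x} * ennreal s epowr P
      \<le> emeasure \<nu> {x. ennreal s < maximal g x} * ennreal s epowr P"
    by (rule mult_right_mono) simp
  also have "\<dots> \<le> A * ennreal (3 ^ CARD('n)) epowr P *
      (\<integral>\<^sup>+x. ennreal (\<bar>g x\<bar> powr P * \<tau> x powr (1 - P)) \<partial>lebesgue)"
    using s P by (intro weak_type_two_weight sets pos cube) auto
  also have "\<dots> \<le> A * ennreal (3 ^ CARD('n)) epowr P *
      (\<integral>\<^sup>+x. (\<Sum>k. ennreal ((2 * (2 ^ k * s)) powr P) * (ennreal (w x) * indicator (E k) x)) \<partial>lebesgue)"
  proof (intro mult_left_mono nn_integral_mono_AE)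
    show "AE x in lebesgue. ennreal (\<bar>g x\<bar> powr P * \<tau> x powr (1 - P))
      \<le> (\<Sum>k. ennreal ((2 * (2 ^ k * s)) powr P) * (ennreal (w x) * indicator (E k) x))"
      using w
    proof eventually_elim
      case (elim x)
      show ?case
      proof (cases "s < \<bar>f x\<bar>")
        case True
        have "ennreal (\<bar>g x\<bar> powr P * \<tau> x powr (1 - P)) = ennreal (\<bar>f x\<bar> powr P) * ennreal (w x)"
          using True elim by (simp add: g_def ennreal_mult)
        also have "\<dots> \<le> (\<Sum>k. ennreal ((2 * (2 ^ k * s)) powr P) * indicator {..<\<bar>f x\<bar>} (2 ^ k * s)) * ennreal (w x)"
          using s P True by (intro mult_right_mono powr_le_dyadic_sum) auto
        also have "\<dots> = (\<Sum>k. ennreal ((2 * (2 ^ k * s)) powr P) * indicator {..<\<bar>f x\<bar>} (2 ^ k * s) * ennreal (w x))"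
          by (rule ennreal_suminf_multc[symmetric])
        also have "\<dots> = (\<Sum>k. ennreal ((2 * (2 ^ k * s)) powr P) * (ennreal (w x) * indicator (E k) x))"
          using s by (intro arg_cong[where f = suminf] ext)
            (simp add: E_def ennreal_less_iff split: split_indicator)
        finally show ?thesis .
      qed (simp add: g_def)
    qed
  qed simp
  also have "\<dots> = A * ennreal (3 ^ CARD('n)) epowr P *
      (\<Sum>k. ennreal ((2 * (2 ^ k * s)) powr P) * emeasure (weighted w) (E k))"
    by (simp add: nn_integral_suminf nn_integral_cmult weighted_def emeasure_density)
  also have "(\<Sum>k. ennreal ((2 * (2 ^ k * s)) powr P) * emeasure (weighted w) (E k))
      = (\<Sum>k. ennreal s epowr P * ennreal 2 epowr P * (ennreal ((2 ^ k) powr P) * emeasure (weighted w) (E k)))"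
    using s unfolding epowr_ennreal[of 2 P, simplified] epowr_ennreal[OF less_imp_le[OF s]]
    by (intro arg_cong[where f = suminf] ext) (simp add: powr_mult ennreal_mult mult_ac epowr_def)
  also have "\<dots> = ennreal s epowr P * ennreal 2 epowr P *
      (\<Sum>k. ennreal ((2 ^ k) powr P) * emeasure (weighted w) (E k))"
    by (rule ennreal_suminf_cmult)
  finally have "ennreal s epowr P * emeasure \<nu> {x. ennreal (2 * s) < maximal f x} \<le> ennreal s epowr P *
      (A * (ennreal 2 epowr P * ennreal (3 ^ CARD('n)) epowr P) *
        (\<Sum>k. ennreal ((2 ^ k) powr P) * emeasure (weighted w) (E k)))"
    by (simp only: mult_ac)
  then have "emeasure \<nu> {x. ennreal (2 * s) < maximal f x} \<le>
      A * (ennreal 2 epowr P * ennreal (3 ^ CARD('n)) epowr P) *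
        (\<Sum>k. ennreal ((2 ^ k) powr P) * emeasure (weighted w) (E k))"
    using s by (subst (asm) ennreal_mult_le_mult_iff) auto
  then show ?thesis by (simp add: E_def ennreal_mult flip: epowr_mult)
qed

section \<open>Summation over dyadic levels\<close>

lemma suminf_epowr_le_Jensen:
  fixes x \<gamma> :: "nat \<Rightarrow> ennreal"
  assumes "1 < r"
  shows "(\<Sum>k. \<gamma> k * x k) epowr r \<le> (\<Sum>k. \<gamma> k) epowr (r - 1) * (\<Sum>k. \<gamma> k * x k epowr r)"
proof -
  let ?M = "density (count_space UNIV) \<gamma>"
  have "(\<integral>\<^sup>+k. h k \<partial>?M) = (\<Sum>k. \<gamma> k * h k)" for h
    by (simp add: nn_integral_density nn_integral_count_space_nat)
  moreover have "emeasure ?M (space ?M) = (\<Sum>k. \<gamma> k)"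
    by (simp add: emeasure_density nn_integral_count_space_nat)
  ultimately show ?thesis
    using nn_integral_epowr_le[OF assms, of x ?M] by (simp add: mult.commute)
qed

text \<open>
  By homogeneity: each term is at most \<open>x\<^sub>k\<^sup>r S\<^bsup>1 / r - 1\<^esup>\<close> with \<open>S\<close> the sum on the right, because \<open>x\<^sub>k\<^sup>r \<le> S\<close>.
\<close>

lemma suminf_epowr_le:
  fixes x :: "nat \<Rightarrow> ennreal"
  assumes r: "0 < r" "r \<le> 1"
  shows "(\<Sum>k. x k) epowr r \<le> (\<Sum>k. x k epowr r)"
proof -
  let ?S = "\<Sum>k. x k epowr r"
  consider "?S = 0" | "?S = top" | "?S \<noteq> 0" "?S \<noteq> top" by blast
  then show ?thesis
  proof cases
    case 1
    then have "x k = 0" for k by (simp add: suminf_eq_zero_iff)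
    then show ?thesis by simp
  next
    case 3
    have le: "x k \<le> x k epowr r * ?S epowr (1 / r - 1)" for k
    proof -
      have "x k epowr r \<le> ?S" using sum_le_suminf[of "\<lambda>k. x k epowr r" "{k}"] by simp
      then have "x k epowr r * (x k epowr r) epowr (1 / r - 1) \<le> x k epowr r * ?S epowr (1 / r - 1)"
        using r by (intro mult_left_mono epowr_mono) (auto simp: field_simps)
      also have "x k epowr r * (x k epowr r) epowr (1 / r - 1) = x k"
        using r epowr_add[of "x k epowr r" 1 "1 / r - 1"] by (simp add: epowr_epowr)
      finally show ?thesis .
    qed
    have "(\<Sum>k. x k) \<le> (\<Sum>k. x k epowr r * ?S epowr (1 / r - 1))"
      by (intro suminf_le le) auto
    also have "\<dots> = ?S epowr (1 / r)"
      using epowr_add[of ?S 1 "1 / r - 1"] by simp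
    finally have "(\<Sum>k. x k) epowr r \<le> (?S epowr (1 / r)) epowr r"
      using r by (intro epowr_mono) auto
    then show ?thesis using r by (simp add: epowr_epowr)
  qed simp
qed

text \<open>
  The measure \<open>ds / s\<close> on the half-line is invariant under dilations.
\<close>

lemma nn_integral_dilation:
  fixes h :: "real \<Rightarrow> ennreal"
  assumes [measurable]: "h \<in> borel_measurable borel" and c: "0 < c"
  shows "(\<integral>\<^sup>+s\<in>{0<..}. h (c * s) / ennreal s \<partial>lborel) = (\<integral>\<^sup>+s\<in>{0<..}. h s / ennreal s \<partial>lborel)"
proof -
  have "(\<integral>\<^sup>+s\<in>{0<..}. h s / ennreal s \<partial>lborel)
      = ennreal \<bar>c\<bar> * (\<integral>\<^sup>+s. h (0 + c * s) / ennreal (0 + c * s) * indicator {0<..} (0 + c * s) \<partial>lborel)"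
    using c by (intro nn_integral_real_affine) auto
  also have "\<dots> = (\<integral>\<^sup>+s. ennreal c * (h (c * s) / ennreal (c * s) * indicator {0<..} (c * s)) \<partial>lborel)"
    using c by (subst nn_integral_cmult) auto
  also have "\<dots> = (\<integral>\<^sup>+s\<in>{0<..}. h (c * s) / ennreal s \<partial>lborel)"
  proof (rule nn_integral_cong)
    fix s
    show "ennreal c * (h (c * s) / ennreal (c * s) * indicator {0<..} (c * s))
        = h (c * s) / ennreal s * indicator {0<..} s"
    proof (cases "0 < s")
      case True
      have "ennreal c * inverse (ennreal (c * s)) = inverse (ennreal s)"
        using True c by (simp add: inverse_ennreal flip: ennreal_mult)
      then show ?thesis using True c
        by (simp add: divide_ennreal_def) (metis mult.left_commute)
    qed (use c in \<open>auto simp: zero_less_mult_iff\<close>)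
  qed
  finally show ?thesis by simp
qed

lemma borel_measurable_antimono_ennreal:
  fixes F :: "real \<Rightarrow> ennreal"
  assumes F: "\<And>s t. s \<le> t \<Longrightarrow> F t \<le> F s"
  shows "F \<in> borel_measurable borel"
proof (rule borel_measurableI_greater)
  fix y
  have "is_interval {s. y < F s}"
    unfolding is_interval_1 using F by (auto intro: less_le_trans)
  then show "{s \<in> space borel. y < F s} \<in> sets borel"
    by (simp add: real_interval_borel_measurable)
qed

lemma suminf_geometric_le:
  assumes e: "0 < e"
  shows "(\<Sum>k. ennreal (2 powr (- (real k * e)))) \<le> ennreal (1 + 2 / e)"
proof -
  define x where "x = 2 powr (- e)"
  have x: "0 < x" "x < 1" using e powr_less_cancel_iff[of 2 "- e" 0] by (auto simp: x_def)
  have "2 powr (- (real k * e)) = x ^ k" for k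
    by (simp add: x_def powr_power mult.commute)
  then have "(\<Sum>k. ennreal (2 powr (- (real k * e)))) = (\<Sum>k. ennreal (x ^ k))" by simp
  also have "\<dots> = ennreal (1 / (1 - x))"
    using x by (subst suminf_ennreal2) (auto simp: suminf_geometric)
  also have "\<dots> \<le> ennreal (1 + 2 / e)"
  proof (rule ennreal_leI)
    have "1 + e / 2 \<le> 1 + e * ln 2" using e ln2_ge_two_thirds by simp
    also have "\<dots> \<le> exp (e * ln 2)" by simp
    also have "\<dots> = 2 powr e" by (simp add: powr_def)
    finally have "(2 + e) * x \<le> 2 * (2 powr e * x)" using x by simp
    also have "2 powr e * x = 1" by (simp add: x_def powr_minus)
    finally show "1 / (1 - x) \<le> 1 + 2 / e" using x e by (simp add: field_simps)
  qed
  finally show ?thesis .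
qed


text \<open>
  The hypothesis on \<open>\<gamma>\<close> and \<open>c\<close> abstracts from how the power \<open>r\<close> of the sum is estimated, by convexity
  or by subadditivity; after that, every summand has the same integral by dilation invariance.
\<close>

lemma nn_integral_dyadic_sum_le:
  fixes N \<mu> :: "real \<Rightarrow> ennreal" and \<gamma> c :: "nat \<Rightarrow> ennreal"
  assumes [measurable]: "N \<in> borel_measurable borel" "\<mu> \<in> borel_measurable borel" and r: "0 < r"
    and N: "\<And>s. 0 < s \<Longrightarrow> N (2 * s) \<le> D * (\<Sum>k. \<gamma> k * \<mu> (2 ^ k * s))"
    and conv: "\<And>x. (\<Sum>k. \<gamma> k * x k) epowr r \<le> (\<Sum>k. c k * x k epowr r)"
  shows "(\<integral>\<^sup>+s\<in>{0<..}. N s epowr r / ennreal s \<partial>lborel)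
    \<le> D epowr r * (\<Sum>k. c k) * (\<integral>\<^sup>+s\<in>{0<..}. \<mu> s epowr r / ennreal s \<partial>lborel)"
proof -
  let ?J = "\<integral>\<^sup>+s\<in>{0<..}. \<mu> s epowr r / ennreal s \<partial>lborel"
  have "(\<integral>\<^sup>+s\<in>{0<..}. N s epowr r / ennreal s \<partial>lborel)
      = (\<integral>\<^sup>+s\<in>{0<..}. N (2 * s) epowr r / ennreal s \<partial>lborel)"
    using nn_integral_dilation[of "\<lambda>s. N s epowr r" 2] by simp
  also have "\<dots> \<le> (\<integral>\<^sup>+s. D epowr r *
      (\<Sum>k. c k * (\<mu> (2 ^ k * s) epowr r / ennreal s * indicator {0<..} s)) \<partial>lborel)"
  proof (rule nn_integral_mono)
    fix s :: real
    show "N (2 * s) epowr r / ennreal s * indicator {0<..} s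
      \<le> D epowr r * (\<Sum>k. c k * (\<mu> (2 ^ k * s) epowr r / ennreal s * indicator {0<..} s))"
    proof (cases "0 < s")
      case True
      have "N (2 * s) epowr r \<le> (D * (\<Sum>k. \<gamma> k * \<mu> (2 ^ k * s))) epowr r"
        using N[OF True] r by (intro epowr_mono) auto
      also have "\<dots> \<le> D epowr r * (\<Sum>k. c k * \<mu> (2 ^ k * s) epowr r)"
        unfolding epowr_mult by (intro mult_left_mono conv) simp
      finally have "N (2 * s) epowr r / ennreal s \<le> D epowr r * (\<Sum>k. c k * \<mu> (2 ^ k * s) epowr r) / ennreal s"
        by (rule divide_right_mono_ennreal)
      also have "\<dots> = D epowr r * (\<Sum>k. c k * (\<mu> (2 ^ k * s) epowr r / ennreal s))"
        by (simp only: ennreal_times_divide[symmetric] ennreal_suminf_divide[symmetric])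
      finally show ?thesis using True by simp
    qed simp
  qed
  also have "\<dots> = D epowr r * (\<Sum>k. c k * (\<integral>\<^sup>+s\<in>{0<..}. \<mu> (2 ^ k * s) epowr r / ennreal s \<partial>lborel))"
    by (simp add: nn_integral_cmult nn_integral_suminf)
  also have "\<dots> = D epowr r * (\<Sum>k. c k * ?J)"
    using nn_integral_dilation[of "\<lambda>s. \<mu> s epowr r" "2 ^ k" for k] by simp
  also have "\<dots> = D epowr r * (\<Sum>k. c k) * ?J"
    by (simp add: mult.assoc)
  finally show ?thesis .
qed

section \<open>Lorentz quasinorms\<close>

lemma lorentz_norm_real:
  assumes p: "0 < p" and q: "0 < q"
  shows "lorentz_norm p (ennreal q) w g = (ennreal p * (\<integral>\<^sup>+s\<in>{0<..}.
    (ennreal (s powr p) * emeasure (weighted w) {x. ennreal s < g x}) epowr (q / p) / ennreal s \<partial>lborel))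
      epowr (1 / q)"
proof -
  have "(\<integral>\<^sup>+s\<in>{0<..}. ennreal (s powr q) * emeasure (weighted w) {x. ennreal s < g x} epowr (q / p)
      / ennreal s \<partial>lborel) = (\<integral>\<^sup>+s\<in>{0<..}.
    (ennreal (s powr p) * emeasure (weighted w) {x. ennreal s < g x}) epowr (q / p) / ennreal s \<partial>lborel)"
    using p by (intro nn_integral_cong) (simp add: epowr_mult epowr_ennreal powr_powr split: split_indicator)
  then show ?thesis using q by (simp add: lorentz_norm_def)
qed

lemma borel_measurable_distribution:
  assumes "\<And>s. 0 \<le> s \<Longrightarrow> {x. ennreal s < g x} \<in> sets \<nu>"
  shows "(\<lambda>s. emeasure \<nu> {x. ennreal s < g x}) \<in> borel_measurable borel"
proof (rule borel_measurable_antimono_ennreal)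
  fix s t :: real assume "s \<le> t"
  then have "{x. ennreal t < g x} \<subseteq> {x. ennreal s < g x}"
    using ennreal_leI[of s t] by (auto intro: le_less_trans)
  moreover have "{x. ennreal s < g x} \<in> sets \<nu>"
    using assms[of s] assms[of 0] by (cases "0 \<le> s") (simp_all add: ennreal_neg)
  ultimately show "emeasure \<nu> {x. ennreal t < g x} \<le> emeasure \<nu> {x. ennreal s < g x}"
    by (rule emeasure_mono)
qed

text \<open>
  Everything that the Lorentz estimates need to know about the maximal operator is the inequality between the two
  distribution functions. The exponent \<open>P < p\<close> makes the dyadic sum converge geometrically.
\<close>

locale dyadic_distribution_bound =
  fixes p P :: real and D :: ennreal and v w :: "real ^ 'n \<Rightarrow> real" and f :: "real ^ 'n \<Rightarrow> real"
  assumes P: "0 < P" "P < p"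
    and f[measurable]: "f \<in> borel_measurable lebesgue"
    and bound: "\<And>s. 0 < s \<Longrightarrow> emeasure (weighted v) {x. ennreal (2 * s) < maximal f x} \<le> D *
      (\<Sum>k. ennreal ((2 ^ k) powr P) * emeasure (weighted w) {x. ennreal (2 ^ k * s) < ennreal \<bar>f x\<bar>})"
begin

text \<open>
  With the factor \<open>s\<^sup>p\<close> the distribution functions become the quantities whose power \<open>q / p\<close> is integrated against \<open>ds / s\<close>
  in a Lorentz quasinorm, and the weights \<open>2\<^bsup>k P\<^esup>\<close> turn into the summable weights \<open>\<gamma>\<close>.
\<close>

definition N :: "real \<Rightarrow> ennreal"
  where "N s = ennreal (s powr p) * emeasure (weighted v) {x. ennreal s < maximal f x}"

definition \<mu> :: "real \<Rightarrow> ennreal"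
  where "\<mu> s = ennreal (s powr p) * emeasure (weighted w) {x. ennreal s < ennreal \<bar>f x\<bar>}"

definition \<gamma> :: "nat \<Rightarrow> ennreal"
  where "\<gamma> k = ennreal (2 powr (- (real k * (p - P))))"

lemma p_pos: "0 < p"
  using P by simp

lemma measurable_N: "N \<in> borel_measurable borel"
proof -
  have [measurable]: "(\<lambda>s. emeasure (weighted v) {x. ennreal s < maximal f x}) \<in> borel_measurable borel"
    by (rule borel_measurable_distribution) (simp add: weighted_def sets_maximal_level)
  show ?thesis unfolding N_def[abs_def] by measurable
qed

lemma measurable_\<mu>: "\<mu> \<in> borel_measurable borel"
proof -
  have "{x \<in> space lebesgue. ennreal s < ennreal \<bar>f x\<bar>} \<in> sets lebesgue" for s by measurable
  then have [measurable]: "(\<lambda>s. emeasure (weighted w) {x. ennreal s < ennreal \<bar>f x\<bar>}) \<in> borel_measurable borel"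
    by (intro borel_measurable_distribution) (simp add: weighted_def)
  show ?thesis unfolding \<mu>_def[abs_def] by measurable
qed

lemma N_le:
  assumes s: "0 < s"
  shows "N (2 * s) \<le> ennreal (2 powr p) * D * (\<Sum>k. \<gamma> k * \<mu> (2 ^ k * s))"
proof -
  let ?l = "\<lambda>k. emeasure (weighted w) {x. ennreal (2 ^ k * s) < ennreal \<bar>f x\<bar>}"
  have "N (2 * s) \<le> ennreal ((2 * s) powr p) * (D * (\<Sum>k. ennreal ((2 ^ k) powr P) * ?l k))"
    unfolding N_def by (intro mult_left_mono bound s) simp
  also have "\<dots> = ennreal (2 powr p) * D * (ennreal (s powr p) * (\<Sum>k. ennreal ((2 ^ k) powr P) * ?l k))"
    using s by (simp add: powr_mult ennreal_mult mult_ac)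
  also have "ennreal (s powr p) * (\<Sum>k. ennreal ((2 ^ k) powr P) * ?l k)
      = (\<Sum>k. ennreal (s powr p) * (ennreal ((2 ^ k) powr P) * ?l k))"
    by (rule ennreal_suminf_cmult[symmetric])
  also have "\<dots> = (\<Sum>k. \<gamma> k * \<mu> (2 ^ k * s))"
  proof (intro arg_cong[where f = suminf] ext)
    fix k
    have "2 powr (- (real k * (p - P))) * 2 powr (real k * p) = 2 powr (real k * P)"
      by (simp add: algebra_simps flip: powr_add)
    also have "\<dots> = (2 ^ k) powr P" using dyadic_powr[of 1 k P] by simp
    finally have eq: "2 powr (- (real k * (p - P))) * 2 powr (real k * p) = (2 ^ k) powr P" .
    have "s powr p * (2 ^ k) powr P = 2 powr (- (real k * (p - P))) * (2 ^ k * s) powr p"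
      unfolding dyadic_powr[OF s] eq[symmetric] by (rule mult.left_commute)
    then have "ennreal (s powr p) * ennreal ((2 ^ k) powr P) = \<gamma> k * ennreal ((2 ^ k * s) powr p)"
      by (simp add: \<gamma>_def flip: ennreal_mult)
    then show "ennreal (s powr p) * (ennreal ((2 ^ k) powr P) * ?l k) = \<gamma> k * \<mu> (2 ^ k * s)"
      by (simp add: \<mu>_def flip: mult.assoc)
  qed
  finally show ?thesis .
qed

lemma lorentz_norm_maximal_le_aux:
  assumes q: "0 < q" and conv: "\<And>x. (\<Sum>k. \<gamma> k * x k) epowr (q / p) \<le> (\<Sum>k. c k * x k epowr (q / p))"
  shows "lorentz_norm p (ennreal q) v (maximal f)
    \<le> (ennreal (2 powr p) * D) epowr (1 / p) * (\<Sum>k. c k) epowr (1 / q)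
      * lorentz_norm p (ennreal q) w (\<lambda>x. ennreal \<bar>f x\<bar>)"
proof -
  let ?D = "ennreal (2 powr p) * D"
  let ?J = "\<integral>\<^sup>+s\<in>{0<..}. \<mu> s epowr (q / p) / ennreal s \<partial>lborel"
  have "lorentz_norm p (ennreal q) v (maximal f)
      = (ennreal p * (\<integral>\<^sup>+s\<in>{0<..}. N s epowr (q / p) / ennreal s \<partial>lborel)) epowr (1 / q)"
    unfolding N_def by (rule lorentz_norm_real[OF p_pos q])
  also have "\<dots> \<le> (ennreal p * (?D epowr (q / p) * (\<Sum>k. c k) * ?J)) epowr (1 / q)"
    using q p_pos
    by (intro epowr_mono mult_left_mono nn_integral_dyadic_sum_le[where \<gamma> = \<gamma>] measurable_N measurable_\<mu> N_le conv) auto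
  also have "\<dots> = ?D epowr (1 / p) * (\<Sum>k. c k) epowr (1 / q) * (ennreal p * ?J) epowr (1 / q)"
    using q by (simp add: epowr_mult epowr_epowr mult_ac)
  also have "(ennreal p * ?J) epowr (1 / q) = lorentz_norm p (ennreal q) w (\<lambda>x. ennreal \<bar>f x\<bar>)"
    unfolding \<mu>_def by (rule lorentz_norm_real[OF p_pos q, symmetric])
  finally show ?thesis .
qed

text \<open>
  For exponents \<open>q \<le> p\<close> the power \<open>q / p\<close> is subadditive, and the ratio of the geometric weights changes with it.
\<close>

lemma lorentz_norm_maximal_le_small:
  assumes q: "0 < q" "q \<le> p"
  shows "lorentz_norm p (ennreal q) v (maximal f)
    \<le> (ennreal (2 powr p) * D) epowr (1 / p) * ennreal (1 + 2 * p / ((p - P) * q)) epowr (1 / q)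
      * lorentz_norm p (ennreal q) w (\<lambda>x. ennreal \<bar>f x\<bar>)"
proof -
  let ?e = "(p - P) * (q / p)"
  have e: "0 < ?e" using P q by simp
  have r: "0 < q / p" "q / p \<le> 1" using q by auto
  have "lorentz_norm p (ennreal q) v (maximal f)
    \<le> (ennreal (2 powr p) * D) epowr (1 / p) * (\<Sum>k. \<gamma> k epowr (q / p)) epowr (1 / q)
      * lorentz_norm p (ennreal q) w (\<lambda>x. ennreal \<bar>f x\<bar>)"
    using suminf_epowr_le[OF r, of "\<lambda>k. \<gamma> k * x k" for x]
    by (intro lorentz_norm_maximal_le_aux q) (simp add: epowr_mult)
  moreover have "(\<Sum>k. \<gamma> k epowr (q / p)) \<le> ennreal (1 + 2 * p / ((p - P) * q))"
  proof -
    have "(\<Sum>k. \<gamma> k epowr (q / p)) = (\<Sum>k. ennreal (2 powr (- (real k * ?e))))"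
      by (simp add: \<gamma>_def epowr_ennreal powr_powr mult.assoc)
    also have "\<dots> \<le> ennreal (1 + 2 / ?e)" by (rule suminf_geometric_le[OF e])
    also have "2 / ?e = 2 * p / ((p - P) * q)" using q p_pos by simp
    finally show ?thesis .
  qed
  ultimately show ?thesis
    using q by (meson epowr_mono less_imp_le mult_left_mono mult_right_mono order_trans zero_le divide_nonneg_pos zero_le_one)
qed

lemma suminf_\<gamma>_le: "(\<Sum>k. \<gamma> k) \<le> ennreal (1 + 2 / (p - P))"
  unfolding \<gamma>_def using P by (intro suminf_geometric_le) simp

text \<open>
  For \<open>q \<ge> p\<close> the power \<open>q / p\<close> is convex, so the sum of the weights enters with the power \<open>1 / p\<close>, whatever \<open>q\<close> is.
  The same bound holds for \<open>q = \<infinity>\<close> by taking suprema.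
\<close>

lemma lorentz_norm_maximal_le_large:
  assumes q: "ennreal p \<le> q"
  shows "lorentz_norm p q v (maximal f)
    \<le> (ennreal (2 powr p) * D * ennreal (1 + 2 / (p - P))) epowr (1 / p)
      * lorentz_norm p q w (\<lambda>x. ennreal \<bar>f x\<bar>)"
proof -
  let ?D = "ennreal (2 powr p) * D" and ?\<Gamma> = "\<Sum>k. \<gamma> k"
  have "lorentz_norm p q v (maximal f)
    \<le> (?D * ?\<Gamma>) epowr (1 / p) * lorentz_norm p q w (\<lambda>x. ennreal \<bar>f x\<bar>)"
  proof (cases "q = \<infinity>")
    case False
    then obtain q' where q': "q = ennreal q'" "0 \<le> q'" by (cases q) auto
    then have pq: "p \<le> q'" "0 < q'" using q p_pos by auto
    let ?r = "q' / p"
    have conv: "(\<Sum>k. \<gamma> k * x k) epowr ?r \<le> (\<Sum>k. ?\<Gamma> epowr (?r - 1) * \<gamma> k * x k epowr ?r)" for x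
    proof (cases "?r = 1")
      case True
      have "?\<Gamma> \<noteq> 0" by (simp add: suminf_eq_zero_iff \<gamma>_def)
      moreover have "?\<Gamma> \<noteq> top" using suminf_\<gamma>_le by (auto simp: top_unique)
      ultimately have "?\<Gamma> epowr 0 = 1" by (cases ?\<Gamma>) (auto simp: epowr_ennreal)
      then show ?thesis using True by simp
    next
      case False
      then have "1 < ?r" using pq p_pos by (simp add: less_divide_eq)
      then show ?thesis using suminf_epowr_le_Jensen[of ?r \<gamma> x] by (simp add: mult.assoc)
    qed
    have "lorentz_norm p (ennreal q') v (maximal f)
        \<le> ?D epowr (1 / p) * (\<Sum>k. ?\<Gamma> epowr (?r - 1) * \<gamma> k) epowr (1 / q')
        * lorentz_norm p (ennreal q') w (\<lambda>x. ennreal \<bar>f x\<bar>)"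
      by (rule lorentz_norm_maximal_le_aux[OF pq(2) conv])
    also have "(\<Sum>k. ?\<Gamma> epowr (?r - 1) * \<gamma> k) epowr (1 / q') = ?\<Gamma> epowr (1 / p)"
      using pq p_pos by (simp add: epowr_mult_self epowr_epowr)
    finally show ?thesis unfolding q' by (simp add: epowr_mult)
  next
    case True
    let ?B = "lorentz_norm p \<infinity> w (\<lambda>x. ennreal \<bar>f x\<bar>)"
    have root: "ennreal (s powr p * 1) epowr (1 / p) = ennreal s" if "0 < s" for s
      using that p_pos by (simp add: epowr_ennreal powr_powr)
    have \<mu>_le: "\<mu> s \<le> ?B epowr p" if s: "0 < s" for s
    proof -
      have "\<mu> s epowr (1 / p) = ennreal s * emeasure (weighted w) {x. ennreal s < ennreal \<bar>f x\<bar>} epowr (1 / p)"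
        using root[OF s] by (simp add: \<mu>_def epowr_mult)
      also have "\<dots> \<le> ?B" unfolding lorentz_norm_def using s by (auto intro: SUP_upper2)
      finally have "(\<mu> s epowr (1 / p)) epowr p \<le> ?B epowr p" using p_pos by (intro epowr_mono) auto
      then show ?thesis using p_pos by (simp add: epowr_epowr)
    qed
    have N_le': "N s \<le> ?D * ?\<Gamma> * ?B epowr p" if s: "0 < s" for s
    proof -
      have "N (2 * (s / 2)) \<le> ?D * (\<Sum>k. \<gamma> k * \<mu> (2 ^ k * (s / 2)))" using s by (intro N_le) simp
      also have "\<dots> \<le> ?D * (\<Sum>k. \<gamma> k * ?B epowr p)"
        using s by (intro mult_left_mono suminf_le \<mu>_le) auto
      finally show ?thesis by (simp add: mult.assoc)
    qed
    have "lorentz_norm p \<infinity> v (maximal f)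
        = (SUP s\<in>{0<..}. ennreal s * emeasure (weighted v) {x. ennreal s < maximal f x} epowr (1 / p))"
      by (simp add: lorentz_norm_def)
    also have "\<dots> \<le> (?D * ?\<Gamma>) epowr (1 / p) * ?B"
    proof (rule SUP_least)
      fix s :: real assume "s \<in> {0<..}"
      then have s: "0 < s" by simp
      have "ennreal s * emeasure (weighted v) {x. ennreal s < maximal f x} epowr (1 / p) = N s epowr (1 / p)"
        using root[OF s] by (simp add: N_def epowr_mult)
      also have "\<dots> \<le> (?D * ?\<Gamma> * ?B epowr p) epowr (1 / p)"
        using p_pos by (intro epowr_mono N_le' s) auto
      also have "\<dots> = (?D * ?\<Gamma>) epowr (1 / p) * ?B"
        using p_pos by (simp add: epowr_mult epowr_epowr)
      finally show "ennreal s * emeasure (weighted v) {x. ennreal s < maximal f x} epowr (1 / p)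
        \<le> (?D * ?\<Gamma>) epowr (1 / p) * ?B" .
    qed
    finally show ?thesis using True by simp
  qed
  also have "\<dots> \<le> (?D * ennreal (1 + 2 / (p - P))) epowr (1 / p) * lorentz_norm p q w (\<lambda>x. ennreal \<bar>f x\<bar>)"
    using p_pos by (intro mult_right_mono epowr_mono mult_left_mono suminf_\<gamma>_le) auto
  finally show ?thesis .
qed

end


section \<open>The two-weight bound\<close>

lemma is_weight_measurable:
  fixes w :: "real ^ 'n \<Rightarrow> real"
  assumes "is_weight w"
  shows "w \<in> borel_measurable lebesgue"
proof (rule borel_measurable_LIMSEQ_real)
  fix n :: nat
  have "w absolutely_integrable_on cball 0 (real n)"
    using assms by (simp add: is_weight_def)
  then show "(\<lambda>x. indicator (cball 0 (real n)) x *\<^sub>R w x) \<in> borel_measurable lebesgue"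
    by (simp add: set_integrable_def borel_measurable_integrable)
next
  fix x :: "real ^ 'n"
  obtain m :: nat where "norm x \<le> real m" using real_arch_simple by blast
  then have "eventually (\<lambda>n. indicator (cball 0 (real n)) x *\<^sub>R w x = w x) sequentially"
    by (intro eventually_sequentiallyI[of m]) auto
  then show "(\<lambda>n. indicator (cball 0 (real n)) x *\<^sub>R w x) \<longlonglongrightarrow> w x"
    by (rule tendsto_eventually)
qed

lemma is_weight_finite:
  assumes "is_weight w" "Q \<in> cubes"
  shows "(\<integral>\<^sup>+x\<in>Q. ennreal \<bar>w x\<bar> \<partial>lebesgue) \<noteq> top"
proof -
  have "w absolutely_integrable_on Q"
    using assms by (auto simp: is_weight_def cubes_def)
  then have "integrable lebesgue (\<lambda>x. indicator Q x *\<^sub>R w x)" by (simp add: set_integrable_def)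
  then have "(\<integral>\<^sup>+x. ennreal (norm (indicator Q x *\<^sub>R w x)) \<partial>lebesgue) < \<infinity>"
    by (simp add: integrable_iff_bounded)
  also have "(\<integral>\<^sup>+x. ennreal (norm (indicator Q x *\<^sub>R w x)) \<partial>lebesgue) = (\<integral>\<^sup>+x\<in>Q. ennreal \<bar>w x\<bar> \<partial>lebesgue)"
    by (intro nn_integral_cong) (auto split: split_indicator)
  finally show ?thesis by simp
qed

lemma is_weight_avg_neq_0:
  assumes "is_weight w" "Q \<in> cubes"
  shows "avg Q w \<noteq> 0"
  using nn_integral_cube_neq_0[OF is_weight_measurable[OF assms(1)] _ assms(2)] assms emeasure_cubes[OF assms(2)]
  by (auto simp: avg_def is_weight_def ennreal_divide_eq_0_iff)

lemma Ap_const_neq_0: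
  fixes v w :: "real ^ 'n \<Rightarrow> real"
  assumes "is_weight v" "is_weight (dual_weight p w)"
  shows "Ap_const p v w \<noteq> 0"
proof -
  define Q where "Q = cube (0 :: real ^ 'n) 1"
  have Q: "Q \<in> cubes" by (simp add: Q_def)
  have "avg Q v * avg Q (dual_weight p w) epowr (p - 1) \<noteq> 0"
    using is_weight_avg_neq_0[OF assms(1) Q] is_weight_avg_neq_0[OF assms(2) Q] by simp
  moreover have "avg Q v * avg Q (dual_weight p w) epowr (p - 1) \<le> Ap_const p v w"
    unfolding Ap_const_def using Q by (rule SUP_upper)
  ultimately show ?thesis by auto
qed

text \<open>
  The gain of integrability of \<open>\<sigma>\<close> turns the \<open>A\<^sub>p\<close> condition into the \<open>A\<^sub>P\<close> condition: \<open>P\<close> is chosen such that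
  \<open>(1 + d) (P - 1) = p - 1\<close>, and so the averages of \<open>\<sigma>\<close> appear with the right power.
\<close>

lemma Ap_cube_bound:
  fixes v \<sigma> :: "real ^ 'n \<Rightarrow> real"
  assumes v: "is_weight v" and Q: "Q \<in> cubes" and p: "1 < p" and d: "0 < d"
    and ap: "Ap_const p v w = A" "dual_weight p w = \<sigma>"
    and rh: "(\<integral>\<^sup>+x\<in>Q. ennreal (\<tau> x) \<partial>lebesgue) \<le> 2 * emeasure lebesgue Q * avg Q \<sigma> epowr (1 + d)"
    and P: "P = 1 + (p - 1) / (1 + d)"
  shows "emeasure (weighted v) Q * (\<integral>\<^sup>+x\<in>Q. ennreal (\<tau> x) \<partial>lebesgue) epowr (P - 1)
    \<le> ennreal (2 powr (P - 1)) * A * emeasure lebesgue Q epowr P"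
proof -
  let ?m = "emeasure lebesgue Q"
  have m: "?m \<noteq> 0" "?m \<noteq> top" "Q \<in> sets lebesgue" using emeasure_cubes[OF Q] by auto
  have P1: "0 < P - 1" "(1 + d) * (P - 1) = p - 1" using p d by (auto simp: P)
  have vQ: "emeasure (weighted v) Q = avg Q v * ?m"
    using v m emeasure_weighted[OF is_weight_measurable[OF v] m(3)]
    by (simp add: is_weight_def avg_def ennreal_divide_times ennreal_divide_self less_top)
  have "emeasure (weighted v) Q * (\<integral>\<^sup>+x\<in>Q. ennreal (\<tau> x) \<partial>lebesgue) epowr (P - 1)
      \<le> avg Q v * ?m * (2 * ?m * avg Q \<sigma> epowr (1 + d)) epowr (P - 1)"
    unfolding vQ using P1 by (intro mult_left_mono epowr_mono rh) auto
  also have "(2 * ?m * avg Q \<sigma> epowr (1 + d)) epowr (P - 1)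
      = ennreal (2 powr (P - 1)) * ?m epowr (P - 1) * avg Q \<sigma> epowr (p - 1)"
    using epowr_ennreal[of 2 "P - 1"] P1(2) by (simp add: epowr_mult epowr_epowr)
  also have "avg Q v * ?m * (ennreal (2 powr (P - 1)) * ?m epowr (P - 1) * avg Q \<sigma> epowr (p - 1))
      = ennreal (2 powr (P - 1)) * (avg Q v * avg Q \<sigma> epowr (p - 1)) * (?m * ?m epowr (P - 1))"
    by (simp only: mult_ac)
  also have "?m * ?m epowr (P - 1) = ?m epowr P"
    using epowr_add[of ?m 1 "P - 1"] by simp
  also have "ennreal (2 powr (P - 1)) * (avg Q v * avg Q \<sigma> epowr (p - 1)) * ?m epowr P
      \<le> ennreal (2 powr (P - 1)) * A * ?m epowr P"
  proof (intro mult_right_mono mult_left_mono)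
    show "avg Q v * avg Q \<sigma> epowr (p - 1) \<le> A"
      unfolding ap(1)[symmetric] ap(2)[symmetric] Ap_const_def using Q by (rule SUP_upper)
  qed auto
  finally show ?thesis .
qed

text \<open>
  The functions of vanishing quasinorm cause no trouble, since \<open>0 / 0 = 0\<close> in the extended nonnegative reals.
\<close>

lemma maximal_norm_leI:
  assumes "\<And>f. f \<in> borel_measurable lebesgue \<Longrightarrow>
    lorentz_norm p q v (maximal f) \<le> R * lorentz_norm p q w (\<lambda>x. ennreal \<bar>f x\<bar>)"
  shows "maximal_norm p q w v \<le> R"
  unfolding maximal_norm_def
proof (rule SUP_least)
  fix f assume "f \<in> {f \<in> lorentz_space p q w. \<not> (AE x in lebesgue. f x = 0)}"
  then have f: "f \<in> borel_measurable lebesgue" "lorentz_norm p q w (\<lambda>x. ennreal \<bar>f x\<bar>) < top"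
    by (auto simp: lorentz_space_def)
  show "lorentz_norm p q v (maximal f) / lorentz_norm p q w (\<lambda>x. ennreal \<bar>f x\<bar>) \<le> R"
  proof (cases "lorentz_norm p q w (\<lambda>x. ennreal \<bar>f x\<bar>) = 0")
    case True
    then show ?thesis using assms[OF f(1)] by simp
  next
    case False
    then show ?thesis using assms[OF f(1)] f(2)
      by (intro divide_le_posI_ennreal) (auto simp: mult.commute zero_less_iff_neq_zero)
  qed
qed

lemma one_plus_powr_inverse_le:
  assumes "0 < q"
  shows "(1 + q) powr (1 / q) \<le> (3 :: real)"
proof -
  have "(1 + q) powr (1 / q) \<le> exp q powr (1 / q)"
    using assms by (intro powr_mono2) (auto simp: add.commute)
  also have "\<dots> = exp 1" using assms by (simp add: powr_def)
  also have "\<dots> \<le> 3" by (rule exp_le)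
  finally show ?thesis .
qed

text \<open>
  The reverse Hoelder inequality supplies \<open>\<tau> = \<sigma>\<^bsup>1 + d\<^esup>\<close> as dual weight of \<open>w\<close> for the exponent \<open>P\<close>, because
  \<open>(1 - p') (1 + d) (1 - P) = 1\<close>.
\<close>

lemma dyadic_distribution_bound_of_Ap:
  fixes v w f :: "real ^ 'n \<Rightarrow> real" and T :: real
  assumes p: "1 < p" and ap: "(v, w) \<in> Ap p" and \<sigma>: "is_weight (dual_weight p w)"
    and T: "A_infty_const (dual_weight p w) = ennreal T" "1 \<le> T"
    and d: "d = 1 / (2 ^ (CARD('n) + 2) * T)" and P: "P = 1 + (p - 1) / (1 + d)"
    and f: "f \<in> borel_measurable lebesgue"
  shows "dyadic_distribution_bound p P
    (ennreal (2 powr (P - 1)) * Ap_const p v w * ennreal (2 * 3 ^ CARD('n)) epowr P) v w f"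
proof
  have d0: "0 < d" using T by (simp add: d)
  have "(p - 1) * 1 < (p - 1) * (1 + d)" using p d0 by (intro mult_strict_left_mono) auto
  then show "0 < P" "P < p" using p d0 by (auto simp: P field_simps add_pos_pos)
  have P1: "1 < P" using p d0 by (simp add: P)
  show "f \<in> borel_measurable lebesgue" by (rule f)
  fix s :: real assume s: "0 < s"
  define \<sigma>' where "\<sigma>' = dual_weight p w"
  define \<tau> where "\<tau> x = \<bar>\<sigma>' x\<bar> powr (1 + d)" for x
  have vw: "is_weight v" "is_weight w" using ap by (auto simp: Ap_def)
  note [measurable] = is_weight_measurable[OF vw(2)] is_weight_measurable[OF \<sigma>, folded \<sigma>'_def]
  have pos\<sigma>: "AE x in lebesgue. 0 < \<sigma>' x" using \<sigma> by (simp add: is_weight_def \<sigma>'_def)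
  have posw: "AE x in lebesgue. 0 < w x" using vw by (simp add: is_weight_def)
  show "emeasure (weighted v) {x. ennreal (2 * s) < maximal f x}
    \<le> ennreal (2 powr (P - 1)) * Ap_const p v w * ennreal (2 * 3 ^ CARD('n)) epowr P *
      (\<Sum>k. ennreal ((2 ^ k) powr P) * emeasure (weighted w) {x. ennreal (2 ^ k * s) < ennreal \<bar>f x\<bar>})"
  proof (rule maximal_distribution_le[where \<tau> = \<tau>])
    show "sets (weighted v) = sets lebesgue" by (simp add: weighted_def)
    show "\<tau> \<in> borel_measurable lebesgue" unfolding \<tau>_def by measurable
    show "AE x in lebesgue. 0 < \<tau> x" using pos\<sigma> by eventually_elim (simp add: \<tau>_def)
    show "AE x in lebesgue. w x = \<tau> x powr (1 - P)"
      using posw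
    proof eventually_elim
      case (elim x)
      have "(1 - conj_exp p) * ((1 + d) * (1 - P)) = 1"
      proof -
        have "1 - conj_exp p = - 1 / (p - 1)" using p by (simp add: conj_exp_def field_simps)
        moreover have "(1 + d) * (1 - P) = - (p - 1)" using d0 by (simp add: P)
        ultimately show ?thesis using p by (simp add: divide_eq_eq)
      qed
      then show ?case using elim by (simp add: \<tau>_def \<sigma>'_def dual_weight_def powr_powr mult.assoc)
    qed
    fix Q :: "(real ^ 'n) set" assume Q: "Q \<in> cubes"
    have "(\<integral>\<^sup>+x\<in>Q. ennreal (\<tau> x) \<partial>lebesgue) \<le> 2 * emeasure lebesgue Q * avg Q \<sigma>' epowr (1 + d)"
      using reverse_Hoelder[OF _ pos\<sigma> is_weight_finite[OF \<sigma>, folded \<sigma>'_def] T[folded \<sigma>'_def] d Q]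
      by (simp add: \<tau>_def epowr_ennreal)
    then show "emeasure (weighted v) Q * (\<integral>\<^sup>+x\<in>Q. ennreal (\<tau> x) \<partial>lebesgue) epowr (P - 1)
      \<le> ennreal (2 powr (P - 1)) * Ap_const p v w * emeasure lebesgue Q epowr P"
      by (rule Ap_cube_bound[OF vw(1) Q p d0 refl \<sigma>'_def[symmetric] _ P])
  qed (use s P1 f in auto)
qed

lemma lorentz_constant_le:
  assumes "1 < p" "1 \<le> P" "P \<le> p"
  shows "(ennreal (2 powr p) * (ennreal (2 powr (P - 1)) * A * ennreal (2 * 3 ^ n) epowr P)) epowr (1 / p)
    \<le> ennreal (8 * 3 ^ n) * A epowr (1 / p)"
proof -
  have "2 powr p * 2 powr (P - 1) * (2 * 3 ^ n) powr P \<le> 2 powr p * 2 powr p * (2 * 3 ^ n) powr p"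
    using assms by (intro mult_mono powr_mono) (auto intro: order_trans[of _ "2 * 1"] one_le_power)
  also have "\<dots> = (8 * 3 ^ n) powr p"
    by (simp flip: powr_mult)
  finally have "ennreal (2 powr p * 2 powr (P - 1) * (2 * 3 ^ n) powr P) \<le> ennreal ((8 * 3 ^ n) powr p)"
    by (rule ennreal_leI)
  then have "(ennreal (2 powr p * 2 powr (P - 1) * (2 * 3 ^ n) powr P) * A) epowr (1 / p)
      \<le> (ennreal ((8 * 3 ^ n) powr p) * A) epowr (1 / p)"
    using assms by (intro epowr_mono mult_right_mono) auto
  also have "\<dots> = ennreal (8 * 3 ^ n) * A epowr (1 / p)"
    using assms by (simp add: epowr_mult epowr_ennreal powr_powr)
  finally have le: "(ennreal (2 powr p * 2 powr (P - 1) * (2 * 3 ^ n) powr P) * A) epowr (1 / p)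
    \<le> ennreal (8 * 3 ^ n) * A epowr (1 / p)" .
  have "ennreal (2 * 3 ^ n) epowr P = ennreal ((2 * 3 ^ n) powr P)"
    by (rule epowr_ennreal) simp
  then have "ennreal (2 powr p) * (ennreal (2 powr (P - 1)) * A * ennreal (2 * 3 ^ n) epowr P)
      = ennreal (2 powr p * 2 powr (P - 1) * (2 * 3 ^ n) powr P) * A"
    by (simp only: ennreal_mult powr_ge_zero mult_nonneg_nonneg mult_ac)
  then show ?thesis using le by simp
qed

text \<open>
  The number \<open>X\<close> dominates both \<open>1 + 2 / (p - P)\<close> and \<open>2 p / (p - P)\<close>, the two forms in which the gap enters.
\<close>

lemma
  fixes v w f :: "real ^ 'n \<Rightarrow> real" and T :: real
  assumes p: "1 < p" and ap: "(v, w) \<in> Ap p" and \<sigma>: "is_weight (dual_weight p w)"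
    and T: "A_infty_const (dual_weight p w) = ennreal T" "1 \<le> T"
    and f: "f \<in> borel_measurable lebesgue"
    and X: "X = 2 ^ (CARD('n) + 4) * T * conj_exp p"
  shows lorentz_norm_maximal_le_Ap_large: "ennreal p \<le> q \<Longrightarrow> lorentz_norm p q v (maximal f)
      \<le> ennreal (8 * 3 ^ CARD('n)) * Ap_const p v w epowr (1 / p) * ennreal X epowr (1 / p)
        * lorentz_norm p q w (\<lambda>x. ennreal \<bar>f x\<bar>)"
    and lorentz_norm_maximal_le_Ap_small: "0 < r \<Longrightarrow> r \<le> p \<Longrightarrow> lorentz_norm p (ennreal r) v (maximal f)
      \<le> ennreal (8 * 3 ^ CARD('n)) * Ap_const p v w epowr (1 / p) * ennreal (1 + X / r) epowr (1 / r)
        * lorentz_norm p (ennreal r) w (\<lambda>x. ennreal \<bar>f x\<bar>)"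
proof -
  define d where "d = 1 / (2 ^ (CARD('n) + 2) * T)"
  define P where "P = 1 + (p - 1) / (1 + d)"
  define D where "D = ennreal (2 powr (P - 1)) * Ap_const p v w * ennreal (2 * 3 ^ CARD('n)) epowr P"
  have d: "0 < d" "d \<le> 1"
  proof -
    have "1 * 1 \<le> (2 ^ (CARD('n) + 2)) * T" using T by (intro mult_mono one_le_power) auto
    then show "0 < d" "d \<le> 1" using T by (auto simp: d_def divide_le_eq)
  qed
  interpret dyadic_distribution_bound p P D v w f
    unfolding D_def by (rule dyadic_distribution_bound_of_Ap[OF p ap \<sigma> T d_def P_def f])
  have "1 \<le> P" using p d by (simp add: P_def)
  then have const: "(ennreal (2 powr p) * D) epowr (1 / p)
      \<le> ennreal (8 * 3 ^ CARD('n)) * Ap_const p v w epowr (1 / p)"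
    unfolding D_def using p P by (intro lorentz_constant_le) auto
  have p': "conj_exp p = p / (p - 1)" "conj_exp p = 1 + 1 / (p - 1)"
    using p by (auto simp: conj_exp_def field_simps)
  define Y where "Y = 2 ^ (CARD('n) + 4) * T"
  have Y: "1 \<le> Y"
    unfolding Y_def using T mult_mono[of 1 "2 ^ (CARD('n) + 4)" 1 T] one_le_power[of "2::real" "CARD('n) + 4"] by simp
  have gap: "2 / (p - P) \<le> Y / (p - 1)"
  proof -
    have "p - P = (p - 1) * d / (1 + d)" using d by (simp add: P_def field_simps)
    then have "2 / (p - P) = 2 / ((p - 1) * d / (1 + d))" by simp
    also have "\<dots> = 2 * (1 + d) / d / (p - 1)" using d by simp
    also have "\<dots> \<le> 4 / d / (p - 1)" using p d by (intro divide_right_mono) auto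
    also have "4 / d = Y" using T by (simp add: d_def Y_def power_add)
    finally show ?thesis .
  qed
  show "lorentz_norm p q v (maximal f)
      \<le> ennreal (8 * 3 ^ CARD('n)) * Ap_const p v w epowr (1 / p) * ennreal X epowr (1 / p)
        * lorentz_norm p q w (\<lambda>x. ennreal \<bar>f x\<bar>)" if q: "ennreal p \<le> q"
  proof -
    have "1 + 2 / (p - P) \<le> Y + Y / (p - 1)" using gap Y by (intro add_mono)
    also have "\<dots> = X" by (simp add: X Y_def p'(2) algebra_simps)
    finally have "ennreal (1 + 2 / (p - P)) epowr (1 / p) \<le> ennreal X epowr (1 / p)"
      using p by (intro epowr_mono ennreal_leI) auto
    then have "(ennreal (2 powr p) * D * ennreal (1 + 2 / (p - P))) epowr (1 / p)
        \<le> ennreal (8 * 3 ^ CARD('n)) * Ap_const p v w epowr (1 / p) * ennreal X epowr (1 / p)"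
      unfolding epowr_mult[of "ennreal (2 powr p) * D"] by (intro mult_mono const) auto
    then show ?thesis
      using lorentz_norm_maximal_le_large[OF q] by (meson mult_right_mono order_trans zero_le)
  qed
  show "lorentz_norm p (ennreal r) v (maximal f)
      \<le> ennreal (8 * 3 ^ CARD('n)) * Ap_const p v w epowr (1 / p) * ennreal (1 + X / r) epowr (1 / r)
        * lorentz_norm p (ennreal r) w (\<lambda>x. ennreal \<bar>f x\<bar>)" if r: "0 < r" "r \<le> p"
  proof -
    have "2 * p / ((p - P) * r) = 2 / (p - P) * (p / r)" by simp
    also have "\<dots> \<le> Y / (p - 1) * (p / r)" using gap p r by (intro mult_right_mono) auto
    also have "\<dots> = X / r" by (simp add: X Y_def p'(1))
    finally have "ennreal (1 + 2 * p / ((p - P) * r)) epowr (1 / r) \<le> ennreal (1 + X / r) epowr (1 / r)"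
      using r by (intro epowr_mono ennreal_leI) auto
    then have "(ennreal (2 powr p) * D) epowr (1 / p) * ennreal (1 + 2 * p / ((p - P) * r)) epowr (1 / r)
        \<le> ennreal (8 * 3 ^ CARD('n)) * Ap_const p v w epowr (1 / p) * ennreal (1 + X / r) epowr (1 / r)"
      by (intro mult_mono const) auto
    then show ?thesis
      using lorentz_norm_maximal_le_small[OF r] by (meson mult_right_mono order_trans zero_le)
  qed
qed

theorem corollary2p3:
  shows "\<exists>c C :: real. 1 \<le> c \<and> 0 < C \<and>
    (\<forall>(p :: real) (q :: ennreal) (v :: real ^ 'n \<Rightarrow> real) (w :: real ^ 'n \<Rightarrow> real).
      1 < p \<longrightarrow> 0 < q \<longrightarrow> (v, w) \<in> Ap p \<longrightarrow> dual_weight p w \<in> A_infty \<longrightarrow>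
        (ennreal p \<le> q \<longrightarrow>
          maximal_norm p q w v
            \<le> ennreal (C * c * conj_exp p) * Ap_const p v w epowr (1 / p)
              * A_infty_const (dual_weight p w) epowr (1 / p)) \<and>
        (q \<le> ennreal p \<longrightarrow>
          maximal_norm p q w v
            \<le> ennreal (C * (4 * c / enn2real q) powr (1 / enn2real q)
                         * conj_exp p powr (1 / enn2real q))
              * Ap_const p v w epowr (1 / p)
              * A_infty_const (dual_weight p w) epowr (1 / enn2real q)))"
proof -
  define c C :: real where "c = 2 ^ (CARD('n) + 4)" and "C = 24 * 3 ^ CARD('n)"
  have c: "1 \<le> c" unfolding c_def by (rule one_le_power) simp
  have C: "0 < C" by (simp add: C_def)
  show ?thesis
  proof (rule exI[of _ c], rule exI[of _ C], intro conjI c C allI impI)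
    fix p :: real and q :: ennreal and v w :: "real ^ 'n \<Rightarrow> real"
    assume p: "1 < p" and q: "0 < q" and ap: "(v, w) \<in> Ap p" and "dual_weight p w \<in> A_infty"
    then have \<sigma>: "is_weight (dual_weight p w)" by (auto simp: A_infty_def Ap_def)
    let ?A = "Ap_const p v w" and ?S = "A_infty_const (dual_weight p w)"
    have p': "1 < conj_exp p" using p by (simp add: conj_exp_def)
    have A: "?A \<noteq> 0" using ap by (intro Ap_const_neq_0 \<sigma>) (simp add: Ap_def)
    have S1: "1 \<le> ?S"
      using \<sigma> by (intro A_infty_const_ge_1 is_weight_measurable is_weight_finite) (auto simp: is_weight_def)
    show "maximal_norm p q w v \<le> ennreal (C * c * conj_exp p) * ?A epowr (1 / p) * ?S epowr (1 / p)"
      if pq: "ennreal p \<le> q"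
    proof (cases "?S = top")
      \<comment> \<open>if the Fujii--Wilson constant is infinite, so is the right-hand side, since \<open>[v, w]\<close> is positive\<close>
      case True
      then show ?thesis using A C c p' by (simp add: ennreal_mult_top)
    next
      case False
      then obtain T where T: "?S = ennreal T" "0 \<le> T" by (cases ?S) auto
      have T1: "1 \<le> T" using S1 T by simp
      have cp: "1 \<le> c * conj_exp p" using mult_mono[of 1 c 1 "conj_exp p"] c p' by simp
      show ?thesis
      proof (rule maximal_norm_leI)
        fix f :: "real ^ 'n \<Rightarrow> real" assume f: "f \<in> borel_measurable lebesgue"
        have "ennreal (c * T * conj_exp p) epowr (1 / p) = ennreal ((c * conj_exp p) powr (1 / p)) * ?S epowr (1 / p)"
          using T T1 c p' by (simp add: epowr_ennreal powr_mult mult_ac flip: ennreal_mult)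
        also have "\<dots> \<le> ennreal (c * conj_exp p) * ?S epowr (1 / p)"
          using cp p powr_mono[of "1 / p" 1 "c * conj_exp p"]
          by (intro mult_right_mono ennreal_leI) auto
        finally have "ennreal (8 * 3 ^ CARD('n)) * ?A epowr (1 / p) * ennreal (c * T * conj_exp p) epowr (1 / p)
            \<le> ennreal C * ?A epowr (1 / p) * (ennreal (c * conj_exp p) * ?S epowr (1 / p))"
          by (intro mult_mono ennreal_leI) (auto simp: C_def)
        also have "\<dots> = ennreal (C * c * conj_exp p) * ?A epowr (1 / p) * ?S epowr (1 / p)"
          using C c p' by (simp add: ennreal_mult mult_ac)
        finally show "lorentz_norm p q v (maximal f) \<le>
            ennreal (C * c * conj_exp p) * ?A epowr (1 / p) * ?S epowr (1 / p)
              * lorentz_norm p q w (\<lambda>x. ennreal \<bar>f x\<bar>)"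
          using lorentz_norm_maximal_le_Ap_large[OF p ap \<sigma> T(1) T1 f refl pq]
          unfolding c_def by (meson mult_right_mono order_trans zero_le)
      qed
    qed
    show "maximal_norm p q w v \<le> ennreal (C * (4 * c / enn2real q) powr (1 / enn2real q)
          * conj_exp p powr (1 / enn2real q)) * ?A epowr (1 / p) * ?S epowr (1 / enn2real q)"
      if pq: "q \<le> ennreal p"
    proof -
      obtain r where r': "q = ennreal r" "0 \<le> r" using pq by (cases q) (auto simp: top_unique)
      then have r: "q = ennreal r" "enn2real q = r" "0 < r" "r \<le> p" using q pq p by auto
      show ?thesis
      proof (cases "?S = top")
        case True
        then show ?thesis using A C c p' r by (simp add: ennreal_mult_top)
      next
        case False
        then obtain T where T: "?S = ennreal T" "0 \<le> T" by (cases ?S) auto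
        have T1: "1 \<le> T" using S1 T by simp
        define X where "X = c * T * conj_exp p"
        have X: "1 \<le> X"
          unfolding X_def using mult_mono[of 1 c 1 T] mult_mono[of 1 "c * T" 1 "conj_exp p"] c T1 p' by simp
        \<comment> \<open>replacing \<open>1 + X / r\<close> by a multiple of \<open>X / r\<close> costs \<open>(1 + r)\<^bsup>1 / r\<^esup>\<close>, which is bounded\<close>
        have "X / r \<le> 4 * X / r" using X r by (intro divide_right_mono) auto
        moreover have "(1 + r) * (4 * X / r) = 4 * X / r + 4 * X" using r by (simp add: field_simps)
        ultimately have "1 + X / r \<le> (1 + r) * (4 * X / r)" using X by linarith
        then have "(1 + X / r) powr (1 / r) \<le> ((1 + r) * (4 * X / r)) powr (1 / r)"
          using X r by (intro powr_mono2) auto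
        also have "\<dots> = (1 + r) powr (1 / r) * (4 * X / r) powr (1 / r)"
          using X r by (intro powr_mult)
        also have "\<dots> \<le> 3 * (4 * X / r) powr (1 / r)"
          using r by (intro mult_right_mono one_plus_powr_inverse_le) auto
        also have "4 * X / r = (4 * c / r) * conj_exp p * T" by (simp add: X_def)
        also have "((4 * c / r) * conj_exp p * T) powr (1 / r)
            = (4 * c / r) powr (1 / r) * conj_exp p powr (1 / r) * T powr (1 / r)"
          by (simp only: powr_mult)
        finally have "ennreal ((1 + X / r) powr (1 / r))
            \<le> ennreal (3 * ((4 * c / r) powr (1 / r) * conj_exp p powr (1 / r) * T powr (1 / r)))"
          by (rule ennreal_leI)
        also have "\<dots> = ennreal (3 * ((4 * c / r) powr (1 / r) * conj_exp p powr (1 / r))) * ?S epowr (1 / r)"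
          using T by (simp add: epowr_ennreal mult.assoc flip: ennreal_mult)
        also have "ennreal ((1 + X / r) powr (1 / r)) = ennreal (1 + X / r) epowr (1 / r)"
          using X r by (intro epowr_ennreal[symmetric]) simp
        finally have le: "ennreal (1 + X / r) epowr (1 / r)
            \<le> ennreal (3 * ((4 * c / r) powr (1 / r) * conj_exp p powr (1 / r))) * ?S epowr (1 / r)" .
        show ?thesis
        proof (rule maximal_norm_leI)
          fix f :: "real ^ 'n \<Rightarrow> real" assume f: "f \<in> borel_measurable lebesgue"
          have "ennreal (8 * 3 ^ CARD('n)) * ?A epowr (1 / p) * ennreal (1 + X / r) epowr (1 / r)
              \<le> ennreal (8 * 3 ^ CARD('n)) * ?A epowr (1 / p) *
                (ennreal (3 * ((4 * c / r) powr (1 / r) * conj_exp p powr (1 / r))) * ?S epowr (1 / r))"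
            by (intro mult_left_mono le) simp
          also have "\<dots> = (ennreal (8 * 3 ^ CARD('n)) * ennreal (3 * ((4 * c / r) powr (1 / r) * conj_exp p powr (1 / r))))
              * ?A epowr (1 / p) * ?S epowr (1 / r)"
            by (simp only: mult_ac)
          also have "ennreal (8 * 3 ^ CARD('n)) * ennreal (3 * ((4 * c / r) powr (1 / r) * conj_exp p powr (1 / r)))
              = ennreal (C * (4 * c / r) powr (1 / r) * conj_exp p powr (1 / r))"
            by (simp add: C_def mult.assoc flip: ennreal_mult)
          finally show "lorentz_norm p q v (maximal f)
              \<le> ennreal (C * (4 * c / enn2real q) powr (1 / enn2real q) * conj_exp p powr (1 / enn2real q))
                * ?A epowr (1 / p) * ?S epowr (1 / enn2real q) * lorentz_norm p q w (\<lambda>x. ennreal \<bar>f x\<bar>)"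
            using lorentz_norm_maximal_le_Ap_small[OF p ap \<sigma> T(1) T1 f X_def[unfolded c_def] r(3,4)]
            unfolding r(2) unfolding r(1) by (meson mult_right_mono order_trans zero_le)
        qed
      qed
    qed
  qed
qed

end
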